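(* Let $H=\{H_\alpha\}_{\alpha\in\pi}$ be a Hopf $\pi$-coalgebra, let $(C,\sigma)$ be a Hopf $\pi$-subcoalgebra of $H$ which has a left section $g=\{g_\alpha\}_{\alpha\in\pi}$, and let $V=\{V_\alpha\}_{\alpha\in\pi}$ be a right $\pi$-comodule over $C$ with coaction $\rho=\{\rho_{\alpha,\beta}\}$. If $H$ has a left cosection, then $Ind(\rho)$ is isomorphic, as a right $B$-module, to $V\otimes B=\{(V\otimes B)_\alpha=V_1\otimes B_\alpha\}_{\alpha\in\pi}$; that is, for each $\alpha\in\pi$ there is an isomorphism of right $B_\alpha$-modules $V_1\otimes B_\alpha\cong Ind(\rho)_\alpha$.
   Context: Everything is over a field $K$: spaces, linear maps, tensor products; algebras are associative and unital. $I$ denotes identity maps. $\pi$ is a group with neutral element $1$. A $\pi$-coalgebra is a family $C=\{C_\alpha\}_{\alpha\in\pi}$ of $K$-spaces with linear maps $\Delta_{\alpha,\beta}:C_{\alpha\beta}\to C_\alpha\otimes C_\beta$ and $\epsilon:C_1\to K$ such that $(\Delta_{\alpha,\beta}\otimes I)\Delta_{\alpha\beta,\gamma}=(I\otimes\Delta_{\beta,\gamma})\Delta_{\alpha,\beta\gamma}$ and $(\epsilon\otimes I)\Delta_{1,\alpha}=I=(I\otimes\epsilon)\Delta_{\alpha,1}$ (identifying $K\otimes C_\alpha\cong C_\alpha\cong C_\alpha\otimes K$). A Hopf $\pi$-coalgebra is a $\pi$-coalgebra $H=\{H_\alpha\}$ with linear maps $S_\alpha:H_\alpha\to H_{\alpha^{-1}}$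 such that each $H_\alpha$ is an algebra (multiplication $\mu_\alpha$, unit $1_\alpha$), all $\Delta_{\alpha,\beta}$ and $\epsilon$ are algebra maps, and $\mu_\alpha(S_{\alpha^{-1}}\otimes I)\Delta_{\alpha^{-1},\alpha}=1_\alpha\epsilon=\mu_\alpha(I\otimes S_{\alpha^{-1}})\Delta_{\alpha,\alpha^{-1}}$. A right $\pi$-comodule over a $\pi$-coalgebra $C$ is a family $M=\{M_\alpha\}$ of spaces with linear maps $\theta_{\alpha,\beta}:M_{\alpha\beta}\to M_\alpha\otimes C_\beta$ such that $(\theta_{\alpha,\beta}\otimes I)\theta_{\alpha\beta,\gamma}=(I\otimes\Delta_{\beta,\gamma})\theta_{\alpha,\beta\gamma}$ and $(I\otimes\epsilon)\theta_{\alpha,1}=I$ (up to $M_\alpha\otimes K\cong M_\alpha$). A Hopf $\pi$-subcoalgebra of $H$ is a pair $(C,\sigma)$ where $C$ is a Hopf $\pi$-coalgebra and $\sigma=\{\sigma_\alpha:H_\alpha\to C_\alpha\}$ is a family of surjective algebra maps with $\Delta^C_{\alpha,\beta}\sigma_{\alpha\beta}=(\sigma_\alpha\otimes\sigma_\beta)\Delta^H_{\alpha,\beta}$, $\epsilon^C\sigma_1=\epsilon^H$ and $S^C_\alpha\sigma_\alpha=\sigma_{\alpha^{-1}}S^H_\alpha$. Put $L_{\alpha,\beta}=(\sigma_\alpha\otimes I_{H_\beta})\Delta^H_{\alpha,\beta}:H_{\alpha\beta}\to C_\alpha\otimes H_\beta$. A family of linear maps $g=\{g_\alpha:C_\alpha\to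 H_\alpha\}$ is convolution invertible if there is a family of linear maps $g^{-1}=\{g_\alpha^{-1}:C_{\alpha^{-1}}\to H_\alpha\}$ with $\mu_\alpha(g_\alpha\otimes g_\alpha^{-1})\Delta^C_{\alpha,\alpha^{-1}}(c)=\epsilon^C(c)1_{H_\alpha}=\mu_\alpha(g_\alpha^{-1}\otimes g_\alpha)\Delta^C_{\alpha^{-1},\alpha}(c)$ for all $c\in C_1$. $(C,\sigma)$ has a left section if there is a convolution invertible family $g$ of linear maps $g_\alpha:C_\alpha\to H_\alpha$ with $g_\alpha(1)=1$ and $L_{1,\alpha}g_\alpha=(I_{C_1}\otimes g_\alpha)\Delta^C_{1,\alpha}$ for all $\alpha$. $H$ has a left cosection if there is a family of algebra maps $\eta=\{\eta_\alpha:H_1\to H_\alpha\}_{\alpha\in\pi}$ with $\Delta_{1,\alpha}\eta_\alpha=(I_{H_1}\otimes\eta_\alpha)\Delta_{1,1}$ for all $\alpha$. $B_\alpha=\{h\in H_\alpha: L_{1,\alpha}(h)=1_{C_1}\otimes h\}$, a subalgebra of $H_\alpha$; $B=\{B_\alpha\}$. The space $Ind(\rho)_\alpha=\{x\in V_1\otimes H_\alpha:(I_{V_1}\otimes L_{1,\alpha})(x)=(\rho_{1,1}\otimes I_{H_\alpha})(x)\}$ is a right $B_\alpha$-module by $(v\otimes h)\cdot b=v\otimes hb$ (extended linearly), and $V_1\otimes B_\alpha$ is a right $B_\alpha$-module by $(v\otimes b)\cdot k=v\otimes bk$. *)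

theory Defs
  imports "HOL-Algebra.Module" "HOL-Algebra.AbelCoset"
begin

section \<open>Linear maps and algebras over a field\<close>

text \<open>A family of $K$-spaces over an index set is a function into records of type
  \<^typ>\<open>('k, 'a) module\<close>; the spaces of one family share an element type but may have arbitrary
  carriers and operations. The multiplicative fields of the record matter only where the
  space is required to be an algebra.\<close>

definition linear_map ::
  "('k, 'm) ring_scheme \<Rightarrow> ('k, 'a) module \<Rightarrow> ('k, 'b) module \<Rightarrow> ('a \<Rightarrow> 'b) \<Rightarrow> bool" where
  "linear_map K M N f \<longleftrightarrow>
     f \<in> carrier M \<rightarrow> carrier N \<and>
     (\<forall>x\<in>carrier M. \<forall>y\<in>carrier M. f (x \<oplus>\<^bsub>M\<^esub> y) = f x \<oplus>\<^bsub>N\<^esub> f y) \<and>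
     (\<forall>a\<in>carrier K. \<forall>x\<in>carrier M. f (a \<odot>\<^bsub>M\<^esub> x) = a \<odot>\<^bsub>N\<^esub> f x)"

text \<open>The library locale \<^locale>\<open>algebra\<close> is restricted to commutative algebras.\<close>

definition assoc_algebra :: "('k, 'm) ring_scheme \<Rightarrow> ('k, 'a) module \<Rightarrow> bool" where
  "assoc_algebra K A \<longleftrightarrow>
     module K A \<and> ring A \<and>
     (\<forall>a\<in>carrier K. \<forall>x\<in>carrier A. \<forall>y\<in>carrier A.
        (a \<odot>\<^bsub>A\<^esub> x) \<otimes>\<^bsub>A\<^esub> y = a \<odot>\<^bsub>A\<^esub> (x \<otimes>\<^bsub>A\<^esub> y) \<and>
        x \<otimes>\<^bsub>A\<^esub> (a \<odot>\<^bsub>A\<^esub> y) = a \<odot>\<^bsub>A\<^esub> (x \<otimes>\<^bsub>A\<^esub> y))"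

definition algebra_map ::
  "('k, 'm) ring_scheme \<Rightarrow> ('k, 'a) module \<Rightarrow> ('k, 'b) module \<Rightarrow> ('a \<Rightarrow> 'b) \<Rightarrow> bool" where
  "algebra_map K A B f \<longleftrightarrow> linear_map K A B f \<and> f \<in> ring_hom A B"

definition base_algebra :: "('k, 'm) ring_scheme \<Rightarrow> ('k, 'k) module" where
  "base_algebra K =
     \<lparr>carrier = carrier K, mult = mult K, one = one K, zero = zero K, add = add K,
      smult = mult K\<rparr>"


section \<open>Tensor products\<close>

text \<open>The tensor product of $M$ and $N$ is the free module on the set
  \<^term>\<open>carrier M \<times> carrier N\<close> modulo the submodule generated by the bilinearity relations.\<close>

definition free_module :: "('k, 'm) ring_scheme \<Rightarrow> 'x set \<Rightarrow> ('k, 'x \<Rightarrow> 'k) module" where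
  "free_module K X =
     \<lparr>carrier = {f. (\<forall>x. f x \<in> carrier K) \<and> finite {x. f x \<noteq> \<zero>\<^bsub>K\<^esub>} \<and> {x. f x \<noteq> \<zero>\<^bsub>K\<^esub>} \<subseteq> X},
      mult = undefined, one = undefined,
      zero = (\<lambda>x. \<zero>\<^bsub>K\<^esub>),
      add = (\<lambda>f h x. f x \<oplus>\<^bsub>K\<^esub> h x),
      smult = (\<lambda>a f x. a \<otimes>\<^bsub>K\<^esub> f x)\<rparr>"

definition free_gen :: "('k, 'm) ring_scheme \<Rightarrow> 'x \<Rightarrow> 'x \<Rightarrow> 'k" where
  "free_gen K p = (\<lambda>x. if x = p then \<one>\<^bsub>K\<^esub> else \<zero>\<^bsub>K\<^esub>)"

abbreviation tensor_free ::
  "('k, 'm) ring_scheme \<Rightarrow> ('k, 'a) module \<Rightarrow> ('k, 'b) module \<Rightarrow> ('k, 'a \<times> 'b \<Rightarrow> 'k) module"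
  where "tensor_free K M N \<equiv> free_module K (carrier M \<times> carrier N)"

inductive_set tensor_gens ::
  "('k, 'm) ring_scheme \<Rightarrow> ('k, 'a) module \<Rightarrow> ('k, 'b) module \<Rightarrow> ('a \<times> 'b \<Rightarrow> 'k) set"
  for K :: "('k, 'm) ring_scheme" and M :: "('k, 'a) module" and N :: "('k, 'b) module" where
  add_left: "\<lbrakk>x \<in> carrier M; x' \<in> carrier M; y \<in> carrier N\<rbrakk> \<Longrightarrow>
     free_gen K (x \<oplus>\<^bsub>M\<^esub> x', y)
       \<ominus>\<^bsub>tensor_free K M N\<^esub> (free_gen K (x, y) \<oplus>\<^bsub>tensor_free K M N\<^esub> free_gen K (x', y))
     \<in> tensor_gens K M N"
| add_right: "\<lbrakk>x \<in> carrier M; y \<in> carrier N; y' \<in> carrier N\<rbrakk> \<Longrightarrow>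
     free_gen K (x, y \<oplus>\<^bsub>N\<^esub> y')
       \<ominus>\<^bsub>tensor_free K M N\<^esub> (free_gen K (x, y) \<oplus>\<^bsub>tensor_free K M N\<^esub> free_gen K (x, y'))
     \<in> tensor_gens K M N"
| smult_left: "\<lbrakk>a \<in> carrier K; x \<in> carrier M; y \<in> carrier N\<rbrakk> \<Longrightarrow>
     free_gen K (a \<odot>\<^bsub>M\<^esub> x, y)
       \<ominus>\<^bsub>tensor_free K M N\<^esub> (a \<odot>\<^bsub>tensor_free K M N\<^esub> free_gen K (x, y))
     \<in> tensor_gens K M N"
| smult_right: "\<lbrakk>a \<in> carrier K; x \<in> carrier M; y \<in> carrier N\<rbrakk> \<Longrightarrow>
     free_gen K (x, a \<odot>\<^bsub>N\<^esub> y)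
       \<ominus>\<^bsub>tensor_free K M N\<^esub> (a \<odot>\<^bsub>tensor_free K M N\<^esub> free_gen K (x, y))
     \<in> tensor_gens K M N"

definition tensor_rels ::
  "('k, 'm) ring_scheme \<Rightarrow> ('k, 'a) module \<Rightarrow> ('k, 'b) module \<Rightarrow> ('a \<times> 'b \<Rightarrow> 'k) set" where
  "tensor_rels K M N =
     \<Inter>{R. submodule R K (tensor_free K M N) \<and> tensor_gens K M N \<subseteq> R}"

type_synonym ('k, 'a, 'b) tensor = "('a \<times> 'b \<Rightarrow> 'k) set"

definition tensor_space ::
  "('k, 'm) ring_scheme \<Rightarrow> ('k, 'a) module \<Rightarrow> ('k, 'b) module
     \<Rightarrow> ('k, ('k, 'a, 'b) tensor) module" where
  "tensor_space K M N =
     \<lparr>carrier = a_rcosets\<^bsub>tensor_free K M N\<^esub> (tensor_rels K M N),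
      mult = undefined, one = undefined,
      zero = tensor_rels K M N,
      add = set_add (tensor_free K M N),
      smult = (\<lambda>a X. \<Union>f\<in>X. tensor_rels K M N +>\<^bsub>tensor_free K M N\<^esub>
                               (a \<odot>\<^bsub>tensor_free K M N\<^esub> f))\<rparr>"

definition pure_tensor ::
  "('k, 'm) ring_scheme \<Rightarrow> ('k, 'a) module \<Rightarrow> ('k, 'b) module \<Rightarrow> 'a \<Rightarrow> 'b
     \<Rightarrow> ('k, 'a, 'b) tensor" where
  "pure_tensor K M N x y = tensor_rels K M N +>\<^bsub>tensor_free K M N\<^esub> free_gen K (x, y)"

text \<open>The linear map out of a tensor product, with values in $P$, that is induced by a bilinear
  map \<open>b\<close>: a class represented by $\sum_i a_i (x_i, y_i)$ is sent to
  $\sum_i a_i\, b(x_i, y_i)$. For bilinear \<open>b\<close> the choice of the representative is irrelevant.\<close>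

definition tensor_lift ::
  "('k, 'm) ring_scheme \<Rightarrow> ('k, 'c) module \<Rightarrow> ('a \<Rightarrow> 'b \<Rightarrow> 'c) \<Rightarrow> ('k, 'a, 'b) tensor \<Rightarrow> 'c" where
  "tensor_lift K P b X =
     (let f = (SOME f. f \<in> X)
      in \<Oplus>\<^bsub>P\<^esub>p\<in>{p. f p \<noteq> \<zero>\<^bsub>K\<^esub>}. f p \<odot>\<^bsub>P\<^esub> b (fst p) (snd p))"

text \<open>The product is $(x \otimes y)(x' \otimes y') = xx' \otimes yy'$, extended bilinearly; it is
  meaningful when both factors are algebras.\<close>

definition tensor ::
  "('k, 'm) ring_scheme \<Rightarrow> ('k, 'a) module \<Rightarrow> ('k, 'b) module
     \<Rightarrow> ('k, ('k, 'a, 'b) tensor) module" where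
  "tensor K M N = (tensor_space K M N)
     \<lparr>mult := (\<lambda>X Y.
        tensor_lift K (tensor_space K M N) (\<lambda>x y.
          tensor_lift K (tensor_space K M N) (\<lambda>x' y'.
            pure_tensor K M N (x \<otimes>\<^bsub>M\<^esub> x') (y \<otimes>\<^bsub>N\<^esub> y')) Y) X),
      one := pure_tensor K M N \<one>\<^bsub>M\<^esub> \<one>\<^bsub>N\<^esub>\<rparr>"

text \<open>$f \otimes g$; the arguments \<open>M'\<close> and \<open>N'\<close> are the codomains of \<open>f\<close> and \<open>g\<close>.\<close>

definition tensor_map ::
  "('k, 'm) ring_scheme \<Rightarrow> ('k, 'c) module \<Rightarrow> ('k, 'd) module \<Rightarrow> ('a \<Rightarrow> 'c) \<Rightarrow> ('b \<Rightarrow> 'd)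
     \<Rightarrow> ('k, 'a, 'b) tensor \<Rightarrow> ('k, 'c, 'd) tensor" where
  "tensor_map K M' N' f g =
     tensor_lift K (tensor K M' N') (\<lambda>x y. pure_tensor K M' N' (f x) (g y))"

text \<open>The canonical identifications $(A \otimes B) \otimes C \cong A \otimes (B \otimes C)$,
  $K \otimes M \cong M$ and $M \otimes K \cong M$.\<close>

definition tensor_assoc ::
  "('k, 'm) ring_scheme \<Rightarrow> ('k, 'a) module \<Rightarrow> ('k, 'b) module \<Rightarrow> ('k, 'c) module
     \<Rightarrow> ('k, ('k, 'a, 'b) tensor, 'c) tensor \<Rightarrow> ('k, 'a, ('k, 'b, 'c) tensor) tensor" where
  "tensor_assoc K A B C =
     tensor_lift K (tensor K A (tensor K B C)) (\<lambda>X z.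
       tensor_lift K (tensor K A (tensor K B C)) (\<lambda>x y.
         pure_tensor K A (tensor K B C) x (pure_tensor K B C y z)) X)"

definition tensor_unit_left ::
  "('k, 'm) ring_scheme \<Rightarrow> ('k, 'a) module \<Rightarrow> ('k, 'k, 'a) tensor \<Rightarrow> 'a" where
  "tensor_unit_left K M = tensor_lift K M (\<lambda>a x. a \<odot>\<^bsub>M\<^esub> x)"

definition tensor_unit_right ::
  "('k, 'm) ring_scheme \<Rightarrow> ('k, 'a) module \<Rightarrow> ('k, 'a, 'k) tensor \<Rightarrow> 'a" where
  "tensor_unit_right K M = tensor_lift K M (\<lambda>x a. a \<odot>\<^bsub>M\<^esub> x)"

definition mult_map ::
  "('k, 'm) ring_scheme \<Rightarrow> ('k, 'a) module \<Rightarrow> ('k, 'a, 'a) tensor \<Rightarrow> 'a" where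
  "mult_map K A = tensor_lift K A (\<lambda>x y. x \<otimes>\<^bsub>A\<^esub> y)"


section \<open>Hopf group-coalgebras\<close>

text \<open>Throughout, \<open>G\<close> is the indexing group $\pi$.\<close>

record ('g, 'k, 'c) pi_coalg =
  component :: "'g \<Rightarrow> ('k, 'c) module"
  comult :: "'g \<Rightarrow> 'g \<Rightarrow> 'c \<Rightarrow> ('k, 'c, 'c) tensor"
  counit :: "'c \<Rightarrow> 'k"

record ('g, 'k, 'c) hopf_pi_coalg = "('g, 'k, 'c) pi_coalg" +
  antipode :: "'g \<Rightarrow> 'c \<Rightarrow> 'c"

locale pi_coalgebra =
  fixes G :: "('g, 'n) monoid_scheme" and K :: "('k, 'm) ring_scheme"
    and C :: "('g, 'k, 'c, 'z) pi_coalg_scheme"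
  assumes group: "group G"
    and field: "field K"
    and component_module: "\<alpha> \<in> carrier G \<Longrightarrow> module K (component C \<alpha>)"
    and comult_linear: "\<lbrakk>\<alpha> \<in> carrier G; \<beta> \<in> carrier G\<rbrakk> \<Longrightarrow>
      linear_map K (component C (\<alpha> \<otimes>\<^bsub>G\<^esub> \<beta>)) (tensor K (component C \<alpha>) (component C \<beta>))
        (comult C \<alpha> \<beta>)"
    and counit_linear: "linear_map K (component C \<one>\<^bsub>G\<^esub>) (base_algebra K) (counit C)"
    and coassoc:
      "\<lbrakk>\<alpha> \<in> carrier G; \<beta> \<in> carrier G; \<gamma> \<in> carrier G;
        x \<in> carrier (component C (\<alpha> \<otimes>\<^bsub>G\<^esub> \<beta> \<otimes>\<^bsub>G\<^esub> \<gamma>))\<rbrakk> \<Longrightarrow>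
       tensor_assoc K (component C \<alpha>) (component C \<beta>) (component C \<gamma>)
         (tensor_map K (tensor K (component C \<alpha>) (component C \<beta>)) (component C \<gamma>)
            (comult C \<alpha> \<beta>) id (comult C (\<alpha> \<otimes>\<^bsub>G\<^esub> \<beta>) \<gamma> x)) =
       tensor_map K (component C \<alpha>) (tensor K (component C \<beta>) (component C \<gamma>))
         id (comult C \<beta> \<gamma>) (comult C \<alpha> (\<beta> \<otimes>\<^bsub>G\<^esub> \<gamma>) x)"
    and counit_left: "\<lbrakk>\<alpha> \<in> carrier G; x \<in> carrier (component C \<alpha>)\<rbrakk> \<Longrightarrow>
       tensor_unit_left K (component C \<alpha>)
         (tensor_map K (base_algebra K) (component C \<alpha>) (counit C) id (comult C \<one>\<^bsub>G\<^esub> \<alpha> x)) = x"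
    and counit_right: "\<lbrakk>\<alpha> \<in> carrier G; x \<in> carrier (component C \<alpha>)\<rbrakk> \<Longrightarrow>
       tensor_unit_right K (component C \<alpha>)
         (tensor_map K (component C \<alpha>) (base_algebra K) id (counit C) (comult C \<alpha> \<one>\<^bsub>G\<^esub> x)) = x"

locale hopf_pi_coalgebra = pi_coalgebra G K H
  for G :: "('g, 'n) monoid_scheme" and K :: "('k, 'm) ring_scheme"
    and H :: "('g, 'k, 'c, 'z) hopf_pi_coalg_scheme" +
  assumes component_algebra: "\<alpha> \<in> carrier G \<Longrightarrow> assoc_algebra K (component H \<alpha>)"
    and comult_algebra_map: "\<lbrakk>\<alpha> \<in> carrier G; \<beta> \<in> carrier G\<rbrakk> \<Longrightarrow>
      algebra_map K (component H (\<alpha> \<otimes>\<^bsub>G\<^esub> \<beta>)) (tensor K (component H \<alpha>) (component H \<beta>))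
        (comult H \<alpha> \<beta>)"
    and counit_algebra_map: "algebra_map K (component H \<one>\<^bsub>G\<^esub>) (base_algebra K) (counit H)"
    and antipode_linear: "\<alpha> \<in> carrier G \<Longrightarrow>
      linear_map K (component H \<alpha>) (component H (inv\<^bsub>G\<^esub> \<alpha>)) (antipode H \<alpha>)"
    and antipode_left: "\<lbrakk>\<alpha> \<in> carrier G; x \<in> carrier (component H \<one>\<^bsub>G\<^esub>)\<rbrakk> \<Longrightarrow>
      mult_map K (component H \<alpha>)
        (tensor_map K (component H \<alpha>) (component H \<alpha>) (antipode H (inv\<^bsub>G\<^esub> \<alpha>)) id
          (comult H (inv\<^bsub>G\<^esub> \<alpha>) \<alpha> x))
      = counit H x \<odot>\<^bsub>component H \<alpha>\<^esub> \<one>\<^bsub>component H \<alpha>\<^esub>"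
    and antipode_right: "\<lbrakk>\<alpha> \<in> carrier G; x \<in> carrier (component H \<one>\<^bsub>G\<^esub>)\<rbrakk> \<Longrightarrow>
      mult_map K (component H \<alpha>)
        (tensor_map K (component H \<alpha>) (component H \<alpha>) id (antipode H (inv\<^bsub>G\<^esub> \<alpha>))
          (comult H \<alpha> (inv\<^bsub>G\<^esub> \<alpha>) x))
      = counit H x \<odot>\<^bsub>component H \<alpha>\<^esub> \<one>\<^bsub>component H \<alpha>\<^esub>"

locale right_pi_comodule = pi_coalgebra G K C
  for G :: "('g, 'n) monoid_scheme" and K :: "('k, 'm) ring_scheme"
    and C :: "('g, 'k, 'c, 'z) pi_coalg_scheme" +
  fixes M :: "'g \<Rightarrow> ('k, 'v) module" and \<theta> :: "'g \<Rightarrow> 'g \<Rightarrow> 'v \<Rightarrow> ('k, 'v, 'c) tensor"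
  assumes comodule_module: "\<alpha> \<in> carrier G \<Longrightarrow> module K (M \<alpha>)"
    and coaction_linear: "\<lbrakk>\<alpha> \<in> carrier G; \<beta> \<in> carrier G\<rbrakk> \<Longrightarrow>
      linear_map K (M (\<alpha> \<otimes>\<^bsub>G\<^esub> \<beta>)) (tensor K (M \<alpha>) (component C \<beta>)) (\<theta> \<alpha> \<beta>)"
    and coaction_coassoc:
      "\<lbrakk>\<alpha> \<in> carrier G; \<beta> \<in> carrier G; \<gamma> \<in> carrier G;
        v \<in> carrier (M (\<alpha> \<otimes>\<^bsub>G\<^esub> \<beta> \<otimes>\<^bsub>G\<^esub> \<gamma>))\<rbrakk> \<Longrightarrow>
       tensor_assoc K (M \<alpha>) (component C \<beta>) (component C \<gamma>)
         (tensor_map K (tensor K (M \<alpha>) (component C \<beta>)) (component C \<gamma>)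
            (\<theta> \<alpha> \<beta>) id (\<theta> (\<alpha> \<otimes>\<^bsub>G\<^esub> \<beta>) \<gamma> v)) =
       tensor_map K (M \<alpha>) (tensor K (component C \<beta>) (component C \<gamma>))
         id (comult C \<beta> \<gamma>) (\<theta> \<alpha> (\<beta> \<otimes>\<^bsub>G\<^esub> \<gamma>) v)"
    and coaction_counit: "\<lbrakk>\<alpha> \<in> carrier G; v \<in> carrier (M \<alpha>)\<rbrakk> \<Longrightarrow>
       tensor_unit_right K (M \<alpha>)
         (tensor_map K (M \<alpha>) (base_algebra K) id (counit C) (\<theta> \<alpha> \<one>\<^bsub>G\<^esub> v)) = v"

locale hopf_pi_subcoalgebra = H: hopf_pi_coalgebra G K H + C: hopf_pi_coalgebra G K C
  for G :: "('g, 'n) monoid_scheme" and K :: "('k, 'm) ring_scheme"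
    and H :: "('g, 'k, 'h, 'y) hopf_pi_coalg_scheme"
    and C :: "('g, 'k, 'c, 'z) hopf_pi_coalg_scheme" +
  fixes \<sigma> :: "'g \<Rightarrow> 'h \<Rightarrow> 'c"
  assumes \<sigma>_algebra_map: "\<alpha> \<in> carrier G \<Longrightarrow> algebra_map K (component H \<alpha>) (component C \<alpha>) (\<sigma> \<alpha>)"
    and \<sigma>_surj: "\<alpha> \<in> carrier G \<Longrightarrow> \<sigma> \<alpha> ` carrier (component H \<alpha>) = carrier (component C \<alpha>)"
    and \<sigma>_comult:
      "\<lbrakk>\<alpha> \<in> carrier G; \<beta> \<in> carrier G; x \<in> carrier (component H (\<alpha> \<otimes>\<^bsub>G\<^esub> \<beta>))\<rbrakk> \<Longrightarrow>
       comult C \<alpha> \<beta> (\<sigma> (\<alpha> \<otimes>\<^bsub>G\<^esub> \<beta>) x) =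
       tensor_map K (component C \<alpha>) (component C \<beta>) (\<sigma> \<alpha>) (\<sigma> \<beta>) (comult H \<alpha> \<beta> x)"
    and \<sigma>_counit: "x \<in> carrier (component H \<one>\<^bsub>G\<^esub>) \<Longrightarrow> counit C (\<sigma> \<one>\<^bsub>G\<^esub> x) = counit H x"
    and \<sigma>_antipode: "\<lbrakk>\<alpha> \<in> carrier G; x \<in> carrier (component H \<alpha>)\<rbrakk> \<Longrightarrow>
       antipode C \<alpha> (\<sigma> \<alpha> x) = \<sigma> (inv\<^bsub>G\<^esub> \<alpha>) (antipode H \<alpha> x)"


section \<open>Sections and cosections\<close>

definition left_coaction ::
  "('k, 'm) ring_scheme \<Rightarrow> ('g, 'k, 'h, 'y) pi_coalg_scheme \<Rightarrow> ('g, 'k, 'c, 'z) pi_coalg_scheme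
     \<Rightarrow> ('g \<Rightarrow> 'h \<Rightarrow> 'c) \<Rightarrow> 'g \<Rightarrow> 'g \<Rightarrow> 'h \<Rightarrow> ('k, 'c, 'h) tensor" where
  "left_coaction K H C \<sigma> \<alpha> \<beta> x =
     tensor_map K (component C \<alpha>) (component H \<beta>) (\<sigma> \<alpha>) id (comult H \<alpha> \<beta> x)"

definition convolution_invertible ::
  "('g, 'n) monoid_scheme \<Rightarrow> ('k, 'm) ring_scheme \<Rightarrow> ('g, 'k, 'h, 'y) pi_coalg_scheme
     \<Rightarrow> ('g, 'k, 'c, 'z) pi_coalg_scheme \<Rightarrow> ('g \<Rightarrow> 'c \<Rightarrow> 'h) \<Rightarrow> bool" where
  "convolution_invertible G K H C g \<longleftrightarrow>
     (\<exists>g'. \<forall>\<alpha>\<in>carrier G.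
        linear_map K (component C (inv\<^bsub>G\<^esub> \<alpha>)) (component H \<alpha>) (g' \<alpha>) \<and>
        (\<forall>c\<in>carrier (component C \<one>\<^bsub>G\<^esub>).
           mult_map K (component H \<alpha>)
             (tensor_map K (component H \<alpha>) (component H \<alpha>) (g \<alpha>) (g' \<alpha>)
               (comult C \<alpha> (inv\<^bsub>G\<^esub> \<alpha>) c))
             = counit C c \<odot>\<^bsub>component H \<alpha>\<^esub> \<one>\<^bsub>component H \<alpha>\<^esub> \<and>
           mult_map K (component H \<alpha>)
             (tensor_map K (component H \<alpha>) (component H \<alpha>) (g' \<alpha>) (g \<alpha>)
               (comult C (inv\<^bsub>G\<^esub> \<alpha>) \<alpha> c))
             = counit C c \<odot>\<^bsub>component H \<alpha>\<^esub> \<one>\<^bsub>component H \<alpha>\<^esub>))"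

definition left_section ::
  "('g, 'n) monoid_scheme \<Rightarrow> ('k, 'm) ring_scheme \<Rightarrow> ('g, 'k, 'h, 'y) pi_coalg_scheme
     \<Rightarrow> ('g, 'k, 'c, 'z) pi_coalg_scheme \<Rightarrow> ('g \<Rightarrow> 'h \<Rightarrow> 'c) \<Rightarrow> ('g \<Rightarrow> 'c \<Rightarrow> 'h) \<Rightarrow> bool" where
  "left_section G K H C \<sigma> g \<longleftrightarrow>
     (\<forall>\<alpha>\<in>carrier G. linear_map K (component C \<alpha>) (component H \<alpha>) (g \<alpha>)) \<and>
     convolution_invertible G K H C g \<and>
     (\<forall>\<alpha>\<in>carrier G.
        g \<alpha> \<one>\<^bsub>component C \<alpha>\<^esub> = \<one>\<^bsub>component H \<alpha>\<^esub> \<and>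
        (\<forall>c\<in>carrier (component C \<alpha>).
           left_coaction K H C \<sigma> \<one>\<^bsub>G\<^esub> \<alpha> (g \<alpha> c) =
           tensor_map K (component C \<one>\<^bsub>G\<^esub>) (component H \<alpha>) id (g \<alpha>) (comult C \<one>\<^bsub>G\<^esub> \<alpha> c)))"

definition has_left_cosection ::
  "('g, 'n) monoid_scheme \<Rightarrow> ('k, 'm) ring_scheme \<Rightarrow> ('g, 'k, 'h, 'y) pi_coalg_scheme \<Rightarrow> bool"
  where
  "has_left_cosection G K H \<longleftrightarrow>
     (\<exists>\<eta>. \<forall>\<alpha>\<in>carrier G.
        algebra_map K (component H \<one>\<^bsub>G\<^esub>) (component H \<alpha>) (\<eta> \<alpha>) \<and>
        (\<forall>x\<in>carrier (component H \<one>\<^bsub>G\<^esub>).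
           comult H \<one>\<^bsub>G\<^esub> \<alpha> (\<eta> \<alpha> x) =
           tensor_map K (component H \<one>\<^bsub>G\<^esub>) (component H \<alpha>) id (\<eta> \<alpha>)
             (comult H \<one>\<^bsub>G\<^esub> \<one>\<^bsub>G\<^esub> x)))"


section \<open>Coinvariants, induced modules and module isomorphisms\<close>

definition coinv ::
  "('g, 'n) monoid_scheme \<Rightarrow> ('k, 'm) ring_scheme \<Rightarrow> ('g, 'k, 'h, 'y) pi_coalg_scheme
     \<Rightarrow> ('g, 'k, 'c, 'z) pi_coalg_scheme \<Rightarrow> ('g \<Rightarrow> 'h \<Rightarrow> 'c) \<Rightarrow> 'g \<Rightarrow> ('k, 'h) module" where
  "coinv G K H C \<sigma> \<alpha> = (component H \<alpha>)
     \<lparr>carrier := {h \<in> carrier (component H \<alpha>).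
        left_coaction K H C \<sigma> \<one>\<^bsub>G\<^esub> \<alpha> h =
        pure_tensor K (component C \<one>\<^bsub>G\<^esub>) (component H \<alpha>) \<one>\<^bsub>component C \<one>\<^bsub>G\<^esub>\<^esub> h}\<rparr>"

text \<open>The two sides of the defining equation live in $V_1 \otimes (C_1 \otimes H_\alpha)$ and
  $(V_1 \otimes C_1) \otimes H_\alpha$, hence the associativity isomorphism.\<close>

definition Ind ::
  "('g, 'n) monoid_scheme \<Rightarrow> ('k, 'm) ring_scheme \<Rightarrow> ('g, 'k, 'h, 'y) pi_coalg_scheme
     \<Rightarrow> ('g, 'k, 'c, 'z) pi_coalg_scheme \<Rightarrow> ('g \<Rightarrow> 'h \<Rightarrow> 'c)
     \<Rightarrow> ('g \<Rightarrow> ('k, 'v) module) \<Rightarrow> ('g \<Rightarrow> 'g \<Rightarrow> 'v \<Rightarrow> ('k, 'v, 'c) tensor)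
     \<Rightarrow> 'g \<Rightarrow> ('k, ('k, 'v, 'h) tensor) module" where
  "Ind G K H C \<sigma> V \<rho> \<alpha> = (tensor K (V \<one>\<^bsub>G\<^esub>) (component H \<alpha>))
     \<lparr>carrier := {x \<in> carrier (tensor K (V \<one>\<^bsub>G\<^esub>) (component H \<alpha>)).
        tensor_map K (V \<one>\<^bsub>G\<^esub>) (tensor K (component C \<one>\<^bsub>G\<^esub>) (component H \<alpha>))
          id (left_coaction K H C \<sigma> \<one>\<^bsub>G\<^esub> \<alpha>) x =
        tensor_assoc K (V \<one>\<^bsub>G\<^esub>) (component C \<one>\<^bsub>G\<^esub>) (component H \<alpha>)
          (tensor_map K (tensor K (V \<one>\<^bsub>G\<^esub>) (component C \<one>\<^bsub>G\<^esub>)) (component H \<alpha>)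
             (\<rho> \<one>\<^bsub>G\<^esub> \<one>\<^bsub>G\<^esub>) id x)}\<rparr>"

text \<open>$(v \otimes h) \cdot b = v \otimes hb$ on $V \otimes A$, extended linearly.\<close>

definition tensor_right_action ::
  "('k, 'm) ring_scheme \<Rightarrow> ('k, 'v) module \<Rightarrow> ('k, 'a) module
     \<Rightarrow> ('k, 'v, 'a) tensor \<Rightarrow> 'a \<Rightarrow> ('k, 'v, 'a) tensor" where
  "tensor_right_action K V A x b = tensor_map K V A id (\<lambda>h. h \<otimes>\<^bsub>A\<^esub> b) x"

definition right_module ::
  "('k, 'm) ring_scheme \<Rightarrow> ('k, 'a) module \<Rightarrow> ('k, 'x) module \<Rightarrow> ('x \<Rightarrow> 'a \<Rightarrow> 'x) \<Rightarrow> bool" where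
  "right_module K A M act \<longleftrightarrow>
     assoc_algebra K A \<and> module K M \<and>
     (\<forall>a\<in>carrier A. linear_map K M M (\<lambda>x. act x a)) \<and>
     (\<forall>x\<in>carrier M. linear_map K A M (act x)) \<and>
     (\<forall>x\<in>carrier M. act x \<one>\<^bsub>A\<^esub> = x) \<and>
     (\<forall>x\<in>carrier M. \<forall>a\<in>carrier A. \<forall>b\<in>carrier A. act (act x a) b = act x (a \<otimes>\<^bsub>A\<^esub> b))"

definition right_module_iso ::
  "('k, 'm) ring_scheme \<Rightarrow> ('k, 'a) module \<Rightarrow> ('k, 'x) module \<Rightarrow> ('x \<Rightarrow> 'a \<Rightarrow> 'x)
     \<Rightarrow> ('k, 'y) module \<Rightarrow> ('y \<Rightarrow> 'a \<Rightarrow> 'y) \<Rightarrow> ('x \<Rightarrow> 'y) \<Rightarrow> bool" where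
  "right_module_iso K A M act N act' \<phi> \<longleftrightarrow>
     right_module K A M act \<and> right_module K A N act' \<and>
     linear_map K M N \<phi> \<and> bij_betw \<phi> (carrier M) (carrier N) \<and>
     (\<forall>x\<in>carrier M. \<forall>a\<in>carrier A. \<phi> (act x a) = act' (\<phi> x) a)"

end

theory Submission
  imports Defs
begin

text \<open>Let $\gamma = \eta_\alpha g_1$ and $\gamma' = \eta_\alpha g_1^{-1}$. As $\eta_\alpha$ is a colinear
  algebra map, $\gamma : C_1 \to H_\alpha$ is colinear with convolution inverse $\gamma'$, so $H_\alpha$ is a
  cleft $C_1$-comodule algebra with coinvariants $B_\alpha$. Write $L_{1,\alpha}(a) = a_{-1} \otimes a_0$ and
  $P(a) = \gamma'(a_{-1}) a_0$. Colinearity of $\gamma$ and $a = \gamma(a_{-1}) P(a_0)$ give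
  $L(a) = L(\gamma(a_{-1})) (1 \otimes P(a_0))$ for $L = L_{1,\alpha}$; cancelling $L \gamma$ with its
  convolution inverse $L \gamma'$ yields $L(P(a)) = 1 \otimes P(a)$, so $P$ has values in $B_\alpha$. Moreover
  $P(\gamma(c) b) = \epsilon(c) b$ for $b \in B_\alpha$. Hence $v \otimes b \mapsto v_0 \otimes \gamma(v_1) b$ is an
  isomorphism from $V_1 \otimes B_\alpha$ to the induced module, with inverse the restriction of
  $I \otimes P$. That the inverse takes values in $V_1 \otimes B_\alpha$ itself makes an argument for the
  injectivity of $V_1 \otimes B_\alpha \to V_1 \otimes H_\alpha$ superfluous.\<close>

section \<open>Linear and bilinear maps\<close>

text \<open>A tensor is a coset and \<open>tensor_lift\<close> evaluates an arbitrary representative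
  of it, so Sweedler notation makes sense only where the expression under the sum is bilinear on the
  carriers. Each sum is therefore a \<open>tensor_lift\<close>, nested once for every further
  coproduct or coaction, and each step of a calculation carries linearity obligations, which
  backward chaining over \<open>linear_intros\<close> and \<open>closed_intros\<close> discharges.
  What remains are four moves: rewriting under a sum (\<open>tensor_lift_cong\<close>), pulling a
  linear map through it (\<open>tensor_lift_commute\<close>), substituting the components of a
  mapped tensor (\<open>tensor_lift_tensor_map\<close>) and regrouping by coassociativity
  (\<open>coassoc_eval\<close>). The spaces V \<otimes> B and V \<otimes> A are quotients of
  different free modules, so a tensor of one need not be a tensor of the other; each direction of
  the isomorphism has to name the space in which its pure tensors are formed.\<close>

lemma linear_mapI:
  assumes "\<And>x. x \<in> carrier M \<Longrightarrow> f x \<in> carrier N"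
    and "\<And>x y. \<lbrakk>x \<in> carrier M; y \<in> carrier M\<rbrakk> \<Longrightarrow> f (x \<oplus>\<^bsub>M\<^esub> y) = f x \<oplus>\<^bsub>N\<^esub> f y"
    and "\<And>a x. \<lbrakk>a \<in> carrier K; x \<in> carrier M\<rbrakk> \<Longrightarrow> f (a \<odot>\<^bsub>M\<^esub> x) = a \<odot>\<^bsub>N\<^esub> f x"
  shows "linear_map K M N f"
  using assms by (auto simp: linear_map_def)

lemma linear_map_closed: "\<lbrakk>linear_map K M N f; x \<in> carrier M\<rbrakk> \<Longrightarrow> f x \<in> carrier N"
  by (auto simp: linear_map_def)

lemma linear_map_add:
  "\<lbrakk>linear_map K M N f; x \<in> carrier M; y \<in> carrier M\<rbrakk> \<Longrightarrow> f (x \<oplus>\<^bsub>M\<^esub> y) = f x \<oplus>\<^bsub>N\<^esub> f y"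
  by (auto simp: linear_map_def)

lemma linear_map_smult:
  "\<lbrakk>linear_map K M N f; a \<in> carrier K; x \<in> carrier M\<rbrakk> \<Longrightarrow> f (a \<odot>\<^bsub>M\<^esub> x) = a \<odot>\<^bsub>N\<^esub> f x"
  by (auto simp: linear_map_def)

lemma linear_map_zero:
  assumes "module K M" "module K N" "linear_map K M N f"
  shows "f \<zero>\<^bsub>M\<^esub> = \<zero>\<^bsub>N\<^esub>"
proof -
  interpret M: module K M by fact
  interpret N: module K N by fact
  have "f (\<zero>\<^bsub>K\<^esub> \<odot>\<^bsub>M\<^esub> \<zero>\<^bsub>M\<^esub>) = \<zero>\<^bsub>K\<^esub> \<odot>\<^bsub>N\<^esub> f \<zero>\<^bsub>M\<^esub>"
    by (rule linear_map_smult[OF assms(3)]) auto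
  then show ?thesis
    using linear_map_closed[OF assms(3), of "\<zero>\<^bsub>M\<^esub>"] by simp
qed

lemma linear_map_ident: "linear_map K M M (\<lambda>x. x)"
  by (auto simp: linear_map_def)

lemma linear_map_compose:
  assumes "linear_map K N P g" "linear_map K M N f"
  shows "linear_map K M P (\<lambda>x. g (f x))"
  using assms
  by (intro linear_mapI) (simp_all add: linear_map_closed linear_map_add linear_map_smult)

lemma linear_map_cong:
  assumes "module K M" "linear_map K M N f" "\<And>x. x \<in> carrier M \<Longrightarrow> f x = g x"
  shows "linear_map K M N g"
  using assms by (auto simp: linear_map_def Pi_iff module.smult_closed
      abelian_monoid.a_closed[OF abelian_group.axioms(1)[OF module.axioms(2)]])

lemma linear_map_smult_const:
  assumes "module K M" "a \<in> carrier K" "linear_map K D M f"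
  shows "linear_map K D M (\<lambda>x. a \<odot>\<^bsub>M\<^esub> f x)"
proof -
  interpret M: module K M by fact
  show ?thesis
    using assms(2,3)
    by (intro linear_mapI) (simp_all add: linear_map_closed linear_map_add linear_map_smult
        M.smult_r_distr M.smult_assoc1[symmetric] M.R.m_comm)
qed

section \<open>Bilinear maps and the multiplication of an algebra\<close>

definition bilinear_map ::
  "('k, 'm) ring_scheme \<Rightarrow> ('k, 'a) module \<Rightarrow> ('k, 'b) module \<Rightarrow> ('k, 'c) module
     \<Rightarrow> ('a \<Rightarrow> 'b \<Rightarrow> 'c) \<Rightarrow> bool" where
  "bilinear_map K M N P b \<longleftrightarrow>
     (\<forall>x\<in>carrier M. linear_map K N P (b x)) \<and>
     (\<forall>y\<in>carrier N. linear_map K M P (\<lambda>x. b x y))"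

lemma bilinear_mapI:
  assumes "\<And>x. x \<in> carrier M \<Longrightarrow> linear_map K N P (b x)"
    and "\<And>y. y \<in> carrier N \<Longrightarrow> linear_map K M P (\<lambda>x. b x y)"
  shows "bilinear_map K M N P b"
  using assms by (simp add: bilinear_map_def)

lemma bilinear_map_right: "\<lbrakk>bilinear_map K M N P b; x \<in> carrier M\<rbrakk> \<Longrightarrow> linear_map K N P (b x)"
  by (simp add: bilinear_map_def)

lemma bilinear_map_left:
  "\<lbrakk>bilinear_map K M N P b; y \<in> carrier N\<rbrakk> \<Longrightarrow> linear_map K M P (\<lambda>x. b x y)"
  by (simp add: bilinear_map_def)

lemma bilinear_map_closed:
  "\<lbrakk>bilinear_map K M N P b; x \<in> carrier M; y \<in> carrier N\<rbrakk> \<Longrightarrow> b x y \<in> carrier P"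
  by (blast dest: bilinear_map_right linear_map_closed)

lemma assoc_algebra_bilinear:
  assumes "assoc_algebra K A"
  shows "bilinear_map K A A A (\<lambda>x y. x \<otimes>\<^bsub>A\<^esub> y)"
proof -
  interpret ring A using assms by (simp add: assoc_algebra_def)
  show ?thesis
    using assms
    by (auto intro!: bilinear_mapI linear_mapI simp: assoc_algebra_def l_distr r_distr)
qed

lemma assoc_algebra_module: "assoc_algebra K A \<Longrightarrow> module K A"
  by (simp add: assoc_algebra_def)

lemma assoc_algebra_mult_closed:
  assumes "assoc_algebra K A" "x \<in> carrier A" "y \<in> carrier A"
  shows "x \<otimes>\<^bsub>A\<^esub> y \<in> carrier A"
proof -
  interpret ring A using assms by (simp add: assoc_algebra_def)
  show ?thesis using assms by simp
qed

lemma assoc_algebra_one_closed: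
  assumes "assoc_algebra K A"
  shows "\<one>\<^bsub>A\<^esub> \<in> carrier A"
proof -
  interpret ring A using assms by (simp add: assoc_algebra_def)
  show ?thesis by simp
qed

text \<open>Stated for a composite with an arbitrary linear \<open>f\<close> rather than for the
  bare multiplication, so that backward chaining can peel a nested expression from the
  outside.\<close>

lemma linear_map_mult_left:
  assumes "assoc_algebra K A" "y \<in> carrier A" "linear_map K D A f"
  shows "linear_map K D A (\<lambda>x. f x \<otimes>\<^bsub>A\<^esub> y)"
  by (rule linear_map_compose[OF bilinear_map_left[OF assoc_algebra_bilinear]]) fact+

lemma linear_map_mult_right:
  assumes "assoc_algebra K A" "y \<in> carrier A" "linear_map K D A f"
  shows "linear_map K D A (\<lambda>x. y \<otimes>\<^bsub>A\<^esub> f x)"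
  by (rule linear_map_compose[OF bilinear_map_right[OF assoc_algebra_bilinear]]) fact+

section \<open>Universal property of the tensor product\<close>

lemma free_module_simps [simp]:
  "zero (free_module K X) = (\<lambda>x. \<zero>\<^bsub>K\<^esub>)"
  "add (free_module K X) = (\<lambda>f h x. f x \<oplus>\<^bsub>K\<^esub> h x)"
  "smult (free_module K X) = (\<lambda>a f x. a \<otimes>\<^bsub>K\<^esub> f x)"
  by (simp_all add: free_module_def)

lemma free_module_carrier:
  "f \<in> carrier (free_module K X) \<longleftrightarrow>
     (\<forall>x. f x \<in> carrier K) \<and> finite {x. f x \<noteq> \<zero>\<^bsub>K\<^esub>} \<and> {x. f x \<noteq> \<zero>\<^bsub>K\<^esub>} \<subseteq> X"
  by (simp add: free_module_def)

lemma free_moduleI: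
  assumes "\<And>x. f x \<in> carrier K" "finite S" "S \<subseteq> X" "\<And>x. x \<notin> S \<Longrightarrow> f x = \<zero>\<^bsub>K\<^esub>"
  shows "f \<in> carrier (free_module K X)"
proof -
  have "{x. f x \<noteq> \<zero>\<^bsub>K\<^esub>} \<subseteq> S" using assms(4) by auto
  then show ?thesis
    using assms finite_subset by (auto simp: free_module_carrier)
qed

lemma free_moduleE:
  assumes "f \<in> carrier (free_module K X)"
  obtains S where "finite S" "S \<subseteq> X" "\<And>x. x \<notin> S \<Longrightarrow> f x = \<zero>\<^bsub>K\<^esub>"
  by (rule that[of "{x. f x \<noteq> \<zero>\<^bsub>K\<^esub>}"]) (use assms in \<open>simp_all add: free_module_carrier\<close>)

lemma free_module_module:
  assumes "cring K"
  shows "module K (free_module K X)"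
proof -
  interpret K: cring K by fact
  have add: "(\<lambda>x. f x \<oplus>\<^bsub>K\<^esub> h x) \<in> carrier (free_module K X)"
    if f: "f \<in> carrier (free_module K X)" and h: "h \<in> carrier (free_module K X)" for f h
  proof -
    obtain S where S: "finite S" "S \<subseteq> X" "\<And>x. x \<notin> S \<Longrightarrow> f x = \<zero>\<^bsub>K\<^esub>"
      using f by (rule free_moduleE) blast
    obtain T where T: "finite T" "T \<subseteq> X" "\<And>x. x \<notin> T \<Longrightarrow> h x = \<zero>\<^bsub>K\<^esub>"
      using h by (rule free_moduleE) blast
    show ?thesis
      using f h S T by (intro free_moduleI[where S = "S \<union> T"]) (auto simp: free_module_carrier)
  qed
  have smult: "(\<lambda>x. a \<otimes>\<^bsub>K\<^esub> f x) \<in> carrier (free_module K X)"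
    if "a \<in> carrier K" and f: "f \<in> carrier (free_module K X)" for a f
  proof -
    obtain S where S: "finite S" "S \<subseteq> X" "\<And>x. x \<notin> S \<Longrightarrow> f x = \<zero>\<^bsub>K\<^esub>"
      using f by (rule free_moduleE) blast
    then show ?thesis
      using that by (intro free_moduleI[where S = S]) (auto simp: free_module_carrier)
  qed
  show ?thesis
  proof (intro moduleI abelian_groupI, goal_cases)
    \<comment> \<open>Goal 7 asks for an additive inverse. Taking -1 times \<open>f\<close> reduces
      its finite support to closure under scaling.\<close>
    case (7 f)
    then have "(\<lambda>x. \<ominus>\<^bsub>K\<^esub> \<one>\<^bsub>K\<^esub> \<otimes>\<^bsub>K\<^esub> f x) \<in> carrier (free_module K X)"
      by (intro smult) auto
    moreover have "(\<lambda>x. (\<ominus>\<^bsub>K\<^esub> \<one>\<^bsub>K\<^esub> \<otimes>\<^bsub>K\<^esub> f x) \<oplus>\<^bsub>K\<^esub> f x) = (\<lambda>x. \<zero>\<^bsub>K\<^esub>)"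
      using 7 by (auto simp: free_module_carrier K.l_minus K.l_neg)
    ultimately show ?case by auto
  qed (use assms in \<open>auto simp: add smult, (auto simp: free_module_carrier K.a_ac
        K.l_distr K.r_distr K.m_assoc)?\<close>)
qed

lemma free_gen_closed:
  assumes "cring K" "p \<in> X"
  shows "free_gen K p \<in> carrier (free_module K X)"
proof -
  interpret K: cring K by fact
  show ?thesis
    using assms(2) by (intro free_moduleI[where S = "{p}"]) (auto simp: free_gen_def)
qed

text \<open>Induction on a finite set that contains the support: a point p is split off as
  \<open>f p\<close> times its generator, and the remainder vanishes at p.\<close>

lemma free_module_induct:
  assumes "cring K" and f: "f \<in> carrier (free_module K X)"
    and zero: "Q (\<lambda>x. \<zero>\<^bsub>K\<^esub>)"
    and step: "\<And>a p f. \<lbrakk>a \<in> carrier K; p \<in> X; f \<in> carrier (free_module K X); Q f\<rbrakk> \<Longrightarrow>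
      Q (\<lambda>x. (a \<otimes>\<^bsub>K\<^esub> free_gen K p x) \<oplus>\<^bsub>K\<^esub> f x)"
  shows "Q f"
proof -
  interpret K: cring K by fact
  obtain S where S: "finite S" "S \<subseteq> X" "\<And>x. x \<notin> S \<Longrightarrow> f x = \<zero>\<^bsub>K\<^esub>"
    using f by (rule free_moduleE) blast
  from S(1) f S(2,3) show ?thesis
  proof (induction S arbitrary: f rule: finite_induct)
    case empty
    then have "f = (\<lambda>x. \<zero>\<^bsub>K\<^esub>)" by auto
    then show ?case using zero by simp
  next
    case (insert p S)
    define h where "h = f(p := \<zero>\<^bsub>K\<^esub>)"
    have fK: "f x \<in> carrier K" for x
      using insert.prems(1) by (simp add: free_module_carrier)
    have h: "h \<in> carrier (free_module K X)"
      using insert fK by (intro free_moduleI[where S = S]) (auto simp: h_def)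
    have "Q h"
      by (rule insert.IH[OF h]) (use insert.prems in \<open>auto simp: h_def\<close>)
    then have "Q (\<lambda>x. (f p \<otimes>\<^bsub>K\<^esub> free_gen K p x) \<oplus>\<^bsub>K\<^esub> h x)"
      using insert.prems(2) fK by (intro step[OF _ _ h \<open>Q h\<close>]) auto
    moreover have "(\<lambda>x. (f p \<otimes>\<^bsub>K\<^esub> free_gen K p x) \<oplus>\<^bsub>K\<^esub> h x) = f"
      using fK by (auto simp: h_def free_gen_def)
    ultimately show ?case by simp
  qed
qed

text \<open>The linear extension of \<open>b\<close> from the generators. It is written as the very
  sum that occurs in \<open>tensor_lift\<close>, which thereby becomes \<open>free_eval\<close> at a
  chosen representative.\<close>

definition free_eval ::
  "('k, 'm) ring_scheme \<Rightarrow> ('k, 'c) module \<Rightarrow> ('x \<Rightarrow> 'c) \<Rightarrow> ('x \<Rightarrow> 'k) \<Rightarrow> 'c" where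
  "free_eval K P b f = (\<Oplus>\<^bsub>P\<^esub>p\<in>{p. f p \<noteq> \<zero>\<^bsub>K\<^esub>}. f p \<odot>\<^bsub>P\<^esub> b p)"

text \<open>Supports change under addition and scaling. Padding the sum with zero terms to any
  finite S that contains the support lets the sums for different functions be compared over one
  index set.\<close>

lemma free_eval_eq:
  assumes "module K P" "b \<in> X \<rightarrow> carrier P" "f \<in> carrier (free_module K X)"
    "finite S" "S \<subseteq> X" "\<And>x. x \<notin> S \<Longrightarrow> f x = \<zero>\<^bsub>K\<^esub>"
  shows "free_eval K P b f = (\<Oplus>\<^bsub>P\<^esub>p\<in>S. f p \<odot>\<^bsub>P\<^esub> b p)"
proof -
  interpret P: module K P by fact
  show ?thesis
    unfolding free_eval_def
    by (rule P.add.finprod_mono_neutral_cong_left)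
      (use assms in \<open>auto simp: free_module_carrier Pi_iff subset_iff\<close>)
qed

lemma free_eval_linear:
  assumes "module K P" "b \<in> X \<rightarrow> carrier P"
  shows "linear_map K (free_module K X) P (free_eval K P b)"
proof -
  interpret P: module K P by fact
  interpret F: module K "free_module K X" by (rule free_module_module) (rule P.R.is_cring)
  show ?thesis
  proof (rule linear_mapI)
    fix f assume f: "f \<in> carrier (free_module K X)"
    then show "free_eval K P b f \<in> carrier P"
      using assms unfolding free_eval_def by (intro P.finsum_closed) (auto simp: free_module_carrier)
  next
    fix f h assume f: "f \<in> carrier (free_module K X)" and h: "h \<in> carrier (free_module K X)"
    obtain S where S: "finite S" "S \<subseteq> X" "\<And>x. x \<notin> S \<Longrightarrow> f x = \<zero>\<^bsub>K\<^esub>"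
      using f by (rule free_moduleE) blast
    obtain T where T: "finite T" "T \<subseteq> X" "\<And>x. x \<notin> T \<Longrightarrow> h x = \<zero>\<^bsub>K\<^esub>"
      using h by (rule free_moduleE) blast
    have K: "f x \<in> carrier K" "h x \<in> carrier K" for x
      using f h by (auto simp: free_module_carrier)
    have b: "x \<in> S \<union> T \<Longrightarrow> b x \<in> carrier P" for x
      using assms(2) S(2) T(2) by auto
    have fh: "f \<oplus>\<^bsub>free_module K X\<^esub> h \<in> carrier (free_module K X)"
      using f h by (rule F.a_closed)
    have "free_eval K P b (f \<oplus>\<^bsub>free_module K X\<^esub> h) = (\<Oplus>\<^bsub>P\<^esub>p\<in>S \<union> T. (f p \<oplus>\<^bsub>K\<^esub> h p) \<odot>\<^bsub>P\<^esub> b p)"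
      using free_eval_eq[OF assms fh, of "S \<union> T"] S T by simp
    also have "\<dots> = (\<Oplus>\<^bsub>P\<^esub>p\<in>S \<union> T. f p \<odot>\<^bsub>P\<^esub> b p \<oplus>\<^bsub>P\<^esub> h p \<odot>\<^bsub>P\<^esub> b p)"
      using K b by (intro P.finsum_cong') (auto simp: P.smult_l_distr)
    also have "\<dots> = (\<Oplus>\<^bsub>P\<^esub>p\<in>S \<union> T. f p \<odot>\<^bsub>P\<^esub> b p) \<oplus>\<^bsub>P\<^esub> (\<Oplus>\<^bsub>P\<^esub>p\<in>S \<union> T. h p \<odot>\<^bsub>P\<^esub> b p)"
      using K b S T by (intro P.finsum_addf) auto
    also have "\<dots> = free_eval K P b f \<oplus>\<^bsub>P\<^esub> free_eval K P b h"
      using free_eval_eq[OF assms f, of "S \<union> T"] free_eval_eq[OF assms h, of "S \<union> T"] S T by simp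
    finally show "free_eval K P b (f \<oplus>\<^bsub>free_module K X\<^esub> h) = free_eval K P b f \<oplus>\<^bsub>P\<^esub> free_eval K P b h" .
  next
    fix a f assume a: "a \<in> carrier K" and f: "f \<in> carrier (free_module K X)"
    obtain S where S: "finite S" "S \<subseteq> X" "\<And>x. x \<notin> S \<Longrightarrow> f x = \<zero>\<^bsub>K\<^esub>"
      using f by (rule free_moduleE) blast
    have K: "f x \<in> carrier K" for x
      using f by (auto simp: free_module_carrier)
    have b: "x \<in> S \<Longrightarrow> b x \<in> carrier P" for x
      using assms(2) S(2) by auto
    have af: "a \<odot>\<^bsub>free_module K X\<^esub> f \<in> carrier (free_module K X)"
      using a f by (rule F.smult_closed)
    have "free_eval K P b (a \<odot>\<^bsub>free_module K X\<^esub> f) = (\<Oplus>\<^bsub>P\<^esub>p\<in>S. (a \<otimes>\<^bsub>K\<^esub> f p) \<odot>\<^bsub>P\<^esub> b p)"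
      using free_eval_eq[OF assms af, of S] S a by simp
    also have "\<dots> = (\<Oplus>\<^bsub>P\<^esub>p\<in>S. a \<odot>\<^bsub>P\<^esub> (f p \<odot>\<^bsub>P\<^esub> b p))"
      using a K b by (intro P.finsum_cong') (auto simp: P.smult_assoc1)
    also have "\<dots> = a \<odot>\<^bsub>P\<^esub> (\<Oplus>\<^bsub>P\<^esub>p\<in>S. f p \<odot>\<^bsub>P\<^esub> b p)"
      using a K b S by (intro P.finsum_smult_ldistr[symmetric]) auto
    also have "\<dots> = a \<odot>\<^bsub>P\<^esub> free_eval K P b f"
      using free_eval_eq[OF assms f, of S] S by simp
    finally show "free_eval K P b (a \<odot>\<^bsub>free_module K X\<^esub> f) = a \<odot>\<^bsub>P\<^esub> free_eval K P b f" .
  qed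
qed

lemma free_eval_gen:
  assumes "module K P" "b \<in> X \<rightarrow> carrier P" "p \<in> X"
  shows "free_eval K P b (free_gen K p) = b p"
proof -
  interpret P: module K P by fact
  have "free_eval K P b (free_gen K p) = (\<Oplus>\<^bsub>P\<^esub>q\<in>{p}. free_gen K p q \<odot>\<^bsub>P\<^esub> b q)"
    using assms free_gen_closed[OF P.R.is_cring assms(3)]
    by (intro free_eval_eq[OF assms(1,2)]) (auto simp: free_gen_def)
  also have "\<dots> = b p"
    using assms by (subst P.finsum_insert) (auto simp: free_gen_def Pi_iff)
  finally show ?thesis .
qed

section \<open>Equalizers of linear maps and the submodule of tensor relations\<close>

lemma linear_map_minus:
  assumes "module K M" "module K N" "linear_map K M N f" "x \<in> carrier M" "y \<in> carrier M"
  shows "f (x \<ominus>\<^bsub>M\<^esub> y) = f x \<ominus>\<^bsub>N\<^esub> f y"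
proof -
  interpret M: module K M by fact
  interpret N: module K N by fact
  have "x = (x \<ominus>\<^bsub>M\<^esub> y) \<oplus>\<^bsub>M\<^esub> y"
    using assms by (simp add: a_minus_def M.a_assoc M.l_neg)
  then have "f x = f (x \<ominus>\<^bsub>M\<^esub> y) \<oplus>\<^bsub>N\<^esub> f y"
    using assms linear_map_add[OF assms(3)] by (metis M.minus_closed)
  moreover have "f y \<in> carrier N" "f (x \<ominus>\<^bsub>M\<^esub> y) \<in> carrier N"
    using assms by (auto intro: linear_map_closed[OF assms(3)])
  ultimately show ?thesis by (simp add: a_minus_def N.a_assoc N.r_neg)
qed

text \<open>One source for three submodules: the kernel of an evaluation, the coinvariants and the
  induced module are all equalizers of two linear maps.\<close>

lemma linear_map_equalizer_submodule:
  assumes "module K M" "module K N" "linear_map K M N f" "linear_map K M N g"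
  shows "submodule {x \<in> carrier M. f x = g x} K M"
proof -
  interpret M: module K M by fact
  have "f (\<ominus>\<^bsub>M\<^esub> x) = g (\<ominus>\<^bsub>M\<^esub> x)" if x: "x \<in> carrier M" "f x = g x" for x
    using linear_map_minus[OF assms(1-3) M.zero_closed x(1)]
      linear_map_minus[OF assms(1,2,4) M.zero_closed x(1)] x
    by (simp add: a_minus_def linear_map_zero[OF assms(1-3)] linear_map_zero[OF assms(1,2,4)])
  then show ?thesis
    by (intro M.submoduleI)
      (auto simp: linear_map_zero[OF assms(1-3)] linear_map_zero[OF assms(1,2,4)]
        linear_map_add[OF assms(3)] linear_map_add[OF assms(4)]
        linear_map_smult[OF assms(3)] linear_map_smult[OF assms(4)])
qed

lemma linear_map_kernel_submodule:
  assumes "module K M" "module K N" "linear_map K M N f"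
  shows "submodule {x \<in> carrier M. f x = \<zero>\<^bsub>N\<^esub>} K M"
proof -
  interpret N: module K N by fact
  show ?thesis
    by (rule linear_map_equalizer_submodule[OF assms]) (simp add: linear_map_def)
qed

lemma tensor_gens_closed:
  assumes "module K M" "module K N"
  shows "tensor_gens K M N \<subseteq> carrier (tensor_free K M N)"
proof -
  interpret M: module K M by fact
  interpret N: module K N by fact
  interpret F: module K "tensor_free K M N" by (rule free_module_module) (rule M.R.is_cring)
  have gen: "free_gen K (x, y) \<in> carrier (tensor_free K M N)"
    if "x \<in> carrier M" "y \<in> carrier N" for x y
    using that by (intro free_gen_closed M.R.is_cring) auto
  show ?thesis
    by (auto elim!: tensor_gens.cases intro!: F.minus_closed F.a_closed F.smult_closed gen
        simp del: free_module_simps)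
qed

lemma tensor_rels_submodule:
  assumes "module K M" "module K N"
  shows "submodule (tensor_rels K M N) K (tensor_free K M N)"
proof -
  interpret M: module K M by fact
  interpret F: module K "tensor_free K M N" by (rule free_module_module) (rule M.R.is_cring)
  \<comment> \<open>The full carrier belongs to the intersected family, so the intersection lies
    inside the carrier; an empty family would have given the whole type.\<close>
  have "carrier (tensor_free K M N) \<in>
      {R. submodule R K (tensor_free K M N) \<and> tensor_gens K M N \<subseteq> R}"
    using F.carrier_is_submodule tensor_gens_closed[OF assms] by simp
  then have "tensor_rels K M N \<subseteq> carrier (tensor_free K M N)"
    unfolding tensor_rels_def by (rule Inter_lower)
  then show ?thesis
  proof (rule F.submoduleI)
    have *: "\<zero>\<^bsub>tensor_free K M N\<^esub> \<in> R" if "submodule R K (tensor_free K M N)" for R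
      using subgroup.one_closed[OF submodule.axioms(1)[OF that]] by simp
    show "\<zero>\<^bsub>tensor_free K M N\<^esub> \<in> tensor_rels K M N"
      unfolding tensor_rels_def using * by blast
  qed (auto simp: tensor_rels_def F.submoduleE simp del: free_module_simps)
qed

lemma tensor_gens_rels: "tensor_gens K M N \<subseteq> tensor_rels K M N"
  by (auto simp: tensor_rels_def)

text \<open>The kernel of the evaluation is a submodule. Bilinearity of \<open>b\<close> puts every
  generating relation into it, hence it contains the smallest submodule with that property.\<close>

lemma tensor_rels_eval:
  assumes "module K M" "module K N" "module K P" "bilinear_map K M N P b"
    "r \<in> tensor_rels K M N"
  shows "free_eval K P (\<lambda>p. b (fst p) (snd p)) r = \<zero>\<^bsub>P\<^esub>"
proof -
  interpret M: module K M by fact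
  interpret N: module K N by fact
  interpret P: module K P by fact
  interpret F: module K "tensor_free K M N" by (rule free_module_module) (rule M.R.is_cring)
  let ?e = "free_eval K P (\<lambda>p. b (fst p) (snd p))"
  have b: "b x y \<in> carrier P" if "x \<in> carrier M" "y \<in> carrier N" for x y
    using assms(4) that by (rule bilinear_map_closed)
  have lin: "linear_map K (tensor_free K M N) P ?e"
    by (rule free_eval_linear) (auto simp: assms b)
  have gen: "free_gen K (x, y) \<in> carrier (tensor_free K M N)"
    if "x \<in> carrier M" "y \<in> carrier N" for x y
    using that by (intro free_gen_closed M.R.is_cring) auto
  have ev: "?e (free_gen K (x, y)) = b x y" if "x \<in> carrier M" "y \<in> carrier N" for x y
    using that by (subst free_eval_gen[where X = "carrier M \<times> carrier N"]) (auto simp: assms b)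
  note bl = linear_map_add[OF bilinear_map_left[OF assms(4)]]
    linear_map_add[OF bilinear_map_right[OF assms(4)]]
    linear_map_smult[OF bilinear_map_left[OF assms(4)]]
    linear_map_smult[OF bilinear_map_right[OF assms(4)]]
  have "tensor_gens K M N \<subseteq> {x \<in> carrier (tensor_free K M N). ?e x = \<zero>\<^bsub>P\<^esub>}"
  proof (intro subsetI CollectI conjI)
    fix t assume t: "t \<in> tensor_gens K M N"
    then show "t \<in> carrier (tensor_free K M N)" using tensor_gens_closed[OF assms(1,2)] by blast
    from t show "?e t = \<zero>\<^bsub>P\<^esub>"
      by cases (simp_all del: free_module_simps
          add: linear_map_minus[OF F.module_axioms assms(3) lin] linear_map_add[OF lin]
            linear_map_smult[OF lin] gen ev b bl P.r_neg a_minus_def[of P])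
  qed
  then have "tensor_rels K M N \<subseteq> {x \<in> carrier (tensor_free K M N). ?e x = \<zero>\<^bsub>P\<^esub>}"
    unfolding tensor_rels_def
    using linear_map_kernel_submodule[OF F.module_axioms assms(3) lin] by (intro Inter_lower) simp
  then show ?thesis using assms(5) by auto
qed

lemma a_r_coset_iff: "h \<in> R +>\<^bsub>G\<^esub> f \<longleftrightarrow> (\<exists>r\<in>R. h = r \<oplus>\<^bsub>G\<^esub> f)"
  by (auto simp: a_r_coset_def')

lemma tensor_rels_abelian_subgroup:
  assumes "module K M" "module K N"
  shows "abelian_subgroup (tensor_rels K M N) (tensor_free K M N)"
proof -
  interpret M: module K M by fact
  interpret F: module K "tensor_free K M N" by (rule free_module_module) (rule M.R.is_cring)
  show ?thesis
    by (intro abelian_subgroupI3 additive_subgroup.intro F.abelian_group_axioms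
        submodule.axioms(1)[OF tensor_rels_submodule[OF assms]])
qed

section \<open>The quotient as a module and its universal property\<close>

context
  fixes K :: "('k, 'm) ring_scheme" and M :: "('k, 'a) module" and N :: "('k, 'b) module"
  assumes M: "module K M" and N: "module K N"
begin

interpretation M: module K M by (rule M)
interpretation N: module K N by (rule N)
interpretation F: module K "tensor_free K M N" by (rule free_module_module) (rule M.R.is_cring)
interpretation R: abelian_subgroup "tensor_rels K M N" "tensor_free K M N"
  by (rule tensor_rels_abelian_subgroup[OF M N])

private abbreviation (input) "cls \<equiv> a_r_coset (tensor_free K M N) (tensor_rels K M N)"

lemma tensor_carrier_iff:
  "X \<in> carrier (tensor K M N) \<longleftrightarrow> (\<exists>f\<in>carrier (tensor_free K M N). X = cls f)"
  by (simp add: tensor_def tensor_space_def A_RCOSETS_def')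

lemma tensor_add:
  assumes "f \<in> carrier (tensor_free K M N)" "h \<in> carrier (tensor_free K M N)"
  shows "cls f \<oplus>\<^bsub>tensor K M N\<^esub> cls h = cls (f \<oplus>\<^bsub>tensor_free K M N\<^esub> h)"
  using R.a_rcos_sum[OF assms] by (simp add: tensor_def tensor_space_def)

text \<open>By definition the left side is the union of the cosets of a h over all representatives h
  of the class. These cosets coincide because the relations are closed under scaling, and the union
  is not empty because f is such a representative.\<close>

lemma tensor_smult:
  assumes a: "a \<in> carrier K" and f: "f \<in> carrier (tensor_free K M N)"
  shows "a \<odot>\<^bsub>tensor K M N\<^esub> cls f = cls (a \<odot>\<^bsub>tensor_free K M N\<^esub> f)"
proof -
  have "cls (a \<odot>\<^bsub>tensor_free K M N\<^esub> h) = cls (a \<odot>\<^bsub>tensor_free K M N\<^esub> f)" if h: "h \<in> cls f" for h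
  proof -
    obtain r where r: "r \<in> tensor_rels K M N" "h = r \<oplus>\<^bsub>tensor_free K M N\<^esub> f"
      using h by (auto simp: a_r_coset_iff simp del: free_module_simps)
    have "a \<odot>\<^bsub>tensor_free K M N\<^esub> h
        = a \<odot>\<^bsub>tensor_free K M N\<^esub> r \<oplus>\<^bsub>tensor_free K M N\<^esub> a \<odot>\<^bsub>tensor_free K M N\<^esub> f"
      using a f r R.a_Hcarr by (simp add: F.smult_r_distr del: free_module_simps)
    moreover have "a \<odot>\<^bsub>tensor_free K M N\<^esub> r \<in> tensor_rels K M N"
      by (rule submodule.smult_closed[OF tensor_rels_submodule[OF M N] a r(1)])
    ultimately have *: "a \<odot>\<^bsub>tensor_free K M N\<^esub> h \<in> cls (a \<odot>\<^bsub>tensor_free K M N\<^esub> f)"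
      unfolding a_r_coset_iff by (rule bexI)
    show ?thesis
      by (rule R.a_repr_independence'[OF * F.smult_closed[OF a f], symmetric])
  qed
  then have "(\<Union>h\<in>cls f. cls (a \<odot>\<^bsub>tensor_free K M N\<^esub> h))
      = (\<Union>h\<in>cls f. cls (a \<odot>\<^bsub>tensor_free K M N\<^esub> f))"
    by (intro SUP_cong refl)
  also have "\<dots> = cls (a \<odot>\<^bsub>tensor_free K M N\<^esub> f)"
    using R.a_rcos_self[OF f] by (intro UN_constant_eq ballI refl)
  finally show ?thesis
    by (simp add: tensor_def tensor_space_def del: free_module_simps)
qed

lemma tensor_zero: "\<zero>\<^bsub>tensor K M N\<^esub> = cls \<zero>\<^bsub>tensor_free K M N\<^esub>"
  using F.a_coset_add_zero[OF R.a_subset] by (simp add: tensor_def tensor_space_def)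

lemma tensor_module: "module K (tensor K M N)"
proof (intro moduleI abelian_groupI, goal_cases)
  case (7 X)
  then obtain f where f: "f \<in> carrier (tensor_free K M N)" "X = cls f"
    by (auto simp: tensor_carrier_iff)
  then have "cls (\<ominus>\<^bsub>tensor_free K M N\<^esub> f) \<oplus>\<^bsub>tensor K M N\<^esub> X = \<zero>\<^bsub>tensor K M N\<^esub>"
    by (simp add: tensor_add tensor_zero F.l_neg del: free_module_simps)
  then show ?case
    using f F.a_inv_closed tensor_carrier_iff by blast
qed (auto simp: tensor_carrier_iff tensor_add tensor_smult tensor_zero
      F.a_ac F.smult_l_distr F.smult_r_distr F.smult_assoc1 M.R.is_cring
      simp del: free_module_simps)

lemma pure_tensor_closed:
  assumes "x \<in> carrier M" "y \<in> carrier N"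
  shows "pure_tensor K M N x y \<in> carrier (tensor K M N)"
  using free_gen_closed[OF M.R.is_cring, of "(x, y)" "carrier M \<times> carrier N"] assms
  by (auto simp: pure_tensor_def tensor_carrier_iff)

text \<open>Each of the four laws says that the generating relation of the corresponding kind
  becomes zero in the quotient; \<open>eqI\<close> passes from such a relation to equality of
  cosets.\<close>

lemma pure_tensor_bilinear: "bilinear_map K M N (tensor K M N) (pure_tensor K M N)"
proof -
  have gen: "free_gen K (x, y) \<in> carrier (tensor_free K M N)"
    if "x \<in> carrier M" "y \<in> carrier N" for x y
    using that by (intro free_gen_closed M.R.is_cring) auto
  have eqI: "cls f = cls h"
    if "f \<ominus>\<^bsub>tensor_free K M N\<^esub> h \<in> tensor_gens K M N"
      "f \<in> carrier (tensor_free K M N)" "h \<in> carrier (tensor_free K M N)" for f h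
  proof -
    have "f = (f \<ominus>\<^bsub>tensor_free K M N\<^esub> h) \<oplus>\<^bsub>tensor_free K M N\<^esub> h"
      using that by (simp add: a_minus_def F.a_assoc F.l_neg del: free_module_simps(1,2))
    moreover have "f \<ominus>\<^bsub>tensor_free K M N\<^esub> h \<in> tensor_rels K M N"
      using that(1) tensor_gens_rels by blast
    ultimately have "f \<in> cls h"
      unfolding a_r_coset_iff by (rule bexI)
    then show ?thesis
      by (rule R.a_repr_independence'[symmetric, OF _ that(3)])
  qed
  show ?thesis
    unfolding pure_tensor_def
  proof (intro bilinear_mapI linear_mapI, goal_cases)
    case (2 x y y')
    then show ?case
      unfolding tensor_add[OF gen[OF 2(1,2)] gen[OF 2(1,3)]]
      by (intro eqI tensor_gens.intros gen F.a_closed) auto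
  next
    case (3 x a y)
    then show ?case
      unfolding tensor_smult[OF 3(2) gen[OF 3(1,3)]]
      by (intro eqI tensor_gens.intros gen F.smult_closed) auto
  next
    case (5 y x x')
    then show ?case
      unfolding tensor_add[OF gen[OF 5(2,1)] gen[OF 5(3,1)]]
      by (intro eqI tensor_gens.intros gen F.a_closed) auto
  next
    case (6 y a x)
    then show ?case
      unfolding tensor_smult[OF 6(2) gen[OF 6(3,1)]]
      by (intro eqI tensor_gens.intros gen F.smult_closed) auto
  qed (auto simp: tensor_carrier_iff intro!: bexI gen simp del: free_module_simps)
qed

text \<open>No case for zero or for scalar multiples arises: zero is the pure tensor 0 \<otimes> 0,
  and a scalar is absorbed by the left factor of a pure tensor.\<close>

lemma tensor_induct [consumes 1, case_names pure add]:
  assumes X: "X \<in> carrier (tensor K M N)"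
    and pure: "\<And>x y. \<lbrakk>x \<in> carrier M; y \<in> carrier N\<rbrakk> \<Longrightarrow> Q (pure_tensor K M N x y)"
    and add: "\<And>X Y. \<lbrakk>X \<in> carrier (tensor K M N); Y \<in> carrier (tensor K M N);
      Q X; Q Y\<rbrakk> \<Longrightarrow> Q (X \<oplus>\<^bsub>tensor K M N\<^esub> Y)"
  shows "Q X"
proof -
  obtain f where f: "f \<in> carrier (tensor_free K M N)" "X = cls f"
    using X by (auto simp: tensor_carrier_iff)
  have "Q (cls f)"
  proof (rule free_module_induct[OF M.R.is_cring f(1)])
    have "pure_tensor K M N \<zero>\<^bsub>M\<^esub> \<zero>\<^bsub>N\<^esub> = \<zero>\<^bsub>tensor K M N\<^esub>"
      by (rule linear_map_zero[OF N tensor_module bilinear_map_right[OF pure_tensor_bilinear]])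
        simp
    then show "Q (cls (\<lambda>x. \<zero>\<^bsub>K\<^esub>))"
      using pure[of "\<zero>\<^bsub>M\<^esub>" "\<zero>\<^bsub>N\<^esub>"] tensor_zero by simp
  next
    fix a p f
    assume a: "a \<in> carrier K" and p: "p \<in> carrier M \<times> carrier N"
      and f: "f \<in> carrier (tensor_free K M N)" and Q: "Q (cls f)"
    obtain x y where xy: "p = (x, y)" "x \<in> carrier M" "y \<in> carrier N" using p by auto
    have gen: "free_gen K p \<in> carrier (tensor_free K M N)"
      by (rule free_gen_closed[OF M.R.is_cring p])
    have "pure_tensor K M N (a \<odot>\<^bsub>M\<^esub> x) y = a \<odot>\<^bsub>tensor K M N\<^esub> pure_tensor K M N x y"
      using linear_map_smult[OF bilinear_map_left[OF pure_tensor_bilinear]] a xy by blast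
    also have "\<dots> = cls (a \<odot>\<^bsub>tensor_free K M N\<^esub> free_gen K p)"
      using a gen xy by (simp add: pure_tensor_def tensor_smult del: free_module_simps)
    finally have "Q (cls (a \<odot>\<^bsub>tensor_free K M N\<^esub> free_gen K p))"
      using pure[of "a \<odot>\<^bsub>M\<^esub> x" y] a xy by simp
    then have "Q (cls (a \<odot>\<^bsub>tensor_free K M N\<^esub> free_gen K p) \<oplus>\<^bsub>tensor K M N\<^esub> cls f)"
      using Q f F.smult_closed[OF a gen] by (intro add) (auto simp: tensor_carrier_iff)
    then have "Q (cls (a \<odot>\<^bsub>tensor_free K M N\<^esub> free_gen K p \<oplus>\<^bsub>tensor_free K M N\<^esub> f))"
      using f F.smult_closed[OF a gen] by (simp add: tensor_add del: free_module_simps)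
    then show "Q (cls (\<lambda>x. (a \<otimes>\<^bsub>K\<^esub> free_gen K p x) \<oplus>\<^bsub>K\<^esub> f x))" by simp
  qed
  then show ?thesis using f by simp
qed

context
  fixes P :: "('k, 'c) module" and b :: "'a \<Rightarrow> 'b \<Rightarrow> 'c"
  assumes P: "module K P" and b: "bilinear_map K M N P b"
begin

private lemma eval_linear:
  "linear_map K (tensor_free K M N) P (free_eval K P (\<lambda>p. b (fst p) (snd p)))"
  by (rule free_eval_linear) (auto simp: P bilinear_map_closed[OF b])

text \<open>Independence of the representative: the one picked by \<open>SOME\<close> differs from
  \<open>f\<close> by a relation, on which the evaluation vanishes.\<close>

private lemma tensor_lift_cls:
  assumes f: "f \<in> carrier (tensor_free K M N)"
  shows "tensor_lift K P b (cls f) = free_eval K P (\<lambda>p. b (fst p) (snd p)) f"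
proof -
  interpret P: module K P by (rule P)
  let ?h = "SOME h. h \<in> cls f"
  have "?h \<in> cls f"
    by (rule someI[of "\<lambda>h. h \<in> cls f"]) (rule R.a_rcos_self[OF f])
  then obtain r where r: "r \<in> tensor_rels K M N" "?h = r \<oplus>\<^bsub>tensor_free K M N\<^esub> f"
    by (auto simp: a_r_coset_iff simp del: free_module_simps)
  have "tensor_lift K P b (cls f) = free_eval K P (\<lambda>p. b (fst p) (snd p)) ?h"
    by (simp add: tensor_lift_def free_eval_def Let_def)
  also have "\<dots> = free_eval K P (\<lambda>p. b (fst p) (snd p)) f"
    using linear_map_add[OF eval_linear R.a_Hcarr[OF r(1)] f] tensor_rels_eval[OF M N P b r(1)]
      linear_map_closed[OF eval_linear f] r(2) by (simp del: free_module_simps)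
  finally show ?thesis .
qed

lemma tensor_lift_linear: "linear_map K (tensor K M N) P (tensor_lift K P b)"
  by (rule linear_mapI)
    (auto simp: tensor_carrier_iff tensor_lift_cls tensor_add tensor_smult
      F.a_closed F.smult_closed linear_map_closed[OF eval_linear] linear_map_add[OF eval_linear]
      linear_map_smult[OF eval_linear] simp del: free_module_simps)

lemma tensor_lift_pure:
  assumes "x \<in> carrier M" "y \<in> carrier N"
  shows "tensor_lift K P b (pure_tensor K M N x y) = b x y"
proof -
  have "(x, y) \<in> carrier M \<times> carrier N" using assms by simp
  then show ?thesis
    unfolding pure_tensor_def
    by (subst tensor_lift_cls, intro free_gen_closed M.R.is_cring, assumption,
        subst free_eval_gen[where X = "carrier M \<times> carrier N"])
      (auto simp: P bilinear_map_closed[OF b])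
qed

end

lemma tensor_linear_ext:
  assumes "linear_map K (tensor K M N) P f" "linear_map K (tensor K M N) P g"
    and "\<And>x y. \<lbrakk>x \<in> carrier M; y \<in> carrier N\<rbrakk> \<Longrightarrow>
      f (pure_tensor K M N x y) = g (pure_tensor K M N x y)"
    and "X \<in> carrier (tensor K M N)"
  shows "f X = g X"
  using assms(4)
  by (induction X rule: tensor_induct)
    (simp_all add: assms(3) linear_map_add[OF assms(1)] linear_map_add[OF assms(2)])

end

section \<open>Calculus of sums over the components of a tensor\<close>

lemma tensor_lift_closed:
  assumes "X \<in> carrier (tensor K M N)" "bilinear_map K M N P b"
    "module K M" "module K N" "module K P"
  shows "tensor_lift K P b X \<in> carrier P"
  using linear_map_closed[OF tensor_lift_linear[OF assms(3-5,2)] assms(1)] .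

text \<open>The premise on \<open>f\<close> stands first because it determines M and N: chaining
  solves it before it meets the bilinearity goal, where the two modules would otherwise be
  unknown.\<close>

lemma linear_map_tensor_lift:
  assumes "linear_map K D (tensor K M N) f" "bilinear_map K M N P b"
    "module K M" "module K N" "module K P"
  shows "linear_map K D P (\<lambda>x. tensor_lift K P b (f x))"
  using linear_map_compose[OF tensor_lift_linear[OF assms(3-5,2)] assms(1)] .

lemma linear_bilinear_compose:
  assumes "linear_map K P Q T" "bilinear_map K M N P b"
  shows "bilinear_map K M N Q (\<lambda>x y. T (b x y))"
proof (rule bilinear_mapI)
  show "linear_map K N Q (\<lambda>y. T (b x y))" if "x \<in> carrier M" for x
    by (rule linear_map_compose[OF assms(1) bilinear_map_right[OF assms(2) that]])
  show "linear_map K M Q (\<lambda>x. T (b x y))" if "y \<in> carrier N" for y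
    by (rule linear_map_compose[OF assms(1) bilinear_map_left[OF assms(2) that]])
qed

text \<open>Uniqueness in the universal property: both sides are linear in X and agree on pure
  tensors. In Sweedler notation, a linear map is pulled under the sum.\<close>

lemma tensor_lift_commute:
  assumes "module K M" "module K N" "module K P" "module K Q" "linear_map K P Q T"
    "X \<in> carrier (tensor K M N)" "bilinear_map K M N P b"
  shows "T (tensor_lift K P b X) = tensor_lift K Q (\<lambda>x y. T (b x y)) X"
proof -
  have b: "bilinear_map K M N Q (\<lambda>x y. T (b x y))"
    using assms(5,7) by (rule linear_bilinear_compose)
  show ?thesis
    by (rule tensor_linear_ext[OF assms(1,2) linear_map_compose[OF assms(5)]])
      (simp_all add: tensor_lift_linear tensor_lift_pure assms b)
qed

lemma bilinear_map_cong:
  assumes "module K M" "module K N" "bilinear_map K M N P b"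
    and "\<And>x y. \<lbrakk>x \<in> carrier M; y \<in> carrier N\<rbrakk> \<Longrightarrow> b x y = b' x y"
  shows "bilinear_map K M N P b'"
proof (rule bilinear_mapI)
  show "linear_map K N P (b' x)" if "x \<in> carrier M" for x
    by (rule linear_map_cong[OF assms(2) bilinear_map_right[OF assms(3) that] assms(4)[OF that]])
  show "linear_map K M P (\<lambda>x. b' x y)" if "y \<in> carrier N" for y
    by (rule linear_map_cong[OF assms(1) bilinear_map_left[OF assms(3) that] assms(4)[OF _ that]])
qed

text \<open>Rewriting under the sum, with access to the fact that the components lie in the
  carriers. Bilinearity of \<open>b'\<close> is inherited from \<open>b\<close>.\<close>

lemma tensor_lift_cong:
  assumes "module K M" "module K N" "module K P" "X \<in> carrier (tensor K M N)"
    "bilinear_map K M N P b"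
    and "\<And>x y. \<lbrakk>x \<in> carrier M; y \<in> carrier N\<rbrakk> \<Longrightarrow> b x y = b' x y"
  shows "tensor_lift K P b X = tensor_lift K P b' X"
proof -
  have b': "bilinear_map K M N P b'"
    using assms(1,2,5,6) by (rule bilinear_map_cong)
  show ?thesis
    by (rule tensor_linear_ext[where P = P, OF assms(1,2)])
      (simp_all add: tensor_lift_linear tensor_lift_pure assms(1-5) b' assms(6))
qed

text \<open>Counterpart of \<open>linear_map_tensor_lift\<close>: the tensor X stays fixed and the
  expression under the sum depends linearly on a parameter. The dependence is not a composite with a
  linear map, so it is proved by induction on X.\<close>

lemma linear_map_tensor_lift_family:
  assumes X: "X \<in> carrier (tensor K M N)"
    and b: "\<And>x. x \<in> carrier D \<Longrightarrow> bilinear_map K M N P (b x)"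
    and lin: "\<And>m n. \<lbrakk>m \<in> carrier M; n \<in> carrier N\<rbrakk> \<Longrightarrow> linear_map K D P (\<lambda>x. b x m n)"
    and mods: "module K D" "module K M" "module K N" "module K P"
  shows "linear_map K D P (\<lambda>x. tensor_lift K P (b x) X)"
proof -
  interpret D: module K D by fact
  interpret P: module K P by fact
  note lift = tensor_lift_linear[OF mods(2-4) b]
  show ?thesis
  proof (rule linear_mapI)
    fix x y assume x: "x \<in> carrier D" and y: "y \<in> carrier D"
    note xy = D.a_closed[OF x y]
    show "tensor_lift K P (b (x \<oplus>\<^bsub>D\<^esub> y)) X = tensor_lift K P (b x) X \<oplus>\<^bsub>P\<^esub> tensor_lift K P (b y) X"
      using X
    proof (induction X rule: tensor_induct[OF mods(2,3), consumes 1, case_names pure add])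
      case (pure m n)
      then show ?case
        using linear_map_add[OF lin x y]
        by (simp add: tensor_lift_pure mods(2-4) b x y xy)
    next
      case (add X Y)
      then show ?case
        by (simp add: linear_map_add[OF lift] x y xy P.a_ac linear_map_closed[OF lift])
    qed
  next
    fix a x assume a: "a \<in> carrier K" and x: "x \<in> carrier D"
    note ax = D.smult_closed[OF a x]
    show "tensor_lift K P (b (a \<odot>\<^bsub>D\<^esub> x)) X = a \<odot>\<^bsub>P\<^esub> tensor_lift K P (b x) X"
      using X
    proof (induction X rule: tensor_induct[OF mods(2,3), consumes 1, case_names pure add])
      case (pure m n)
      then show ?case
        using linear_map_smult[OF lin a x]
        by (simp add: tensor_lift_pure mods(2-4) b x ax)
    next
      case (add X Y)
      then show ?case
        by (simp add: linear_map_add[OF lift] x ax a P.smult_r_distr linear_map_closed[OF lift])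
    qed
  qed (rule linear_map_closed[OF lift X])
qed

lemma linear_map_pure_left:
  assumes "module K M" "module K N" "y \<in> carrier N" "linear_map K D M f"
  shows "linear_map K D (tensor K M N) (\<lambda>x. pure_tensor K M N (f x) y)"
  by (rule linear_map_compose[OF bilinear_map_left[OF pure_tensor_bilinear[OF assms(1,2)] assms(3)] assms(4)])

lemma linear_map_pure_right:
  assumes "module K M" "module K N" "x \<in> carrier M" "linear_map K D N f"
  shows "linear_map K D (tensor K M N) (\<lambda>y. pure_tensor K M N x (f y))"
  by (rule linear_map_compose[OF bilinear_map_right[OF pure_tensor_bilinear[OF assms(1,2)] assms(3)] assms(4)])

text \<open>Syntax-directed rules that prove an expression linear in one variable by descending to
  that variable. At a sum the variable may sit in the tensor or under the sum, but not in
  both.\<close>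

lemmas linear_intros =
  bilinear_mapI linear_map_pure_left linear_map_pure_right linear_map_tensor_lift
  linear_map_tensor_lift_family linear_map_mult_left linear_map_mult_right linear_map_smult_const
  linear_map_ident

lemmas closed_intros =
  pure_tensor_closed tensor_lift_closed assoc_algebra_mult_closed assoc_algebra_one_closed

text \<open>Reassembles a tensor from its components. It ends the two calculations in which all
  other factors have cancelled, \<open>L_eq_\<gamma>_proj\<close> and
  \<open>ind_map_ind_inv\<close>.\<close>

lemma tensor_lift_pure_tensor:
  assumes "module K M" "module K N" "X \<in> carrier (tensor K M N)"
  shows "tensor_lift K (tensor K M N) (pure_tensor K M N) X = X"
  by (rule tensor_linear_ext[OF assms(1,2) _ linear_map_ident _ assms(3)])
    (simp_all add: tensor_lift_linear tensor_lift_pure assms tensor_module pure_tensor_bilinear)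

lemma tensor_map_bilinear:
  assumes "module K M'" "module K N'" "linear_map K M M' f" "linear_map K N N' g"
  shows "bilinear_map K M N (tensor K M' N') (\<lambda>x y. pure_tensor K M' N' (f x) (g y))"
  by (rule linear_intros assms linear_map_closed[OF assms(3)] linear_map_closed[OF assms(4)] | assumption)+

lemma tensor_map_linear:
  assumes "module K M" "module K N" "module K M'" "module K N'"
    "linear_map K M M' f" "linear_map K N N' g"
  shows "linear_map K (tensor K M N) (tensor K M' N') (tensor_map K M' N' f g)"
  unfolding tensor_map_def
  by (rule tensor_lift_linear[OF assms(1,2) tensor_module[OF assms(3,4)] tensor_map_bilinear[OF assms(3-6)]])

lemma tensor_map_pure:
  assumes "module K M" "module K N" "module K M'" "module K N'"
    "linear_map K M M' f" "linear_map K N N' g" "x \<in> carrier M" "y \<in> carrier N"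
  shows "tensor_map K M' N' f g (pure_tensor K M N x y) = pure_tensor K M' N' (f x) (g y)"
  unfolding tensor_map_def
  by (rule tensor_lift_pure[OF assms(1,2) tensor_module[OF assms(3,4)] tensor_map_bilinear[OF assms(3-6)] assms(7,8)])

text \<open>Substitution rule: the components of (f \<otimes> g)(X) are f(x) and g(y), where x and y
  are those of X.\<close>

lemma tensor_lift_tensor_map:
  assumes "module K M" "module K N" "module K M'" "module K N'" "module K P"
    "linear_map K M M' f" "linear_map K N N' g" "X \<in> carrier (tensor K M N)"
    "bilinear_map K M' N' P b"
  shows "tensor_lift K P b (tensor_map K M' N' f g X) = tensor_lift K P (\<lambda>x y. b (f x) (g y)) X"
proof -
  have "tensor_lift K P b (tensor_map K M' N' f g X)
      = tensor_lift K P (\<lambda>x y. tensor_lift K P b (pure_tensor K M' N' (f x) (g y))) X"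
    unfolding tensor_map_def
    by (rule tensor_lift_commute[OF assms(1,2) tensor_module[OF assms(3,4)] assms(5)
          tensor_lift_linear[OF assms(3-5,9)] assms(8) tensor_map_bilinear[OF assms(3,4,6,7)]])
  also have "\<dots> = tensor_lift K P (\<lambda>x y. b (f x) (g y)) X"
  proof (rule tensor_lift_cong[OF assms(1,2,5,8)])
    show "bilinear_map K M N P (\<lambda>x y. tensor_lift K P b (pure_tensor K M' N' (f x) (g y)))"
      by (rule linear_bilinear_compose[OF tensor_lift_linear[OF assms(3-5,9)]
            tensor_map_bilinear[OF assms(3,4,6,7)]])
  qed (simp add: tensor_lift_pure assms linear_map_closed[OF assms(6)] linear_map_closed[OF assms(7)])
  finally show ?thesis .
qed

text \<open>Removes the tensors of (A \<otimes> B) \<otimes> C from the left side of a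
  coassociativity axiom: what is left is a sum over X with a sum over f(m) inside.\<close>

lemma tensor_assoc_tensor_map:
  assumes A: "module K A" and B: "module K B" and C: "module K C" and M: "module K M"
    and f: "linear_map K M (tensor K A B) f" and X: "X \<in> carrier (tensor K M C)"
  shows "tensor_assoc K A B C (tensor_map K (tensor K A B) C f id X) =
    tensor_lift K (tensor K A (tensor K B C))
      (\<lambda>m c. tensor_lift K (tensor K A (tensor K B C))
        (\<lambda>a b. pure_tensor K A (tensor K B C) a (pure_tensor K B C b c)) (f m)) X"
proof -
  note mods = A B C M tensor_module
  have "bilinear_map K (tensor K A B) C (tensor K A (tensor K B C))
      (\<lambda>X c. tensor_lift K (tensor K A (tensor K B C))
        (\<lambda>a b. pure_tensor K A (tensor K B C) a (pure_tensor K B C b c)) X)"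
    by (rule linear_intros closed_intros mods | assumption)+
  then show ?thesis
    unfolding tensor_assoc_def
    by (subst tensor_lift_tensor_map[OF M C tensor_module[OF A B] C _ f _ X])
      (simp_all add: id_def linear_map_ident mods)
qed

text \<open>The coassociativity axioms in the form in which Sweedler notation uses them: both sides of
  the equation are evaluated by an arbitrary trilinear map.\<close>

lemma coassoc_eval:
  assumes A: "module K A" and B: "module K B" and C: "module K C" and M: "module K M"
    and N: "module K N" and P: "module K P"
    and f: "linear_map K M (tensor K A B) f" and h: "linear_map K N (tensor K B C) h"
    and X: "X \<in> carrier (tensor K M C)" and Y: "Y \<in> carrier (tensor K A N)"
    and eq: "tensor_assoc K A B C (tensor_map K (tensor K A B) C f id X)
      = tensor_map K A (tensor K B C) id h Y"
    and F: "\<And>a b. \<lbrakk>a \<in> carrier A; b \<in> carrier B\<rbrakk> \<Longrightarrow> linear_map K C P (\<lambda>c. F a b c)"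
      "\<And>a c. \<lbrakk>a \<in> carrier A; c \<in> carrier C\<rbrakk> \<Longrightarrow> linear_map K B P (\<lambda>b. F a b c)"
      "\<And>b c. \<lbrakk>b \<in> carrier B; c \<in> carrier C\<rbrakk> \<Longrightarrow> linear_map K A P (\<lambda>a. F a b c)"
  shows "tensor_lift K P (\<lambda>m c. tensor_lift K P (\<lambda>a b. F a b c) (f m)) X
    = tensor_lift K P (\<lambda>a n. tensor_lift K P (\<lambda>b c. F a b c) (h n)) Y"
proof -
  note mods = A B C M N P tensor_module
  let ?ABC = "tensor K A (tensor K B C)"
  \<comment> \<open>The linear map on A \<otimes> (B \<otimes> C) that the trilinear F induces; the
    claim is its value on the two sides of \<open>eq\<close>.\<close>
  let ?T = "tensor_lift K P (\<lambda>a w. tensor_lift K P (\<lambda>b c. F a b c) w)"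
  have T_bil: "bilinear_map K A (tensor K B C) P (\<lambda>a w. tensor_lift K P (\<lambda>b c. F a b c) w)"
    by (rule linear_intros F mods | assumption)+
  have T: "linear_map K ?ABC P ?T"
    by (rule tensor_lift_linear[OF A tensor_module[OF B C] P T_bil])
  have T_pure: "?T (pure_tensor K A (tensor K B C) a (pure_tensor K B C b c)) = F a b c"
    if "a \<in> carrier A" "b \<in> carrier B" "c \<in> carrier C" for a b c
    using that by (simp add: tensor_lift_pure[OF A tensor_module[OF B C] P T_bil] mods
        pure_tensor_closed tensor_lift_pure bilinear_mapI F)
  have "?T (tensor_map K A (tensor K B C) id h Y)
    = tensor_lift K P (\<lambda>a n. tensor_lift K P (\<lambda>b c. F a b c) (h n)) Y"
    using h by (subst tensor_lift_tensor_map[OF A N A tensor_module[OF B C] P _ h Y T_bil])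
      (simp_all add: id_def linear_map_ident)
  moreover have "?T (tensor_assoc K A B C (tensor_map K (tensor K A B) C f id X))
    = tensor_lift K P (\<lambda>m c. tensor_lift K P (\<lambda>a b. F a b c) (f m)) X"
  proof -
    let ?u = "\<lambda>X z. tensor_lift K ?ABC (\<lambda>x y. pure_tensor K A (tensor K B C) x (pure_tensor K B C y z)) X"
    have uf: "bilinear_map K M C ?ABC (\<lambda>m c. ?u (f m) c)"
      by (rule linear_intros closed_intros mods f linear_map_closed[OF f] | assumption)+
    have "?T (tensor_assoc K A B C (tensor_map K (tensor K A B) C f id X))
      = ?T (tensor_lift K ?ABC (\<lambda>m c. ?u (f m) c) X)"
      by (simp only: tensor_assoc_tensor_map[OF A B C M f X])
    also have "\<dots> = tensor_lift K P (\<lambda>m c. ?T (?u (f m) c)) X"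
      by (rule tensor_lift_commute[OF M C _ P T X uf]) (intro mods)
    also have "\<dots> = tensor_lift K P (\<lambda>m c. tensor_lift K P (\<lambda>a b. F a b c) (f m)) X"
    proof (rule tensor_lift_cong[OF M C P X])
      show "bilinear_map K M C P (\<lambda>m c. ?T (?u (f m) c))"
        using T uf by (rule linear_bilinear_compose)
      fix m c assume m: "m \<in> carrier M" and c: "c \<in> carrier C"
      have v: "bilinear_map K A B ?ABC (\<lambda>x y. pure_tensor K A (tensor K B C) x (pure_tensor K B C y c))"
        by (rule linear_intros closed_intros mods c | assumption)+
      have "?T (?u (f m) c) = tensor_lift K P (\<lambda>x y. ?T (pure_tensor K A (tensor K B C) x (pure_tensor K B C y c))) (f m)"
        by (rule tensor_lift_commute[OF A B _ P T linear_map_closed[OF f m] v]) (intro mods)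
      also have "\<dots> = tensor_lift K P (\<lambda>a b. F a b c) (f m)"
      proof (rule tensor_lift_cong[OF A B P linear_map_closed[OF f m]])
        show "bilinear_map K A B P (\<lambda>x y. ?T (pure_tensor K A (tensor K B C) x (pure_tensor K B C y c)))"
          using T v by (rule linear_bilinear_compose)
      qed (simp add: T_pure c)
      finally show "?T (?u (f m) c) = tensor_lift K P (\<lambda>a b. F a b c) (f m)" .
    qed
    finally show ?thesis .
  qed
  ultimately show ?thesis using eq by simp
qed

section \<open>The base field as a module\<close>

lemma base_algebra_module:
  assumes "cring K"
  shows "module K (base_algebra K)"
proof -
  interpret K: cring K by fact
  show ?thesis
    by (intro moduleI abelian_groupI)
      (auto simp: base_algebra_def K.is_cring K.a_ac K.l_distr K.r_distr K.m_assoc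
        intro!: bexI[of _ "\<ominus>\<^bsub>K\<^esub> _"] K.l_neg)
qed

lemma linear_map_smult_left:
  assumes "linear_map K D (base_algebra K) f" "module K M" "x \<in> carrier M"
  shows "linear_map K D M (\<lambda>d. f d \<odot>\<^bsub>M\<^esub> x)"
proof -
  interpret M: module K M by fact
  have K: "f d \<in> carrier K" if "d \<in> carrier D" for d
    using linear_map_closed[OF assms(1) that] by (simp add: base_algebra_def)
  show ?thesis
    using linear_map_add[OF assms(1)] linear_map_smult[OF assms(1)] assms(3)
    by (intro linear_mapI) (simp_all add: K base_algebra_def M.smult_l_distr M.smult_assoc1)
qed

section \<open>Tensor products of algebras\<close>

text \<open>The product was defined with sums in \<open>tensor_space\<close>. Adding a product and a
  unit to that record leaves addition, zero and scalar multiplication alone, so both records give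
  the same \<open>tensor_lift\<close>.\<close>

lemma tensor_mult:
  "X \<otimes>\<^bsub>tensor K M N\<^esub> Y = tensor_lift K (tensor K M N) (\<lambda>x y. tensor_lift K (tensor K M N)
    (\<lambda>x' y'. pure_tensor K M N (x \<otimes>\<^bsub>M\<^esub> x') (y \<otimes>\<^bsub>N\<^esub> y')) Y) X"
proof -
  have "tensor_lift K (tensor K M N) = tensor_lift K (tensor_space K M N)"
    by (simp add: fun_eq_iff tensor_lift_def finsum_def tensor_def)
  show ?thesis
    unfolding \<open>tensor_lift K (tensor K M N) = _\<close> by (simp add: tensor_def)
qed

lemma tensor_one: "\<one>\<^bsub>tensor K M N\<^esub> = pure_tensor K M N \<one>\<^bsub>M\<^esub> \<one>\<^bsub>N\<^esub>"
  by (simp add: tensor_def)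

context
  fixes K :: "('k, 'm) ring_scheme" and M :: "('k, 'a) module" and N :: "('k, 'b) module"
  assumes M: "assoc_algebra K M" and N: "assoc_algebra K N"
begin

interpretation M: ring M using M by (simp add: assoc_algebra_def)
interpretation N: ring N using N by (simp add: assoc_algebra_def)

private lemmas mods = assoc_algebra_module[OF M] assoc_algebra_module[OF N] tensor_module

private abbreviation (input) "T \<equiv> tensor K M N"

lemma tensor_mult_bilinear: "bilinear_map K T T T (\<lambda>X Y. X \<otimes>\<^bsub>T\<^esub> Y)"
  unfolding tensor_mult
  by (rule linear_intros closed_intros mods M N | assumption)+

private lemmas lin =
  linear_map_compose[OF bilinear_map_left[OF tensor_mult_bilinear]]
  linear_map_compose[OF bilinear_map_right[OF tensor_mult_bilinear]]
private lemmas cl = bilinear_map_closed[OF tensor_mult_bilinear]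

lemma tensor_mult_pure:
  assumes "x \<in> carrier M" "y \<in> carrier N" "x' \<in> carrier M" "y' \<in> carrier N"
  shows "pure_tensor K M N x y \<otimes>\<^bsub>T\<^esub> pure_tensor K M N x' y'
    = pure_tensor K M N (x \<otimes>\<^bsub>M\<^esub> x') (y \<otimes>\<^bsub>N\<^esub> y')"
proof -
  let ?u = "\<lambda>x y x' y'. pure_tensor K M N (x \<otimes>\<^bsub>M\<^esub> x') (y \<otimes>\<^bsub>N\<^esub> y')"
  have 1: "bilinear_map K M N T (\<lambda>x y. tensor_lift K T (?u x y) (pure_tensor K M N x' y'))"
    by (rule linear_intros closed_intros mods M N assms | assumption)+
  have 2: "bilinear_map K M N T (?u x y)"
    by (rule linear_intros closed_intros mods M N assms | assumption)+
  show ?thesis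
    unfolding tensor_mult
    by (simp add: tensor_lift_pure[OF mods(1,2) tensor_module[OF mods(1,2)] 1]
        tensor_lift_pure[OF mods(1,2) tensor_module[OF mods(1,2)] 2] assms)
qed

text \<open>Both sides of the associative law are linear in each factor, so extensionality is
  applied once per factor until only pure tensors remain, where the law holds componentwise.\<close>

lemma tensor_assoc_algebra: "assoc_algebra K T"
proof -
  interpret T: module K T by (rule tensor_module[OF mods(1,2)])
  note ext = tensor_linear_ext[where P = T, OF mods(1,2)]
  note pure = pure_tensor_closed[OF mods(1,2)]
  have one: "\<one>\<^bsub>T\<^esub> \<in> carrier T" by (simp add: tensor_one pure)
  have l_one: "\<one>\<^bsub>T\<^esub> \<otimes>\<^bsub>T\<^esub> X = X" if "X \<in> carrier T" for X
    by (rule ext[OF _ _ _ that], rule lin[OF one linear_map_ident], rule linear_map_ident)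
      (simp add: tensor_one tensor_mult_pure)
  have r_one: "X \<otimes>\<^bsub>T\<^esub> \<one>\<^bsub>T\<^esub> = X" if "X \<in> carrier T" for X
    by (rule ext[OF _ _ _ that], rule lin[OF one linear_map_ident], rule linear_map_ident)
      (simp add: tensor_one tensor_mult_pure)
  have assoc: "(X \<otimes>\<^bsub>T\<^esub> Y) \<otimes>\<^bsub>T\<^esub> Z = X \<otimes>\<^bsub>T\<^esub> (Y \<otimes>\<^bsub>T\<^esub> Z)"
    if X: "X \<in> carrier T" and Y: "Y \<in> carrier T" and Z: "Z \<in> carrier T" for X Y Z
  proof (rule ext[OF _ _ _ X])
    show "linear_map K T T (\<lambda>X. (X \<otimes>\<^bsub>T\<^esub> Y) \<otimes>\<^bsub>T\<^esub> Z)"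
      by (rule lin linear_map_ident Y Z)+
    show "linear_map K T T (\<lambda>X. X \<otimes>\<^bsub>T\<^esub> (Y \<otimes>\<^bsub>T\<^esub> Z))"
      by (rule lin linear_map_ident cl Y Z)+
    fix x y assume xy: "x \<in> carrier M" "y \<in> carrier N"
    show "(pure_tensor K M N x y \<otimes>\<^bsub>T\<^esub> Y) \<otimes>\<^bsub>T\<^esub> Z = pure_tensor K M N x y \<otimes>\<^bsub>T\<^esub> (Y \<otimes>\<^bsub>T\<^esub> Z)"
    proof (rule ext[OF _ _ _ Y])
      show "linear_map K T T (\<lambda>Y. (pure_tensor K M N x y \<otimes>\<^bsub>T\<^esub> Y) \<otimes>\<^bsub>T\<^esub> Z)"
        by (rule lin linear_map_ident pure xy Z)+
      show "linear_map K T T (\<lambda>Y. pure_tensor K M N x y \<otimes>\<^bsub>T\<^esub> (Y \<otimes>\<^bsub>T\<^esub> Z))"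
        by (rule lin linear_map_ident pure xy Z)+
      fix x' y' assume xy': "x' \<in> carrier M" "y' \<in> carrier N"
      show "(pure_tensor K M N x y \<otimes>\<^bsub>T\<^esub> pure_tensor K M N x' y') \<otimes>\<^bsub>T\<^esub> Z
        = pure_tensor K M N x y \<otimes>\<^bsub>T\<^esub> (pure_tensor K M N x' y' \<otimes>\<^bsub>T\<^esub> Z)"
      proof (rule ext[OF _ _ _ Z])
        show "linear_map K T T (\<lambda>Z. (pure_tensor K M N x y \<otimes>\<^bsub>T\<^esub> pure_tensor K M N x' y') \<otimes>\<^bsub>T\<^esub> Z)"
          by (rule lin linear_map_ident pure cl xy xy')+
        show "linear_map K T T (\<lambda>Z. pure_tensor K M N x y \<otimes>\<^bsub>T\<^esub> (pure_tensor K M N x' y' \<otimes>\<^bsub>T\<^esub> Z))"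
          by (rule lin linear_map_ident pure xy xy')+
      qed (simp add: tensor_mult_pure xy xy' M.m_assoc N.m_assoc)
    qed
  qed
  note bl = bilinear_map_left[OF tensor_mult_bilinear] bilinear_map_right[OF tensor_mult_bilinear]
  have monoid: "monoid T"
    by (rule monoidI; (rule cl one assoc l_one r_one; assumption)?)
  have "ring T"
    by (rule ringI[OF T.abelian_group_axioms monoid])
      (rule linear_map_add[OF bl(1)] linear_map_add[OF bl(2)]; assumption)+
  moreover have "(a \<odot>\<^bsub>T\<^esub> X) \<otimes>\<^bsub>T\<^esub> Y = a \<odot>\<^bsub>T\<^esub> (X \<otimes>\<^bsub>T\<^esub> Y)"
    "X \<otimes>\<^bsub>T\<^esub> (a \<odot>\<^bsub>T\<^esub> Y) = a \<odot>\<^bsub>T\<^esub> (X \<otimes>\<^bsub>T\<^esub> Y)"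
    if "a \<in> carrier K" "X \<in> carrier T" "Y \<in> carrier T" for a X Y
    by (rule linear_map_smult[OF bl(1)] linear_map_smult[OF bl(2)]; fact)+
  ultimately show ?thesis
    unfolding assoc_algebra_def using T.module_axioms by simp
qed

end

lemma algebra_map_linear: "algebra_map K A B f \<Longrightarrow> linear_map K A B f"
  by (simp add: algebra_map_def)

lemma algebra_map_mult:
  "\<lbrakk>algebra_map K A B f; x \<in> carrier A; y \<in> carrier A\<rbrakk> \<Longrightarrow> f (x \<otimes>\<^bsub>A\<^esub> y) = f x \<otimes>\<^bsub>B\<^esub> f y"
  by (simp add: algebra_map_def ring_hom_mult)

lemma algebra_map_one: "algebra_map K A B f \<Longrightarrow> f \<one>\<^bsub>A\<^esub> = \<one>\<^bsub>B\<^esub>"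
  by (simp add: algebra_map_def ring_hom_one)

lemma algebra_mapI:
  assumes "linear_map K A B f"
    and "\<And>x y. \<lbrakk>x \<in> carrier A; y \<in> carrier A\<rbrakk> \<Longrightarrow> f (x \<otimes>\<^bsub>A\<^esub> y) = f x \<otimes>\<^bsub>B\<^esub> f y"
    and "f \<one>\<^bsub>A\<^esub> = \<one>\<^bsub>B\<^esub>"
  shows "algebra_map K A B f"
  unfolding algebra_map_def
  by (intro conjI ring_hom_memI assms linear_map_closed[OF assms(1)] linear_map_add[OF assms(1)])

lemma algebra_map_ident: "algebra_map K A A (\<lambda>x. x)"
  by (intro algebra_mapI linear_map_ident refl)

lemma algebra_map_compose:
  assumes "algebra_map K B D g" "algebra_map K A B f"
  shows "algebra_map K A D (\<lambda>x. g (f x))"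
proof -
  note lin = algebra_map_linear[OF assms(1)] algebra_map_linear[OF assms(2)]
  show ?thesis
    by (intro algebra_mapI linear_map_compose[OF lin])
      (simp_all add: algebra_map_mult[OF assms(1)] algebra_map_mult[OF assms(2)]
        algebra_map_one[OF assms(1)] algebra_map_one[OF assms(2)] linear_map_closed[OF lin(2)])
qed

text \<open>Serves to make (\<sigma> \<otimes> I)\<Delta> an algebra map, which every manipulation
  of L(\<gamma>(c) b) relies on. Multiplicativity is checked on pure tensors in one argument after
  the other.\<close>

lemma tensor_map_algebra_map:
  assumes M: "assoc_algebra K M" and N: "assoc_algebra K N" and M': "assoc_algebra K M'"
    and N': "assoc_algebra K N'" and f: "algebra_map K M M' f" and g: "algebra_map K N N' g"
  shows "algebra_map K (tensor K M N) (tensor K M' N') (tensor_map K M' N' f g)"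
proof -
  note mods = assoc_algebra_module[OF M] assoc_algebra_module[OF N] assoc_algebra_module[OF M']
    assoc_algebra_module[OF N']
  let ?T = "tensor K M N" and ?T' = "tensor K M' N'" and ?h = "tensor_map K M' N' f g"
  note fl = algebra_map_linear[OF f] and gl = algebra_map_linear[OF g]
  have h: "linear_map K ?T ?T' ?h" by (rule tensor_map_linear[OF mods fl gl])
  note hp = tensor_map_pure[OF mods fl gl]
  note ext = tensor_linear_ext[where P = ?T', OF mods(1,2)]
  note lin = linear_map_mult_left[OF tensor_assoc_algebra[OF M N]]
    linear_map_mult_right[OF tensor_assoc_algebra[OF M N]]
    linear_map_mult_left[OF tensor_assoc_algebra[OF M' N']]
    linear_map_mult_right[OF tensor_assoc_algebra[OF M' N']]
    linear_map_compose[OF h] linear_map_ident linear_map_closed[OF h]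
    pure_tensor_closed[OF mods(1,2)]
  have "?h (X \<otimes>\<^bsub>?T\<^esub> Y) = ?h X \<otimes>\<^bsub>?T'\<^esub> ?h Y" if X: "X \<in> carrier ?T" and Y: "Y \<in> carrier ?T" for X Y
  proof (rule ext[OF _ _ _ X])
    show "linear_map K ?T ?T' (\<lambda>X. ?h (X \<otimes>\<^bsub>?T\<^esub> Y))" by (rule lin Y)+
    show "linear_map K ?T ?T' (\<lambda>X. ?h X \<otimes>\<^bsub>?T'\<^esub> ?h Y)" by (rule lin Y)+
    fix x y assume xy: "x \<in> carrier M" "y \<in> carrier N"
    show "?h (pure_tensor K M N x y \<otimes>\<^bsub>?T\<^esub> Y) = ?h (pure_tensor K M N x y) \<otimes>\<^bsub>?T'\<^esub> ?h Y"
    proof (rule ext[OF _ _ _ Y])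
      show "linear_map K ?T ?T' (\<lambda>Y. ?h (pure_tensor K M N x y \<otimes>\<^bsub>?T\<^esub> Y))" by (rule lin xy)+
      show "linear_map K ?T ?T' (\<lambda>Y. ?h (pure_tensor K M N x y) \<otimes>\<^bsub>?T'\<^esub> ?h Y)" by (rule lin xy)+
    qed (simp add: tensor_mult_pure[OF M N] tensor_mult_pure[OF M' N'] xy hp
        linear_map_closed[OF fl] linear_map_closed[OF gl] algebra_map_mult[OF f]
        algebra_map_mult[OF g] assoc_algebra_mult_closed[OF M] assoc_algebra_mult_closed[OF N])
  qed
  then show ?thesis
    by (intro algebra_mapI h)
      (simp_all add: tensor_one hp assoc_algebra_one_closed[OF M]
        assoc_algebra_one_closed[OF N] algebra_map_one[OF f] algebra_map_one[OF g])
qed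

section \<open>Comodules over a cleft comodule algebra\<close>

text \<open>The group index is gone: C stands for C_1, A for H_\<alpha> and V for V_1. The
  coassociativity axioms keep the shape that \<open>coassoc_eval\<close> takes as input, while
  counits, inverse and colinearity are already given as sums over components.\<close>

locale cleft_comodule =
  fixes K :: "('k, 'm) ring_scheme" and C :: "('k, 'c) module" and A :: "('k, 'a) module"
    and V :: "('k, 'v) module"
    and \<Delta> :: "'c \<Rightarrow> ('k, 'c, 'c) tensor" and \<epsilon> :: "'c \<Rightarrow> 'k"
    and L :: "'a \<Rightarrow> ('k, 'c, 'a) tensor" and \<rho> :: "'v \<Rightarrow> ('k, 'v, 'c) tensor"
    and \<gamma> :: "'c \<Rightarrow> 'a" and \<gamma>' :: "'c \<Rightarrow> 'a"
  assumes C: "assoc_algebra K C" and A: "assoc_algebra K A" and V: "module K V"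
    and \<Delta>: "linear_map K C (tensor K C C) \<Delta>"
    and \<epsilon>: "linear_map K C (base_algebra K) \<epsilon>"
    and L: "algebra_map K A (tensor K C A) L"
    and L_coassoc: "a \<in> carrier A \<Longrightarrow>
      tensor_assoc K C C A (tensor_map K (tensor K C C) A \<Delta> id (L a))
        = tensor_map K C (tensor K C A) id L (L a)"
    and L_counit: "a \<in> carrier A \<Longrightarrow> tensor_lift K A (\<lambda>c x. \<epsilon> c \<odot>\<^bsub>A\<^esub> x) (L a) = a"
    and \<rho>: "linear_map K V (tensor K V C) \<rho>"
    and \<rho>_coassoc: "v \<in> carrier V \<Longrightarrow>
      tensor_assoc K V C C (tensor_map K (tensor K V C) C \<rho> id (\<rho> v))
        = tensor_map K V (tensor K C C) id \<Delta> (\<rho> v)"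
    and \<rho>_counit: "v \<in> carrier V \<Longrightarrow> tensor_lift K V (\<lambda>w c. \<epsilon> c \<odot>\<^bsub>V\<^esub> w) (\<rho> v) = v"
    and \<gamma>: "linear_map K C A \<gamma>" and \<gamma>': "linear_map K C A \<gamma>'"
    and \<gamma>_\<gamma>': "c \<in> carrier C \<Longrightarrow>
      tensor_lift K A (\<lambda>x y. \<gamma> x \<otimes>\<^bsub>A\<^esub> \<gamma>' y) (\<Delta> c) = \<epsilon> c \<odot>\<^bsub>A\<^esub> \<one>\<^bsub>A\<^esub>"
    and \<gamma>'_\<gamma>: "c \<in> carrier C \<Longrightarrow>
      tensor_lift K A (\<lambda>x y. \<gamma>' x \<otimes>\<^bsub>A\<^esub> \<gamma> y) (\<Delta> c) = \<epsilon> c \<odot>\<^bsub>A\<^esub> \<one>\<^bsub>A\<^esub>"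
    and \<gamma>_colinear: "c \<in> carrier C \<Longrightarrow>
      L (\<gamma> c) = tensor_lift K (tensor K C A) (\<lambda>x y. pure_tensor K C A x (\<gamma> y)) (\<Delta> c)"
begin

sublocale A: ring A using A by (simp add: assoc_algebra_def)
sublocale C: ring C using C by (simp add: assoc_algebra_def)

abbreviation "CA \<equiv> tensor K C A"
abbreviation "VA \<equiv> tensor K V A"

lemmas modC = assoc_algebra_module[OF C]
lemmas modA = assoc_algebra_module[OF A]

lemma cringK: "cring K"
  using modC by (rule module.axioms)

lemmas CA_algebra = tensor_assoc_algebra[OF C A]
lemmas L_linear = algebra_map_linear[OF L]

definition proj :: "'a \<Rightarrow> 'a" where
  "proj a = tensor_lift K A (\<lambda>c x. \<gamma>' c \<otimes>\<^bsub>A\<^esub> x) (L a)"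

lemmas mods = modC modA V tensor_module base_algebra_module[OF cringK]

lemma \<epsilon>_closed: "c \<in> carrier C \<Longrightarrow> \<epsilon> c \<in> carrier K"
  using linear_map_closed[OF \<epsilon>] by (simp add: base_algebra_def)

lemmas basic_closed = pure_tensor_closed[OF modC modA] assoc_algebra_mult_closed[OF A]
  assoc_algebra_one_closed[OF A] assoc_algebra_one_closed[OF C]
  assoc_algebra_mult_closed[OF CA_algebra] closed_intros
  linear_map_closed[OF \<Delta>] linear_map_closed[OF L_linear] linear_map_closed[OF \<rho>]
  linear_map_closed[OF \<gamma>] linear_map_closed[OF \<gamma>'] \<epsilon>_closed module.smult_closed[OF modA]
  module.smult_closed[OF V]

lemmas basic_linear = linear_intros linear_map_smult_left
  linear_map_compose[OF \<Delta>] linear_map_compose[OF \<epsilon>] linear_map_compose[OF L_linear]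
  linear_map_compose[OF \<rho>] linear_map_compose[OF \<gamma>] linear_map_compose[OF \<gamma>']

lemma proj_linear: "linear_map K A A proj"
  unfolding proj_def by (rule basic_linear basic_closed mods A | assumption)+

lemmas lin = basic_linear linear_map_compose[OF proj_linear] mods A CA_algebra
lemmas closed = basic_closed linear_map_closed[OF proj_linear]

text \<open>Right multiplication by \<open>a\<close> passes through the convolution identities. The
  factors are bracketed to the right because this is how they arise from nested sums.\<close>

lemma inverse_mult:
  assumes c: "c \<in> carrier C" and a: "a \<in> carrier A"
  shows "tensor_lift K A (\<lambda>x y. \<gamma> x \<otimes>\<^bsub>A\<^esub> (\<gamma>' y \<otimes>\<^bsub>A\<^esub> a)) (\<Delta> c) = \<epsilon> c \<odot>\<^bsub>A\<^esub> a"
    and "tensor_lift K A (\<lambda>x y. \<gamma>' x \<otimes>\<^bsub>A\<^esub> (\<gamma> y \<otimes>\<^bsub>A\<^esub> a)) (\<Delta> c) = \<epsilon> c \<odot>\<^bsub>A\<^esub> a"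
proof -
  have *: "tensor_lift K A (\<lambda>x y. f x \<otimes>\<^bsub>A\<^esub> (h y \<otimes>\<^bsub>A\<^esub> a)) (\<Delta> c) = \<epsilon> c \<odot>\<^bsub>A\<^esub> a"
    if f: "linear_map K C A f" and h: "linear_map K C A h"
      and fh: "tensor_lift K A (\<lambda>x y. f x \<otimes>\<^bsub>A\<^esub> h y) (\<Delta> c) = \<epsilon> c \<odot>\<^bsub>A\<^esub> \<one>\<^bsub>A\<^esub>" for f h
  proof -
    note fh_lin = linear_map_closed[OF f] linear_map_closed[OF h]
      linear_map_compose[OF f] linear_map_compose[OF h]
    have fh_bil: "bilinear_map K C C A (\<lambda>x y. f x \<otimes>\<^bsub>A\<^esub> h y)"
      by (rule lin fh_lin closed | assumption)+
    have ra: "linear_map K A A (\<lambda>z. z \<otimes>\<^bsub>A\<^esub> a)"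
      by (rule lin a)+
    have "tensor_lift K A (\<lambda>x y. f x \<otimes>\<^bsub>A\<^esub> (h y \<otimes>\<^bsub>A\<^esub> a)) (\<Delta> c)
      = tensor_lift K A (\<lambda>x y. (f x \<otimes>\<^bsub>A\<^esub> h y) \<otimes>\<^bsub>A\<^esub> a) (\<Delta> c)"
      by (rule tensor_lift_cong[OF modC modC modA linear_map_closed[OF \<Delta> c]],
          (rule lin fh_lin closed a | assumption)+)
        (simp add: A.m_assoc fh_lin(1,2) a)
    also have "\<dots> = tensor_lift K A (\<lambda>x y. f x \<otimes>\<^bsub>A\<^esub> h y) (\<Delta> c) \<otimes>\<^bsub>A\<^esub> a"
      by (rule tensor_lift_commute[OF modC modC modA modA ra linear_map_closed[OF \<Delta> c] fh_bil, symmetric])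
    also have "\<dots> = \<epsilon> c \<odot>\<^bsub>A\<^esub> a"
      using A a \<epsilon>_closed[OF c] by (simp add: fh assoc_algebra_def)
    finally show ?thesis .
  qed
  show "tensor_lift K A (\<lambda>x y. \<gamma> x \<otimes>\<^bsub>A\<^esub> (\<gamma>' y \<otimes>\<^bsub>A\<^esub> a)) (\<Delta> c) = \<epsilon> c \<odot>\<^bsub>A\<^esub> a"
    by (rule *[OF \<gamma> \<gamma>' \<gamma>_\<gamma>'[OF c]])
  show "tensor_lift K A (\<lambda>x y. \<gamma>' x \<otimes>\<^bsub>A\<^esub> (\<gamma> y \<otimes>\<^bsub>A\<^esub> a)) (\<Delta> c) = \<epsilon> c \<odot>\<^bsub>A\<^esub> a"
    by (rule *[OF \<gamma>' \<gamma> \<gamma>'_\<gamma>[OF c]])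
qed

text \<open>With \<open>F\<close> as evaluation, both sides are the sum over the iterated coaction
  a_{-2} \<otimes> a_{-1} \<otimes> a_0: on the left the C-component of L(a) is split by \<Delta>,
  on the right the A-component by L.\<close>

lemma L_coassoc_eval:
  assumes a: "a \<in> carrier A" and P: "module K P"
    and F: "\<And>c d. \<lbrakk>c \<in> carrier C; d \<in> carrier C\<rbrakk> \<Longrightarrow> linear_map K A P (\<lambda>x. F c d x)"
      "\<And>c x. \<lbrakk>c \<in> carrier C; x \<in> carrier A\<rbrakk> \<Longrightarrow> linear_map K C P (\<lambda>d. F c d x)"
      "\<And>d x. \<lbrakk>d \<in> carrier C; x \<in> carrier A\<rbrakk> \<Longrightarrow> linear_map K C P (\<lambda>c. F c d x)"
  shows "tensor_lift K P (\<lambda>m x. tensor_lift K P (\<lambda>c d. F c d x) (\<Delta> m)) (L a)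
    = tensor_lift K P (\<lambda>c y. tensor_lift K P (\<lambda>d x. F c d x) (L y)) (L a)"
  by (rule coassoc_eval[OF modC modC modA modC modA P \<Delta> L_linear linear_map_closed[OF L_linear a]
      linear_map_closed[OF L_linear a] L_coassoc[OF a]]) (fact F)+

lemma \<rho>_coassoc_eval:
  assumes v: "v \<in> carrier V" and P: "module K P"
    and F: "\<And>w c. \<lbrakk>w \<in> carrier V; c \<in> carrier C\<rbrakk> \<Longrightarrow> linear_map K C P (\<lambda>d. F w c d)"
      "\<And>w d. \<lbrakk>w \<in> carrier V; d \<in> carrier C\<rbrakk> \<Longrightarrow> linear_map K C P (\<lambda>c. F w c d)"
      "\<And>c d. \<lbrakk>c \<in> carrier C; d \<in> carrier C\<rbrakk> \<Longrightarrow> linear_map K V P (\<lambda>w. F w c d)"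
  shows "tensor_lift K P (\<lambda>w d. tensor_lift K P (\<lambda>u c. F u c d) (\<rho> w)) (\<rho> v)
    = tensor_lift K P (\<lambda>w m. tensor_lift K P (\<lambda>c d. F w c d) (\<Delta> m)) (\<rho> v)"
  by (rule coassoc_eval[OF V modC modC V modC P \<rho> \<Delta> linear_map_closed[OF \<rho> v]
      linear_map_closed[OF \<rho> v] \<rho>_coassoc[OF v]]) (fact F)+

text \<open>Colinearity turns L(\<gamma>(c)) into c_1 \<otimes> \<gamma>(c_2), and multiplication by
  1 \<otimes> a acts on the second factor only. For coinvariant a the left side is L(\<gamma>(c)
  a).\<close>

lemma L_\<gamma>_mult:
  assumes c: "c \<in> carrier C" and a: "a \<in> carrier A"
  shows "L (\<gamma> c) \<otimes>\<^bsub>CA\<^esub> pure_tensor K C A \<one>\<^bsub>C\<^esub> a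
    = tensor_lift K CA (\<lambda>x y. pure_tensor K C A x (\<gamma> y \<otimes>\<^bsub>A\<^esub> a)) (\<Delta> c)"
proof -
  note D = linear_map_closed[OF \<Delta> c]
  have "L (\<gamma> c) \<otimes>\<^bsub>CA\<^esub> pure_tensor K C A \<one>\<^bsub>C\<^esub> a
    = tensor_lift K CA (\<lambda>x y. pure_tensor K C A x (\<gamma> y) \<otimes>\<^bsub>CA\<^esub> pure_tensor K C A \<one>\<^bsub>C\<^esub> a) (\<Delta> c)"
    unfolding \<gamma>_colinear[OF c]
    by (rule tensor_lift_commute[where T = "\<lambda>z. z \<otimes>\<^bsub>CA\<^esub> pure_tensor K C A \<one>\<^bsub>C\<^esub> a",
          OF modC modC _ _ _ D])
      (rule lin closed a | assumption)+
  also have "\<dots> = tensor_lift K CA (\<lambda>x y. pure_tensor K C A x (\<gamma> y \<otimes>\<^bsub>A\<^esub> a)) (\<Delta> c)"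
    by (rule tensor_lift_cong[OF modC modC _ D], (rule lin closed a | assumption)+)
      (simp add: tensor_mult_pure[OF C A] a linear_map_closed[OF \<gamma>])
  finally show ?thesis .
qed

text \<open>As b is coinvariant, L(\<gamma>(c) b) = c_1 \<otimes> \<gamma>(c_2) b, so the projection
  yields \<gamma>'(c_1) \<gamma>(c_2) b, where the first two factors cancel.\<close>

lemma proj_\<gamma>_mult:
  assumes c: "c \<in> carrier C" and b: "b \<in> carrier A" "L b = pure_tensor K C A \<one>\<^bsub>C\<^esub> b"
  shows "proj (\<gamma> c \<otimes>\<^bsub>A\<^esub> b) = \<epsilon> c \<odot>\<^bsub>A\<^esub> b"
proof -
  note D = linear_map_closed[OF \<Delta> c]
  let ?p = "tensor_lift K A (\<lambda>c x. \<gamma>' c \<otimes>\<^bsub>A\<^esub> x)"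
  have p_bil: "bilinear_map K C A A (\<lambda>c x. \<gamma>' c \<otimes>\<^bsub>A\<^esub> x)"
    by (rule lin closed | assumption)+
  have p: "linear_map K CA A ?p"
    by (rule tensor_lift_linear[OF modC modA modA p_bil])
  have "proj (\<gamma> c \<otimes>\<^bsub>A\<^esub> b) = ?p (tensor_lift K CA (\<lambda>x y. pure_tensor K C A x (\<gamma> y \<otimes>\<^bsub>A\<^esub> b)) (\<Delta> c))"
    by (simp add: proj_def algebra_map_mult[OF L] linear_map_closed[OF \<gamma>] c b L_\<gamma>_mult)
  also have "\<dots> = tensor_lift K A (\<lambda>x y. ?p (pure_tensor K C A x (\<gamma> y \<otimes>\<^bsub>A\<^esub> b))) (\<Delta> c)"
    by (rule tensor_lift_commute[OF modC modC _ modA p D]) (rule lin closed b | assumption)+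
  also have "\<dots> = tensor_lift K A (\<lambda>x y. \<gamma>' x \<otimes>\<^bsub>A\<^esub> (\<gamma> y \<otimes>\<^bsub>A\<^esub> b)) (\<Delta> c)"
    by (rule tensor_lift_cong[OF modC modC _ D], (rule linear_map_compose[OF p] lin closed b | assumption)+)
      (simp add: tensor_lift_pure[OF modC modA modA p_bil] b linear_map_closed[OF \<gamma>])
  also have "\<dots> = \<epsilon> c \<odot>\<^bsub>A\<^esub> b"
    by (rule inverse_mult(2)[OF c b(1)])
  finally show ?thesis .
qed

text \<open>Expanding the projection gives \<gamma>(a_{-2}) \<gamma>'(a_{-1}) a_0; coassociativity
  places \<gamma> and \<gamma>' on the two halves of one coproduct, and the counit finishes.\<close>

lemma \<gamma>_proj:
  assumes a: "a \<in> carrier A"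
  shows "tensor_lift K A (\<lambda>c x. \<gamma> c \<otimes>\<^bsub>A\<^esub> proj x) (L a) = a"
proof -
  note La = linear_map_closed[OF L_linear a]
  have "tensor_lift K A (\<lambda>c x. \<gamma> c \<otimes>\<^bsub>A\<^esub> proj x) (L a)
    = tensor_lift K A (\<lambda>c x. tensor_lift K A (\<lambda>d y. \<gamma> c \<otimes>\<^bsub>A\<^esub> (\<gamma>' d \<otimes>\<^bsub>A\<^esub> y)) (L x)) (L a)"
  proof (rule tensor_lift_cong[OF modC modA modA La])
    fix c x assume c: "c \<in> carrier C" and x: "x \<in> carrier A"
    show "\<gamma> c \<otimes>\<^bsub>A\<^esub> proj x = tensor_lift K A (\<lambda>d y. \<gamma> c \<otimes>\<^bsub>A\<^esub> (\<gamma>' d \<otimes>\<^bsub>A\<^esub> y)) (L x)"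
      unfolding proj_def
      by (rule tensor_lift_commute[where T = "\<lambda>z. \<gamma> c \<otimes>\<^bsub>A\<^esub> z", OF modC modA modA modA _
            linear_map_closed[OF L_linear x]])
        (rule lin closed c | assumption)+
  qed (rule lin closed | assumption)+
  also have "\<dots> = tensor_lift K A (\<lambda>m y. tensor_lift K A (\<lambda>c d. \<gamma> c \<otimes>\<^bsub>A\<^esub> (\<gamma>' d \<otimes>\<^bsub>A\<^esub> y)) (\<Delta> m)) (L a)"
    by (rule L_coassoc_eval[OF a modA, symmetric]) (rule lin closed | assumption)+
  also have "\<dots> = tensor_lift K A (\<lambda>m y. \<epsilon> m \<odot>\<^bsub>A\<^esub> y) (L a)"
    by (rule tensor_lift_cong[OF modC modA modA La], (rule lin closed | assumption)+)
      (simp add: inverse_mult)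
  also have "\<dots> = a" by (rule L_counit[OF a])
  finally show ?thesis .
qed

text \<open>Applying L to \<open>\<gamma>_proj\<close> would only produce L(proj x) in the place of
  1 \<otimes> proj x. Here the right side is expanded instead, to a_{-2} \<otimes> \<gamma>(a_{-1})
  proj(a_0), and \<open>\<gamma>_proj\<close> collapses the second factor.\<close>

lemma L_eq_\<gamma>_proj:
  assumes a: "a \<in> carrier A"
  shows "L a = tensor_lift K CA (\<lambda>c x. L (\<gamma> c) \<otimes>\<^bsub>CA\<^esub> pure_tensor K C A \<one>\<^bsub>C\<^esub> (proj x)) (L a)"
proof -
  note La = linear_map_closed[OF L_linear a]
  have "tensor_lift K CA (\<lambda>c x. L (\<gamma> c) \<otimes>\<^bsub>CA\<^esub> pure_tensor K C A \<one>\<^bsub>C\<^esub> (proj x)) (L a)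
    = tensor_lift K CA (\<lambda>m x. tensor_lift K CA (\<lambda>c d. pure_tensor K C A c (\<gamma> d \<otimes>\<^bsub>A\<^esub> proj x)) (\<Delta> m)) (L a)"
    by (rule tensor_lift_cong[OF modC modA _ La], (rule lin closed | assumption)+)
      (simp add: L_\<gamma>_mult linear_map_closed[OF proj_linear])
  also have "\<dots> = tensor_lift K CA (\<lambda>c y. tensor_lift K CA (\<lambda>d x. pure_tensor K C A c (\<gamma> d \<otimes>\<^bsub>A\<^esub> proj x)) (L y)) (L a)"
    by (rule L_coassoc_eval[OF a]) (rule lin closed | assumption)+
  also have "\<dots> = tensor_lift K CA (pure_tensor K C A) (L a)"
  proof (rule tensor_lift_cong[OF modC modA _ La])
    fix c y assume c: "c \<in> carrier C" and y: "y \<in> carrier A"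
    have "tensor_lift K CA (\<lambda>d x. pure_tensor K C A c (\<gamma> d \<otimes>\<^bsub>A\<^esub> proj x)) (L y)
      = pure_tensor K C A c (tensor_lift K A (\<lambda>d x. \<gamma> d \<otimes>\<^bsub>A\<^esub> proj x) (L y))"
      by (rule tensor_lift_commute[where T = "\<lambda>z. pure_tensor K C A c z", symmetric,
            OF modC modA modA _ _ linear_map_closed[OF L_linear y]])
        (rule lin closed c | assumption)+
    then show "tensor_lift K CA (\<lambda>d x. pure_tensor K C A c (\<gamma> d \<otimes>\<^bsub>A\<^esub> proj x)) (L y) = pure_tensor K C A c y"
      by (simp add: \<gamma>_proj y)
  qed (rule lin closed | assumption)+
  also have "\<dots> = L a"
    by (rule tensor_lift_pure_tensor[OF modC modA La])
  finally show ?thesis by simp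
qed

text \<open>No formula for L(\<gamma>'(c)) enters: since L is an algebra map, it carries the
  convolution identity for \<gamma>' and \<gamma> to one for L\<gamma>' and L\<gamma>.\<close>

lemma L_proj:
  assumes a: "a \<in> carrier A"
  shows "L (proj a) = pure_tensor K C A \<one>\<^bsub>C\<^esub> (proj a)"
proof -
  note La = linear_map_closed[OF L_linear a]
  let ?u = "\<lambda>x. pure_tensor K C A \<one>\<^bsub>C\<^esub> (proj x)"
  have "L (proj a) = tensor_lift K CA (\<lambda>c x. L (\<gamma>' c \<otimes>\<^bsub>A\<^esub> x)) (L a)"
    unfolding proj_def
    by (rule tensor_lift_commute[OF modC modA modA _ L_linear La]) (rule lin closed | assumption)+
  \<comment> \<open>L(\<gamma>'(c) x) splits as a product, and \<open>L_eq_\<gamma>_proj\<close> is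
    inserted for its second factor L(x).\<close>
  also have "\<dots> = tensor_lift K CA (\<lambda>c x. tensor_lift K CA
      (\<lambda>d y. L (\<gamma>' c) \<otimes>\<^bsub>CA\<^esub> (L (\<gamma> d) \<otimes>\<^bsub>CA\<^esub> ?u y)) (L x)) (L a)"
  proof (rule tensor_lift_cong[OF modC modA _ La])
    fix c x assume c: "c \<in> carrier C" and x: "x \<in> carrier A"
    have "L (\<gamma>' c \<otimes>\<^bsub>A\<^esub> x) = L (\<gamma>' c) \<otimes>\<^bsub>CA\<^esub> L x"
      by (rule algebra_map_mult[OF L linear_map_closed[OF \<gamma>' c] x])
    also have "\<dots> = L (\<gamma>' c) \<otimes>\<^bsub>CA\<^esub> tensor_lift K CA (\<lambda>d y. L (\<gamma> d) \<otimes>\<^bsub>CA\<^esub> ?u y) (L x)"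
      by (simp only: L_eq_\<gamma>_proj[OF x, symmetric])
    also have "\<dots> = tensor_lift K CA (\<lambda>d y. L (\<gamma>' c) \<otimes>\<^bsub>CA\<^esub> (L (\<gamma> d) \<otimes>\<^bsub>CA\<^esub> ?u y)) (L x)"
      by (rule tensor_lift_commute[where T = "\<lambda>z. L (\<gamma>' c) \<otimes>\<^bsub>CA\<^esub> z", OF modC modA _ _ _
            linear_map_closed[OF L_linear x]])
        (rule lin closed c | assumption)+
    finally show "L (\<gamma>' c \<otimes>\<^bsub>A\<^esub> x) = tensor_lift K CA (\<lambda>d y. L (\<gamma>' c) \<otimes>\<^bsub>CA\<^esub> (L (\<gamma> d) \<otimes>\<^bsub>CA\<^esub> ?u y)) (L x)" .
  qed (rule lin closed | assumption)+
  also have "\<dots> = tensor_lift K CA (\<lambda>m y. tensor_lift K CA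
      (\<lambda>c d. L (\<gamma>' c) \<otimes>\<^bsub>CA\<^esub> (L (\<gamma> d) \<otimes>\<^bsub>CA\<^esub> ?u y)) (\<Delta> m)) (L a)"
    by (rule L_coassoc_eval[OF a, symmetric]) (rule lin closed | assumption)+
  \<comment> \<open>The scalar left by the cancellation is moved inside \<open>?u\<close>, so that
    \<open>?u\<close> can later be pulled out and the counit law for L applied to its
    argument.\<close>
  also have "\<dots> = tensor_lift K CA (\<lambda>m y. ?u (\<epsilon> m \<odot>\<^bsub>A\<^esub> y)) (L a)"
  proof (rule tensor_lift_cong[OF modC modA _ La])
    fix m y assume m: "m \<in> carrier C" and y: "y \<in> carrier A"
    interpret CA: ring CA using CA_algebra by (simp add: assoc_algebra_def)
    note D = linear_map_closed[OF \<Delta> m]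
    have u: "?u y \<in> carrier CA" by (rule closed y)+
    have "tensor_lift K CA (\<lambda>c d. L (\<gamma>' c) \<otimes>\<^bsub>CA\<^esub> (L (\<gamma> d) \<otimes>\<^bsub>CA\<^esub> ?u y)) (\<Delta> m)
      = tensor_lift K CA (\<lambda>c d. L (\<gamma>' c \<otimes>\<^bsub>A\<^esub> \<gamma> d) \<otimes>\<^bsub>CA\<^esub> ?u y) (\<Delta> m)"
      by (rule tensor_lift_cong[OF modC modC _ D], (rule lin closed y | assumption)+)
        (simp add: algebra_map_mult[OF L] linear_map_closed[OF \<gamma>] linear_map_closed[OF \<gamma>'] CA.m_assoc
          u linear_map_closed[OF L_linear])
    also have "\<dots> = L (tensor_lift K A (\<lambda>c d. \<gamma>' c \<otimes>\<^bsub>A\<^esub> \<gamma> d) (\<Delta> m)) \<otimes>\<^bsub>CA\<^esub> ?u y"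
      by (rule tensor_lift_commute[where T = "\<lambda>z. L z \<otimes>\<^bsub>CA\<^esub> ?u y", symmetric, OF modC modC modA _ _ D])
        (rule lin closed y | assumption)+
    also have "\<dots> = \<epsilon> m \<odot>\<^bsub>CA\<^esub> ?u y"
      using CA_algebra u \<epsilon>_closed[OF m]
      by (simp add: \<gamma>'_\<gamma>[OF m] linear_map_smult[OF L_linear] algebra_map_one[OF L] assoc_algebra_def)
    also have "\<dots> = ?u (\<epsilon> m \<odot>\<^bsub>A\<^esub> y)"
      by (rule linear_map_smult[where f = ?u, symmetric], (rule lin closed m y | assumption)+)
    finally show "tensor_lift K CA (\<lambda>c d. L (\<gamma>' c) \<otimes>\<^bsub>CA\<^esub> (L (\<gamma> d) \<otimes>\<^bsub>CA\<^esub> ?u y)) (\<Delta> m) = ?u (\<epsilon> m \<odot>\<^bsub>A\<^esub> y)" .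
  qed (rule lin closed | assumption)+
  also have "\<dots> = ?u (tensor_lift K A (\<lambda>m y. \<epsilon> m \<odot>\<^bsub>A\<^esub> y) (L a))"
    by (rule tensor_lift_commute[where T = ?u, symmetric, OF modC modA modA _ _ La])
      (rule lin closed | assumption)+
  also have "\<dots> = ?u a"
    by (simp only: L_counit[OF a])
  finally show ?thesis .
qed

end

section \<open>Subalgebras and the right action on a tensor product\<close>

lemma linear_map_restrict:
  assumes "linear_map K M N f" "S \<subseteq> carrier M" "\<And>x. x \<in> S \<Longrightarrow> f x \<in> T"
  shows "linear_map K (M\<lparr>carrier := S\<rparr>) (N\<lparr>carrier := T\<rparr>) f"
  using assms by (auto simp: linear_map_def subset_iff)

lemma assoc_algebra_subalgebra:
  assumes A: "assoc_algebra K A" and S: "submodule S K A"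
    and one: "\<one>\<^bsub>A\<^esub> \<in> S" and mult: "\<And>x y. \<lbrakk>x \<in> S; y \<in> S\<rbrakk> \<Longrightarrow> x \<otimes>\<^bsub>A\<^esub> y \<in> S"
  shows "assoc_algebra K (A\<lparr>carrier := S\<rparr>)"
proof -
  interpret A: ring A using A by (simp add: assoc_algebra_def)
  have mod: "module K (A\<lparr>carrier := S\<rparr>)"
    by (rule submodule.submodule_is_module[OF S assoc_algebra_module[OF A]])
  have sub: "x \<in> carrier A" if "x \<in> S" for x
    using subgroup.subset[OF submodule.axioms(1)[OF S]] that by auto
  have "ring (A\<lparr>carrier := S\<rparr>)"
    by (rule ringI[OF module.axioms(2)[OF mod]])
      (auto intro!: monoidI simp: one mult sub A.m_assoc A.l_distr A.r_distr)
  then show ?thesis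
    using A mod by (simp add: assoc_algebra_def sub)
qed

lemma tensor_right_action_linear:
  assumes V: "module K V" and A: "assoc_algebra K A" and a: "a \<in> carrier A"
  shows "linear_map K (tensor K V A) (tensor K V A) (\<lambda>x. tensor_right_action K V A x a)"
  unfolding tensor_right_action_def
  by (rule tensor_map_linear[OF V assoc_algebra_module[OF A] V assoc_algebra_module[OF A]])
    (simp_all add: id_def linear_map_ident linear_map_mult_left A a)

lemma tensor_right_action_pure:
  assumes V: "module K V" and A: "assoc_algebra K A" and a: "a \<in> carrier A"
    and "v \<in> carrier V" "h \<in> carrier A"
  shows "tensor_right_action K V A (pure_tensor K V A v h) a = pure_tensor K V A v (h \<otimes>\<^bsub>A\<^esub> a)"
  unfolding tensor_right_action_def
  by (subst tensor_map_pure[OF V assoc_algebra_module[OF A] V assoc_algebra_module[OF A]])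
    (simp_all add: id_def linear_map_ident linear_map_mult_left A a assms)

lemma tensor_right_module:
  assumes V: "module K V" and A: "assoc_algebra K A"
  shows "right_module K A (tensor K V A) (tensor_right_action K V A)"
proof -
  interpret A: ring A using A by (simp add: assoc_algebra_def)
  note mods = V assoc_algebra_module[OF A] tensor_module
  let ?T = "tensor K V A" and ?act = "tensor_right_action K V A"
  note act = tensor_right_action_linear[OF V A]
  note act_pure = tensor_right_action_pure[OF V A]
  note ext = tensor_linear_ext[where P = ?T, OF V assoc_algebra_module[OF A]]
  \<comment> \<open>The acting element occurs under the sum while the tensor x is fixed; the
    unfolding exposes this form to \<open>linear_map_tensor_lift_family\<close>.\<close>
  have "linear_map K A ?T (?act x)" if x: "x \<in> carrier ?T" for x
    unfolding tensor_right_action_def tensor_map_def id_apply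
    by (assumption | rule linear_intros closed_intros mods A x)+
  moreover have "?act x \<one>\<^bsub>A\<^esub> = x" if x: "x \<in> carrier ?T" for x
    by (rule ext[OF act[OF A.one_closed] linear_map_ident _ x]) (simp add: act_pure)
  moreover have "?act (?act x a) b = ?act x (a \<otimes>\<^bsub>A\<^esub> b)"
    if x: "x \<in> carrier ?T" and ab: "a \<in> carrier A" "b \<in> carrier A" for x a b
    by (rule ext[OF linear_map_compose[OF act act] act _ x]) (simp_all add: act_pure ab A.m_assoc)
  ultimately show ?thesis
    by (simp add: right_module_def A tensor_module mods act)
qed

section \<open>Coinvariants, the induced module and the isomorphism\<close>

context cleft_comodule
begin

text \<open>The body agrees literally with that of \<open>coinv\<close> at the intended parameters,
  so that unfolding identifies the two.\<close>

definition coinvariants :: "('k, 'a) module" where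
  "coinvariants = A\<lparr>carrier := {h \<in> carrier A. L h = pure_tensor K C A \<one>\<^bsub>C\<^esub> h}\<rparr>"

abbreviation "B \<equiv> coinvariants"
abbreviation "VB \<equiv> tensor K V B"

lemma coinvariants_simps [simp]:
  "mult B = mult A" "one B = one A" "zero B = zero A" "add B = add A" "smult B = smult A"
  by (simp_all add: coinvariants_def)

lemma coinvariants_iff: "h \<in> carrier B \<longleftrightarrow> h \<in> carrier A \<and> L h = pure_tensor K C A \<one>\<^bsub>C\<^esub> h"
  by (simp add: coinvariants_def)

lemma coinvariants_closed: "h \<in> carrier B \<Longrightarrow> h \<in> carrier A"
  by (simp add: coinvariants_iff)

text \<open>The coinvariants are the equalizer of L and h \<mapsto> 1 \<otimes> h. Both maps
  preserve sums, scalars, products and the unit.\<close>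

lemma coinvariants_algebra: "assoc_algebra K B"
  unfolding coinvariants_def
proof (rule assoc_algebra_subalgebra[OF A])
  show "submodule {h \<in> carrier A. L h = pure_tensor K C A \<one>\<^bsub>C\<^esub> h} K A"
    by (rule linear_map_equalizer_submodule[OF modA tensor_module[OF modC modA]]) (rule lin closed L_linear)+
qed (auto simp: algebra_map_one[OF L] algebra_map_mult[OF L] tensor_one tensor_mult_pure[OF C A])

lemmas modB = assoc_algebra_module[OF coinvariants_algebra]

lemma coinvariants_incl: "linear_map K B A (\<lambda>b. b)"
  by (rule linear_mapI) (simp_all add: coinvariants_closed)

text \<open>Corestriction of the projection to B, where \<open>L_proj\<close> supplies membership.
  It is what allows pure tensors of V \<otimes> B to be formed from values of
  \<open>proj\<close>.\<close>

lemma proj_coinvariants: "linear_map K A B proj"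
  by (rule linear_mapI)
    (simp_all add: coinvariants_iff L_proj linear_map_closed[OF proj_linear] linear_map_add[OF proj_linear]
      linear_map_smult[OF proj_linear])

text \<open>\<open>coaction_left\<close> and \<open>coaction_right\<close> are the forms v \<otimes>
  L(h) and v_0 \<otimes> (v_1 \<otimes> h) of the two sides of the equation that defines
  \<open>induced\<close>, with the associativity isomorphism already evaluated.\<close>

definition coaction_left :: "('k, 'v, 'a) tensor \<Rightarrow> ('k, 'v, ('k, 'c, 'a) tensor) tensor" where
  "coaction_left x = tensor_lift K (tensor K V CA) (\<lambda>v h. pure_tensor K V CA v (L h)) x"

definition coaction_right :: "('k, 'v, 'a) tensor \<Rightarrow> ('k, 'v, ('k, 'c, 'a) tensor) tensor" where
  "coaction_right x = tensor_lift K (tensor K V CA) (\<lambda>v h. tensor_lift K (tensor K V CA)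
    (\<lambda>w c. pure_tensor K V CA w (pure_tensor K C A c h)) (\<rho> v)) x"

definition induced :: "('k, ('k, 'v, 'a) tensor) module" where
  "induced = VA\<lparr>carrier := {x \<in> carrier VA. tensor_map K V CA id L x
    = tensor_assoc K V C A (tensor_map K (tensor K V C) A \<rho> id x)}\<rparr>"

lemma induced_simps [simp]:
  "zero induced = zero VA" "add induced = add VA" "smult induced = smult VA"
  by (simp_all add: induced_def)

lemma induced_iff: "x \<in> carrier induced \<longleftrightarrow> x \<in> carrier VA \<and> coaction_left x = coaction_right x"
  using tensor_assoc_tensor_map[OF V modC modA V \<rho>, of x]
  by (auto simp: induced_def coaction_left_def coaction_right_def tensor_map_def)

lemma induced_module: "module K induced"
proof -
  have 1: "linear_map K VA (tensor K V CA) coaction_left"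
    unfolding coaction_left_def by (assumption | rule lin closed)+
  have 2: "linear_map K VA (tensor K V CA) coaction_right"
    unfolding coaction_right_def by (assumption | rule lin closed)+
  have "submodule {x \<in> carrier VA. coaction_left x = coaction_right x} K VA"
    by (rule linear_map_equalizer_submodule[OF _ _ 1 2]) (rule mods)+
  then have "module K (VA\<lparr>carrier := {x \<in> carrier VA. coaction_left x = coaction_right x}\<rparr>)"
    by (rule submodule.submodule_is_module) (rule mods)+
  moreover have "VA\<lparr>carrier := {x \<in> carrier VA. coaction_left x = coaction_right x}\<rparr> = induced"
    using induced_iff by (auto simp: induced_def)
  ultimately show ?thesis by simp
qed

definition ind_map :: "('k, 'v, 'a) tensor \<Rightarrow> ('k, 'v, 'a) tensor" where
  "ind_map y = tensor_lift K VA (\<lambda>v b. tensor_lift K VA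
    (\<lambda>w c. pure_tensor K V A w (\<gamma> c \<otimes>\<^bsub>A\<^esub> b)) (\<rho> v)) y"

text \<open>Defined on all of V \<otimes> A, where it need not invert anything; on the induced
  module it is the two-sided inverse of \<open>ind_map\<close>.\<close>

definition ind_inv :: "('k, 'v, 'a) tensor \<Rightarrow> ('k, 'v, 'a) tensor" where
  "ind_inv x = tensor_lift K VB (\<lambda>v h. pure_tensor K V B v (proj h)) x"

lemmas linB = lin modB coinvariants_algebra coinvariants_incl linear_map_compose[OF proj_coinvariants]
lemmas closedB = closed coinvariants_closed linear_map_closed[OF proj_coinvariants]

lemma ind_map_bilinear:
  "bilinear_map K V B VA (\<lambda>v b. tensor_lift K VA (\<lambda>w c. pure_tensor K V A w (\<gamma> c \<otimes>\<^bsub>A\<^esub> b)) (\<rho> v))"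
  by (assumption | rule linB closedB)+

lemma ind_map_linear: "linear_map K VB VA ind_map"
  unfolding ind_map_def by (assumption | rule linB closedB)+

lemma ind_inv_linear: "linear_map K VA VB ind_inv"
  unfolding ind_inv_def by (assumption | rule linB closedB)+

lemma ind_map_pure:
  assumes "v \<in> carrier V" "b \<in> carrier B"
  shows "ind_map (pure_tensor K V B v b)
    = tensor_lift K VA (\<lambda>w c. pure_tensor K V A w (\<gamma> c \<otimes>\<^bsub>A\<^esub> b)) (\<rho> v)"
  unfolding ind_map_def
  by (rule tensor_lift_pure[OF V modB tensor_module[OF V modA] ind_map_bilinear assms])

lemma ind_inv_pure:
  assumes "v \<in> carrier V" "h \<in> carrier A"
  shows "ind_inv (pure_tensor K V A v h) = pure_tensor K V B v (proj h)"
  unfolding ind_inv_def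
  by (rule tensor_lift_pure[OF V modA tensor_module[OF V modB] _ assms]) (assumption | rule linB closedB)+

text \<open>The scalar \<epsilon>(c) moves across the tensor sign from h to w, where the counit law
  of \<rho> applies. M is arbitrary because the lemma is used both for B and for A.\<close>

lemma \<rho>_counit_pure:
  assumes M: "module K M" and v: "v \<in> carrier V" and h: "h \<in> carrier M"
  shows "tensor_lift K (tensor K V M) (\<lambda>w c. pure_tensor K V M w (\<epsilon> c \<odot>\<^bsub>M\<^esub> h)) (\<rho> v)
    = pure_tensor K V M v h"
proof -
  note D = linear_map_closed[OF \<rho> v]
  note pb = pure_tensor_bilinear[OF V M]
  have "tensor_lift K (tensor K V M) (\<lambda>w c. pure_tensor K V M w (\<epsilon> c \<odot>\<^bsub>M\<^esub> h)) (\<rho> v)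
    = tensor_lift K (tensor K V M) (\<lambda>w c. pure_tensor K V M (\<epsilon> c \<odot>\<^bsub>V\<^esub> w) h) (\<rho> v)"
  proof (rule tensor_lift_cong[OF V modC tensor_module[OF V M] D])
    show "pure_tensor K V M w (\<epsilon> c \<odot>\<^bsub>M\<^esub> h) = pure_tensor K V M (\<epsilon> c \<odot>\<^bsub>V\<^esub> w) h"
      if "w \<in> carrier V" "c \<in> carrier C" for w c
      using linear_map_smult[OF bilinear_map_left[OF pb h] \<epsilon>_closed[OF that(2)] that(1)]
        linear_map_smult[OF bilinear_map_right[OF pb that(1)] \<epsilon>_closed[OF that(2)] h] by simp
  qed (assumption | rule linB closedB M h module.smult_closed[OF M])+
  also have "\<dots> = pure_tensor K V M (tensor_lift K V (\<lambda>w c. \<epsilon> c \<odot>\<^bsub>V\<^esub> w) (\<rho> v)) h"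
    by (rule tensor_lift_commute[where T = "\<lambda>z. pure_tensor K V M z h", symmetric, OF V modC V _ _ D])
      (assumption | rule linB closedB M h)+
  also have "\<dots> = pure_tensor K V M v h"
    by (simp only: \<rho>_counit[OF v])
  finally show ?thesis .
qed

text \<open>On v \<otimes> b the composite is v_0 \<otimes> proj(\<gamma>(v_1) b) = v_0 \<otimes>
  \<epsilon>(v_1) b, by coinvariance of b.\<close>

lemma ind_inv_ind_map:
  assumes y: "y \<in> carrier VB"
  shows "ind_inv (ind_map y) = y"
proof (rule tensor_linear_ext[where P = VB, OF V modB _ linear_map_ident _ y])
  show "linear_map K VB VB (\<lambda>y. ind_inv (ind_map y))"
    by (rule linear_map_compose[OF ind_inv_linear ind_map_linear])
  fix v b assume v: "v \<in> carrier V" and b: "b \<in> carrier B"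
  note D = linear_map_closed[OF \<rho> v]
  have "ind_inv (ind_map (pure_tensor K V B v b))
    = tensor_lift K VB (\<lambda>w c. ind_inv (pure_tensor K V A w (\<gamma> c \<otimes>\<^bsub>A\<^esub> b))) (\<rho> v)"
    unfolding ind_map_pure[OF v b]
    by (rule tensor_lift_commute[OF V modC _ _ ind_inv_linear D]) (assumption | rule linB closedB b)+
  also have "\<dots> = tensor_lift K VB (\<lambda>w c. pure_tensor K V B w (\<epsilon> c \<odot>\<^bsub>B\<^esub> b)) (\<rho> v)"
  proof (rule tensor_lift_cong[OF V modC _ D])
    show "ind_inv (pure_tensor K V A w (\<gamma> c \<otimes>\<^bsub>A\<^esub> b)) = pure_tensor K V B w (\<epsilon> c \<odot>\<^bsub>B\<^esub> b)"
      if "w \<in> carrier V" "c \<in> carrier C" for w c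
      using b that by (simp add: ind_inv_pure proj_\<gamma>_mult coinvariants_iff linear_map_closed[OF \<gamma>])
  qed (assumption | rule linear_map_compose[OF ind_inv_linear] linB closedB b)+
  also have "\<dots> = pure_tensor K V B v b"
    by (rule \<rho>_counit_pure[OF modB v b])
  finally show "ind_inv (ind_map (pure_tensor K V B v b)) = pure_tensor K V B v b" .
qed

text \<open>For v \<otimes> b both sides of the defining equation become v_0 \<otimes> v_1 \<otimes>
  \<gamma>(v_2) b. On the left v_1 and v_2 come from \<Delta>, on the right from a second use of
  \<rho>, and coassociativity of \<rho> identifies them.\<close>

lemma ind_map_induced:
  assumes y: "y \<in> carrier VB"
  shows "ind_map y \<in> carrier induced"
proof -
  let ?W = "tensor K V CA"
  have l: "linear_map K VA ?W coaction_left"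
    unfolding coaction_left_def by (assumption | rule linB closedB)+
  have r: "linear_map K VA ?W coaction_right"
    unfolding coaction_right_def by (assumption | rule linB closedB)+
  have l_pure: "coaction_left (pure_tensor K V A v h) = pure_tensor K V CA v (L h)"
    if "v \<in> carrier V" "h \<in> carrier A" for v h
    unfolding coaction_left_def
    by (rule tensor_lift_pure[OF V modA _ _ that]) (assumption | rule linB closedB)+
  have r_pure: "coaction_right (pure_tensor K V A v h)
      = tensor_lift K ?W (\<lambda>w c. pure_tensor K V CA w (pure_tensor K C A c h)) (\<rho> v)"
    if "v \<in> carrier V" "h \<in> carrier A" for v h
    unfolding coaction_right_def
    by (rule tensor_lift_pure[OF V modA _ _ that]) (assumption | rule linB closedB)+
  have "coaction_left (ind_map y) = coaction_right (ind_map y)"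
  proof (rule tensor_linear_ext[where P = ?W, OF V modB _ _ _ y])
    show "linear_map K VB ?W (\<lambda>y. coaction_left (ind_map y))"
      by (rule linear_map_compose[OF l ind_map_linear])
    show "linear_map K VB ?W (\<lambda>y. coaction_right (ind_map y))"
      by (rule linear_map_compose[OF r ind_map_linear])
    fix v b assume v: "v \<in> carrier V" and b: "b \<in> carrier B"
    note D = linear_map_closed[OF \<rho> v]
    note bA = coinvariants_closed[OF b]
    have "coaction_left (ind_map (pure_tensor K V B v b))
      = tensor_lift K ?W (\<lambda>w c. coaction_left (pure_tensor K V A w (\<gamma> c \<otimes>\<^bsub>A\<^esub> b))) (\<rho> v)"
      unfolding ind_map_pure[OF v b]
      by (rule tensor_lift_commute[OF V modC _ _ l D]) (assumption | rule linB closedB b)+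
    also have "\<dots> = tensor_lift K ?W (\<lambda>w m. tensor_lift K ?W
        (\<lambda>c d. pure_tensor K V CA w (pure_tensor K C A c (\<gamma> d \<otimes>\<^bsub>A\<^esub> b))) (\<Delta> m)) (\<rho> v)"
    proof (rule tensor_lift_cong[OF V modC _ D])
      fix w m assume w: "w \<in> carrier V" and m: "m \<in> carrier C"
      have "coaction_left (pure_tensor K V A w (\<gamma> m \<otimes>\<^bsub>A\<^esub> b)) = pure_tensor K V CA w (L (\<gamma> m) \<otimes>\<^bsub>CA\<^esub> L b)"
        using w m bA by (simp add: l_pure linear_map_closed[OF \<gamma>] algebra_map_mult[OF L])
      \<comment> \<open>Coinvariance of b replaces L(b) by 1 \<otimes> b, which brings the product
        into the form of \<open>L_\<gamma>_mult\<close>.\<close>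
      also have "\<dots> = pure_tensor K V CA w
          (tensor_lift K CA (\<lambda>c d. pure_tensor K C A c (\<gamma> d \<otimes>\<^bsub>A\<^esub> b)) (\<Delta> m))"
        using b m by (simp add: coinvariants_iff L_\<gamma>_mult)
      also have "\<dots> = tensor_lift K ?W
          (\<lambda>c d. pure_tensor K V CA w (pure_tensor K C A c (\<gamma> d \<otimes>\<^bsub>A\<^esub> b))) (\<Delta> m)"
        by (rule tensor_lift_commute[where T = "\<lambda>z. pure_tensor K V CA w z",
              OF modC modC _ _ _ linear_map_closed[OF \<Delta> m]])
          (assumption | rule linB closedB w b)+
      finally show "coaction_left (pure_tensor K V A w (\<gamma> m \<otimes>\<^bsub>A\<^esub> b)) = tensor_lift K ?W
          (\<lambda>c d. pure_tensor K V CA w (pure_tensor K C A c (\<gamma> d \<otimes>\<^bsub>A\<^esub> b))) (\<Delta> m)" .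
    qed (assumption | rule linear_map_compose[OF l] linB closedB b)+
    also have "\<dots> = tensor_lift K ?W (\<lambda>w d. tensor_lift K ?W
        (\<lambda>u c. pure_tensor K V CA u (pure_tensor K C A c (\<gamma> d \<otimes>\<^bsub>A\<^esub> b))) (\<rho> w)) (\<rho> v)"
      by (rule \<rho>_coassoc_eval[OF v, symmetric]) (assumption | rule linB closedB b)+
    also have "\<dots> = tensor_lift K ?W (\<lambda>w c. coaction_right (pure_tensor K V A w (\<gamma> c \<otimes>\<^bsub>A\<^esub> b))) (\<rho> v)"
      by (rule tensor_lift_cong[OF V modC _ D], (assumption | rule linB closedB b)+)
        (simp add: r_pure linear_map_closed[OF \<gamma>] bA)
    also have "\<dots> = coaction_right (ind_map (pure_tensor K V B v b))"
      unfolding ind_map_pure[OF v b]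
      by (rule tensor_lift_commute[symmetric, OF V modC _ _ r D]) (assumption | rule linB closedB b)+
    finally show "coaction_left (ind_map (pure_tensor K V B v b))
      = coaction_right (ind_map (pure_tensor K V B v b))" .
  qed
  then show ?thesis
    by (simp add: induced_iff linear_map_closed[OF ind_map_linear y])
qed

text \<open>The defining equation of the induced module allows to replace \<open>\<gamma>'(h\<^sub>-\<^sub>1)\<close> in the projection by
  \<open>\<gamma>'(v\<^sub>1)\<close>, which cancels against the factor \<open>\<gamma>(v\<^sub>1)\<close>.\<close>

lemma ind_map_ind_inv:
  assumes x: "x \<in> carrier induced"
  shows "ind_map (ind_inv x) = x"
proof -
  let ?W = "tensor K V CA"
  have xA: "x \<in> carrier VA" and eq: "coaction_left x = coaction_right x"
    using x by (auto simp: induced_iff)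
  let ?p = "tensor_lift K A (\<lambda>c x. \<gamma>' c \<otimes>\<^bsub>A\<^esub> x)"
  have p_bil: "bilinear_map K C A A (\<lambda>c x. \<gamma>' c \<otimes>\<^bsub>A\<^esub> x)"
    by (assumption | rule linB closedB)+
  have p: "linear_map K CA A ?p"
    by (rule tensor_lift_linear[OF modC modA modA p_bil])
  \<comment> \<open>\<open>?T\<close> sends v \<otimes> (c \<otimes> x) to v_0 \<otimes>
    \<gamma>(v_1) \<gamma>'(c) x. It is chosen so that \<open>ind_map\<close> after
    \<open>ind_inv\<close> is \<open>?T\<close> after \<open>coaction_left\<close>: the projection
    of h is \<open>?p\<close> at L(h).\<close>
  let ?Q = "\<lambda>v z. tensor_lift K VA (\<lambda>w c. pure_tensor K V A w (\<gamma> c \<otimes>\<^bsub>A\<^esub> ?p z)) (\<rho> v)"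
  let ?T = "tensor_lift K VA ?Q"
  note p_rules = linear_map_compose[OF p] linear_map_closed[OF p]
  have Q: "bilinear_map K V CA VA ?Q"
    by (assumption | rule p_rules linB closedB)+
  have T: "linear_map K ?W VA ?T"
    by (rule tensor_lift_linear[OF V _ _ Q]) (rule mods)+
  have T_pure: "?T (pure_tensor K V CA v z) = ?Q v z" if "v \<in> carrier V" "z \<in> carrier CA" for v z
    by (rule tensor_lift_pure[OF V _ _ Q that]) (rule mods)+
  have "ind_map (ind_inv x) = tensor_lift K VA (\<lambda>v h. ind_map (pure_tensor K V B v (proj h))) x"
    unfolding ind_inv_def
    by (rule tensor_lift_commute[OF V modA _ _ ind_map_linear xA]) (assumption | rule linB closedB)+
  also have "\<dots> = tensor_lift K VA (\<lambda>v h. ?T (pure_tensor K V CA v (L h))) x"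
    by (rule tensor_lift_cong[OF V modA _ xA], (assumption | rule linear_map_compose[OF ind_map_linear] linB closedB)+)
      (simp add: T_pure ind_map_pure linear_map_closed[OF proj_coinvariants] linear_map_closed[OF L_linear],
        simp add: proj_def)
  also have "\<dots> = ?T (coaction_left x)"
    unfolding coaction_left_def
    by (rule tensor_lift_commute[symmetric, OF V modA _ _ T xA]) (assumption | rule linB closedB)+
  \<comment> \<open>The defining equation of the induced module enters here; from now on the
    argument of \<gamma>' comes from the coaction on V.\<close>
  also have "\<dots> = ?T (coaction_right x)" by (simp only: eq)
  also have "\<dots> = tensor_lift K VA (\<lambda>v h. ?T (tensor_lift K ?W
      (\<lambda>w c. pure_tensor K V CA w (pure_tensor K C A c h)) (\<rho> v))) x"
    unfolding coaction_right_def
    by (rule tensor_lift_commute[OF V modA _ _ T xA]) (assumption | rule linB closedB)+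
  also have "\<dots> = tensor_lift K VA (pure_tensor K V A) x"
  proof (rule tensor_lift_cong[OF V modA _ xA])
    fix v h assume v: "v \<in> carrier V" and h: "h \<in> carrier A"
    note D = linear_map_closed[OF \<rho> v]
    have "?T (tensor_lift K ?W (\<lambda>w c. pure_tensor K V CA w (pure_tensor K C A c h)) (\<rho> v))
      = tensor_lift K VA (\<lambda>w d. ?T (pure_tensor K V CA w (pure_tensor K C A d h))) (\<rho> v)"
      by (rule tensor_lift_commute[OF V modC _ _ T D]) (assumption | rule linB closedB h)+
    also have "\<dots> = tensor_lift K VA (\<lambda>w d. tensor_lift K VA
        (\<lambda>u c. pure_tensor K V A u (\<gamma> c \<otimes>\<^bsub>A\<^esub> (\<gamma>' d \<otimes>\<^bsub>A\<^esub> h))) (\<rho> w)) (\<rho> v)"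
      by (rule tensor_lift_cong[OF V modC _ D], (assumption | rule linear_map_compose[OF T] linB closedB h)+)
        (simp add: T_pure pure_tensor_closed modC modA h tensor_lift_pure[OF modC modA modA p_bil])
    \<comment> \<open>Coassociativity of \<rho> puts \<gamma> and \<gamma>' on the two halves of one
      coproduct \<Delta>(m), so that their product collapses to \<epsilon>(m).\<close>
    also have "\<dots> = tensor_lift K VA (\<lambda>w m. tensor_lift K VA
        (\<lambda>c d. pure_tensor K V A w (\<gamma> c \<otimes>\<^bsub>A\<^esub> (\<gamma>' d \<otimes>\<^bsub>A\<^esub> h))) (\<Delta> m)) (\<rho> v)"
      by (rule \<rho>_coassoc_eval[OF v]) (assumption | rule linB closedB h)+
    also have "\<dots> = tensor_lift K VA (\<lambda>w m. pure_tensor K V A w (\<epsilon> m \<odot>\<^bsub>A\<^esub> h)) (\<rho> v)"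
    proof (rule tensor_lift_cong[OF V modC _ D])
      fix w m assume w: "w \<in> carrier V" and m: "m \<in> carrier C"
      have "tensor_lift K VA (\<lambda>c d. pure_tensor K V A w (\<gamma> c \<otimes>\<^bsub>A\<^esub> (\<gamma>' d \<otimes>\<^bsub>A\<^esub> h))) (\<Delta> m)
        = pure_tensor K V A w (tensor_lift K A (\<lambda>c d. \<gamma> c \<otimes>\<^bsub>A\<^esub> (\<gamma>' d \<otimes>\<^bsub>A\<^esub> h)) (\<Delta> m))"
        by (rule tensor_lift_commute[where T = "\<lambda>z. pure_tensor K V A w z", symmetric,
              OF modC modC modA _ _ linear_map_closed[OF \<Delta> m]])
          (assumption | rule linB closedB w h)+
      then show "tensor_lift K VA (\<lambda>c d. pure_tensor K V A w (\<gamma> c \<otimes>\<^bsub>A\<^esub> (\<gamma>' d \<otimes>\<^bsub>A\<^esub> h))) (\<Delta> m)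
        = pure_tensor K V A w (\<epsilon> m \<odot>\<^bsub>A\<^esub> h)"
        by (simp only: inverse_mult(1)[OF m h])
    qed (assumption | rule linB closedB h)+
    also have "\<dots> = pure_tensor K V A v h"
      by (rule \<rho>_counit_pure[OF modA v h])
    finally show "?T (tensor_lift K ?W (\<lambda>w c. pure_tensor K V CA w (pure_tensor K C A c h)) (\<rho> v))
      = pure_tensor K V A v h" .
  qed (assumption | rule linear_map_compose[OF T] linB closedB)+
  also have "\<dots> = x"
    by (rule tensor_lift_pure_tensor[OF V modA xA])
  finally show ?thesis .
qed

text \<open>The factor \<gamma>(v_1) multiplies from the left and the action from the right, so this
  is associativity in A.\<close>

lemma ind_map_action:
  assumes y: "y \<in> carrier VB" and b: "b \<in> carrier B"
  shows "ind_map (tensor_right_action K V B y b) = tensor_right_action K V A (ind_map y) b"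
proof (rule tensor_linear_ext[where P = VA, OF V modB _ _ _ y])
  note bA = coinvariants_closed[OF b]
  note actA = tensor_right_action_linear[OF V A bA]
  note actB = tensor_right_action_linear[OF V coinvariants_algebra b]
  show "linear_map K VB VA (\<lambda>y. ind_map (tensor_right_action K V B y b))"
    by (rule linear_map_compose[OF ind_map_linear actB])
  show "linear_map K VB VA (\<lambda>y. tensor_right_action K V A (ind_map y) b)"
    by (rule linear_map_compose[OF actA ind_map_linear])
  fix v h assume v: "v \<in> carrier V" and h: "h \<in> carrier B"
  note D = linear_map_closed[OF \<rho> v] and hA = coinvariants_closed[OF h]
  have hb: "h \<otimes>\<^bsub>A\<^esub> b \<in> carrier B"
    using assoc_algebra_mult_closed[OF coinvariants_algebra h b] by simp
  have "ind_map (tensor_right_action K V B (pure_tensor K V B v h) b)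
    = tensor_lift K VA (\<lambda>w c. pure_tensor K V A w (\<gamma> c \<otimes>\<^bsub>A\<^esub> (h \<otimes>\<^bsub>A\<^esub> b))) (\<rho> v)"
    by (simp add: tensor_right_action_pure[OF V coinvariants_algebra b v h] ind_map_pure v hb)
  also have "\<dots> = tensor_lift K VA
      (\<lambda>w c. tensor_right_action K V A (pure_tensor K V A w (\<gamma> c \<otimes>\<^bsub>A\<^esub> h)) b) (\<rho> v)"
    by (rule tensor_lift_cong[OF V modC _ D], (assumption | rule linB closedB hA bA)+)
      (simp add: tensor_right_action_pure[OF V A bA] hA bA linear_map_closed[OF \<gamma>] A.m_assoc)
  also have "\<dots> = tensor_right_action K V A (ind_map (pure_tensor K V B v h)) b"
    unfolding ind_map_pure[OF v h]
    by (rule tensor_lift_commute[symmetric, OF V modC _ _ actA D]) (assumption | rule linB closedB hA)+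
  finally show "ind_map (tensor_right_action K V B (pure_tensor K V B v h) b)
    = tensor_right_action K V A (ind_map (pure_tensor K V B v h)) b" .
qed

lemma ind_inv_closed: "x \<in> carrier induced \<Longrightarrow> ind_inv x \<in> carrier VB"
  by (simp add: induced_iff linear_map_closed[OF ind_inv_linear])

text \<open>Closure is transported instead of checked against the defining equation: x is
  \<open>ind_map\<close> of \<open>ind_inv x\<close>, the action moves inside \<open>ind_map\<close>
  by equivariance, and \<open>ind_map\<close> takes values in the induced module.\<close>

lemma induced_action_closed:
  assumes "x \<in> carrier induced" "b \<in> carrier B"
  shows "tensor_right_action K V A x b \<in> carrier induced"
proof -
  have xB: "ind_inv x \<in> carrier VB"
    by (rule ind_inv_closed[OF assms(1)])
  then have "tensor_right_action K V A x b = ind_map (tensor_right_action K V B (ind_inv x) b)"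
    by (simp add: ind_map_action[OF xB assms(2)] ind_map_ind_inv[OF assms(1)])
  then show ?thesis
    using linear_map_closed[OF tensor_right_action_linear[OF V coinvariants_algebra assms(2)] xB]
    by (simp add: ind_map_induced)
qed

lemma induced_right_module: "right_module K B induced (tensor_right_action K V A)"
proof -
  note rm = tensor_right_module[OF V A]
  have 1: "linear_map K induced induced (\<lambda>x. tensor_right_action K V A x b)" if "b \<in> carrier B" for b
    using linear_map_restrict[OF tensor_right_action_linear[OF V A coinvariants_closed[OF that]],
        of "carrier induced" "carrier induced"] induced_action_closed that
    by (auto simp: induced_def)
  have 2: "linear_map K B induced (tensor_right_action K V A x)" if x: "x \<in> carrier induced" for x
    using rm x coinvariants_closed induced_action_closed
    by (intro linear_mapI) (auto simp: right_module_def induced_iff linear_map_def)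
  show ?thesis
    using rm by (auto simp: right_module_def 1 2 induced_module coinvariants_algebra induced_iff coinvariants_closed)
qed

theorem induced_iso:
  "right_module_iso K B VB (tensor_right_action K V B) induced (tensor_right_action K V A) ind_map"
proof -
  have "linear_map K VB induced ind_map"
    using ind_map_induced linear_map_add[OF ind_map_linear] linear_map_smult[OF ind_map_linear]
    by (intro linear_mapI) auto
  moreover have "bij_betw ind_map (carrier VB) (carrier induced)"
    by (rule bij_betw_byWitness[where f' = ind_inv])
      (simp_all add: ind_inv_ind_map ind_map_ind_inv ind_map_induced ind_inv_closed image_subset_iff)
  ultimately show ?thesis
    by (simp add: right_module_iso_def tensor_right_module[OF V coinvariants_algebra]
        induced_right_module ind_map_action)
qed

end

section \<open>Left coactions of Hopf group-coalgebras\<close>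

text \<open>Brings a counit axiom, stated through the identification K \<otimes> N \<cong> N, into
  the form of a sum over components that the locale \<open>cleft_comodule\<close> uses. The
  right-hand version does the same for comodules, and \<open>mult_map_tensor_map\<close> for
  convolution products.\<close>

lemma tensor_unit_left_map:
  assumes M: "module K M" and N: "module K N" and f: "linear_map K M (base_algebra K) f"
    and X: "X \<in> carrier (tensor K M N)"
  shows "tensor_unit_left K N (tensor_map K (base_algebra K) N f id X)
    = tensor_lift K N (\<lambda>x y. f x \<odot>\<^bsub>N\<^esub> y) X"
proof -
  have b: "module K (base_algebra K)"
    by (rule base_algebra_module[OF module.axioms(1)[OF M]])
  have bil: "bilinear_map K (base_algebra K) N N (\<lambda>a x. a \<odot>\<^bsub>N\<^esub> x)"
    by (rule bilinear_mapI, rule linear_map_smult_const[OF N _ linear_map_ident],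
        simp add: base_algebra_def, rule linear_map_smult_left[OF linear_map_ident N])
  show ?thesis
    unfolding tensor_unit_left_def
    by (subst tensor_lift_tensor_map[OF M N b N N f _ X bil]) (simp_all add: id_def linear_map_ident)
qed

lemma tensor_unit_right_map:
  assumes M: "module K M" and N: "module K N" and f: "linear_map K N (base_algebra K) f"
    and X: "X \<in> carrier (tensor K M N)"
  shows "tensor_unit_right K M (tensor_map K M (base_algebra K) id f X)
    = tensor_lift K M (\<lambda>x y. f y \<odot>\<^bsub>M\<^esub> x) X"
proof -
  have b: "module K (base_algebra K)"
    by (rule base_algebra_module[OF module.axioms(1)[OF M]])
  have bil: "bilinear_map K M (base_algebra K) M (\<lambda>x a. a \<odot>\<^bsub>M\<^esub> x)"
    by (rule bilinear_mapI, rule linear_map_smult_left[OF linear_map_ident M], assumption,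
        rule linear_map_smult_const[OF M _ linear_map_ident]) (simp add: base_algebra_def)
  show ?thesis
    unfolding tensor_unit_right_def
    by (subst tensor_lift_tensor_map[OF M N M b M _ f X bil]) (simp_all add: id_def linear_map_ident)
qed

lemma mult_map_tensor_map:
  assumes "module K M" "module K N" "assoc_algebra K A" "linear_map K M A f" "linear_map K N A h"
    and "X \<in> carrier (tensor K M N)"
  shows "mult_map K A (tensor_map K A A f h X) = tensor_lift K A (\<lambda>x y. f x \<otimes>\<^bsub>A\<^esub> h y) X"
  unfolding mult_map_def
  by (rule tensor_lift_tensor_map[OF assms(1,2) _ _ _ assms(4-6) assoc_algebra_bilinear[OF assms(3)]])
    (rule assoc_algebra_module[OF assms(3)])+

section \<open>The coaction of C_1 on H_\<alpha> and its cleft structure\<close>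

context hopf_pi_subcoalgebra
begin

sublocale G: group G by (rule H.group)

context
  fixes \<alpha> assumes \<alpha>: "\<alpha> \<in> carrier G"
begin

private abbreviation (input) "A \<equiv> component H \<alpha>"
private abbreviation (input) "H1 \<equiv> component H \<one>\<^bsub>G\<^esub>"
private abbreviation (input) "C1 \<equiv> component C \<one>\<^bsub>G\<^esub>"
private abbreviation (input) "L \<equiv> left_coaction K H C \<sigma> \<one>\<^bsub>G\<^esub> \<alpha>"

private lemma algebras: "assoc_algebra K A" "assoc_algebra K H1" "assoc_algebra K C1"
  by (simp_all add: \<alpha> H.component_algebra C.component_algebra)

private lemmas mods = algebras[THEN assoc_algebra_module] tensor_module

text \<open>The source of \<Delta>_{1,\<alpha>} has the index 1\<alpha>, which the group law reduces
  to \<alpha>; this is how H_\<alpha> becomes a comodule over H_1.\<close>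

private lemma comult_A: "algebra_map K A (tensor K H1 A) (comult H \<one>\<^bsub>G\<^esub> \<alpha>)"
  using H.comult_algebra_map[OF G.one_closed \<alpha>] \<alpha> by simp

private lemma comult_H1: "algebra_map K H1 (tensor K H1 H1) (comult H \<one>\<^bsub>G\<^esub> \<one>\<^bsub>G\<^esub>)"
  using H.comult_algebra_map[OF G.one_closed G.one_closed] by simp

private lemma comult_C1: "algebra_map K C1 (tensor K C1 C1) (comult C \<one>\<^bsub>G\<^esub> \<one>\<^bsub>G\<^esub>)"
  using C.comult_algebra_map[OF G.one_closed G.one_closed] by simp

private lemmas \<sigma>1 = \<sigma>_algebra_map[OF G.one_closed]

private lemmas linear = algebra_map_linear[OF comult_A] algebra_map_linear[OF comult_H1]
  algebra_map_linear[OF comult_C1] algebra_map_linear[OF \<sigma>1]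

lemma left_coaction_algebra_map: "algebra_map K A (tensor K C1 A) L"
  unfolding left_coaction_def id_def
  by (rule algebra_map_compose[OF tensor_map_algebra_map comult_A]) (rule algebras \<sigma>1 algebra_map_ident)+

private lemmas L_linear = algebra_map_linear[OF left_coaction_algebra_map]

text \<open>The components of L(a) are \<sigma>(a_1) and a_2, so sums over L become sums over the
  comultiplication of H, where the axioms of H apply.\<close>

lemma tensor_lift_left_coaction:
  assumes "module K P" "bilinear_map K C1 A P b" "a \<in> carrier A"
  shows "tensor_lift K P b (L a) = tensor_lift K P (\<lambda>x y. b (\<sigma> \<one>\<^bsub>G\<^esub> x) y) (comult H \<one>\<^bsub>G\<^esub> \<alpha> a)"
  unfolding left_coaction_def id_def
  by (rule tensor_lift_tensor_map[OF mods(2,1,3,1) assms(1) linear(4) linear_map_ident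
        linear_map_closed[OF linear(1) assms(3)] assms(2)])

lemma left_coaction_counit:
  assumes a: "a \<in> carrier A"
  shows "tensor_lift K A (\<lambda>c x. counit C c \<odot>\<^bsub>A\<^esub> x) (L a) = a"
proof -
  note \<epsilon> = C.counit_linear and \<epsilon>H = H.counit_linear
  have K: "counit C c \<in> carrier K" if "c \<in> carrier C1" for c
    using linear_map_closed[OF \<epsilon> that] by (simp add: base_algebra_def)
  note rules = linear_intros linear_map_smult_left linear_map_compose[OF \<epsilon>] mods K
    linear_map_compose[OF linear(4)] linear_map_closed[OF linear(4)] linear_map_compose[OF L_linear]
  have "tensor_lift K A (\<lambda>c x. counit C c \<odot>\<^bsub>A\<^esub> x) (L a)
    = tensor_lift K A (\<lambda>x y. counit C (\<sigma> \<one>\<^bsub>G\<^esub> x) \<odot>\<^bsub>A\<^esub> y) (comult H \<one>\<^bsub>G\<^esub> \<alpha> a)"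
    by (rule tensor_lift_left_coaction[OF mods(1) _ a]) (assumption | rule rules)+
  also have "\<dots> = tensor_lift K A (\<lambda>x y. counit H x \<odot>\<^bsub>A\<^esub> y) (comult H \<one>\<^bsub>G\<^esub> \<alpha> a)"
    by (rule tensor_lift_cong[OF mods(2,1,1) linear_map_closed[OF linear(1) a]],
        (assumption | rule rules)+) (simp add: \<sigma>_counit)
  also have "\<dots> = a"
    using H.counit_left[OF \<alpha> a]
    by (simp add: tensor_unit_left_map[OF mods(2,1) \<epsilon>H linear_map_closed[OF linear(1) a]])
  finally show ?thesis .
qed

text \<open>Both sides equal \<sigma>(a_1) \<otimes> \<sigma>(a_2) \<otimes> a_3: compatibility of
  \<sigma> with comultiplication rewrites the left side, coassociativity of H regroups the
  components, and the inner sum then folds back into L.\<close>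

lemma left_coaction_coassoc:
  assumes a: "a \<in> carrier A"
  shows "tensor_assoc K C1 C1 A (tensor_map K (tensor K C1 C1) A (comult C \<one>\<^bsub>G\<^esub> \<one>\<^bsub>G\<^esub>) id (L a))
    = tensor_map K C1 (tensor K C1 A) id L (L a)"
proof -
  let ?CA = "tensor K C1 A"
  let ?W = "tensor K C1 ?CA"
  let ?s = "\<sigma> \<one>\<^bsub>G\<^esub>"
  note D = linear_map_closed[OF linear(1) a]
  note rules = linear_intros closed_intros mods linear_map_compose[OF linear(1)]
    linear_map_compose[OF linear(2)] linear_map_compose[OF linear(3)] linear_map_compose[OF linear(4)]
    linear_map_closed[OF linear(1)] linear_map_closed[OF linear(2)] linear_map_closed[OF linear(3)]
    linear_map_closed[OF linear(4)] linear_map_compose[OF L_linear] linear_map_closed[OF L_linear]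
  have "tensor_assoc K C1 C1 A (tensor_map K (tensor K C1 C1) A (comult C \<one>\<^bsub>G\<^esub> \<one>\<^bsub>G\<^esub>) id (L a))
    = tensor_lift K ?W (\<lambda>m x. tensor_lift K ?W (\<lambda>c d. pure_tensor K C1 ?CA c (pure_tensor K C1 A d x))
        (comult C \<one>\<^bsub>G\<^esub> \<one>\<^bsub>G\<^esub> m)) (L a)"
    by (rule tensor_assoc_tensor_map[OF mods(3,3,1,3) linear(3) linear_map_closed[OF L_linear a]])
  also have "\<dots> = tensor_lift K ?W (\<lambda>m x. tensor_lift K ?W
      (\<lambda>c d. pure_tensor K C1 ?CA c (pure_tensor K C1 A d x)) (comult C \<one>\<^bsub>G\<^esub> \<one>\<^bsub>G\<^esub> (?s m)))
        (comult H \<one>\<^bsub>G\<^esub> \<alpha> a)"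
    by (rule tensor_lift_left_coaction[OF _ _ a]) (assumption | rule rules)+
  also have "\<dots> = tensor_lift K ?W (\<lambda>m x. tensor_lift K ?W
      (\<lambda>c d. pure_tensor K C1 ?CA (?s c) (pure_tensor K C1 A (?s d) x)) (comult H \<one>\<^bsub>G\<^esub> \<one>\<^bsub>G\<^esub> m))
        (comult H \<one>\<^bsub>G\<^esub> \<alpha> a)"
  proof (rule tensor_lift_cong[OF mods(2,1) _ D])
    fix m x assume m: "m \<in> carrier H1" and x: "x \<in> carrier A"
    have "comult C \<one>\<^bsub>G\<^esub> \<one>\<^bsub>G\<^esub> (?s m) = tensor_map K C1 C1 ?s ?s (comult H \<one>\<^bsub>G\<^esub> \<one>\<^bsub>G\<^esub> m)"
      using \<sigma>_comult[OF G.one_closed G.one_closed, of m] m by simp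
    then show "tensor_lift K ?W (\<lambda>c d. pure_tensor K C1 ?CA c (pure_tensor K C1 A d x))
        (comult C \<one>\<^bsub>G\<^esub> \<one>\<^bsub>G\<^esub> (?s m))
      = tensor_lift K ?W (\<lambda>c d. pure_tensor K C1 ?CA (?s c) (pure_tensor K C1 A (?s d) x))
        (comult H \<one>\<^bsub>G\<^esub> \<one>\<^bsub>G\<^esub> m)"
      by (simp only:) (rule tensor_lift_tensor_map[OF mods(2,2,3,3) _ linear(4,4)
            linear_map_closed[OF linear(2) m]], (assumption | rule rules x)+)
  qed (assumption | rule rules)+
  also have "\<dots> = tensor_lift K ?W (\<lambda>y n. tensor_lift K ?W
      (\<lambda>d x. pure_tensor K C1 ?CA (?s y) (pure_tensor K C1 A (?s d) x)) (comult H \<one>\<^bsub>G\<^esub> \<alpha> n))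
        (comult H \<one>\<^bsub>G\<^esub> \<alpha> a)"
  proof (rule coassoc_eval[OF mods(2,2,1,2,1) _ linear(2,1) D D])
    show "tensor_assoc K H1 H1 A (tensor_map K (tensor K H1 H1) A (comult H \<one>\<^bsub>G\<^esub> \<one>\<^bsub>G\<^esub>) id (comult H \<one>\<^bsub>G\<^esub> \<alpha> a))
      = tensor_map K H1 (tensor K H1 A) id (comult H \<one>\<^bsub>G\<^esub> \<alpha>) (comult H \<one>\<^bsub>G\<^esub> \<alpha> a)"
      using H.coassoc[OF G.one_closed G.one_closed \<alpha>, of a] \<alpha> a by simp
  qed (assumption | rule rules)+
  also have "\<dots> = tensor_lift K ?W (\<lambda>y n. pure_tensor K C1 ?CA (?s y) (L n)) (comult H \<one>\<^bsub>G\<^esub> \<alpha> a)"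
  proof (rule tensor_lift_cong[OF mods(2,1) _ D])
    fix y n assume y: "y \<in> carrier H1" and n: "n \<in> carrier A"
    show "tensor_lift K ?W (\<lambda>d x. pure_tensor K C1 ?CA (?s y) (pure_tensor K C1 A (?s d) x)) (comult H \<one>\<^bsub>G\<^esub> \<alpha> n)
      = pure_tensor K C1 ?CA (?s y) (L n)"
      unfolding left_coaction_def tensor_map_def id_apply
      by (rule tensor_lift_commute[where T = "\<lambda>z. pure_tensor K C1 ?CA (?s y) z", symmetric,
            OF mods(2,1) _ _ _ linear_map_closed[OF linear(1) n]])
        (assumption | rule rules y)+
  qed (assumption | rule rules)+
  also have "\<dots> = tensor_lift K ?W (\<lambda>c x. pure_tensor K C1 ?CA c (L x)) (L a)"
    by (rule tensor_lift_left_coaction[symmetric, OF _ _ a]) (assumption | rule rules)+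
  also have "\<dots> = tensor_map K C1 ?CA id L (L a)"
    by (simp add: tensor_map_def)
  finally show ?thesis .
qed

text \<open>The cosection carries the section \<open>g\<^sub>1\<close> and its convolution inverse over to the component
  at \<open>\<alpha>\<close>; the other components of the section play no role.\<close>

lemma cleft_comodule_cosection:
  assumes V: "right_pi_comodule G K C V \<rho>"
    and \<eta>: "algebra_map K H1 A \<eta>"
    and \<eta>_comult: "\<And>x. x \<in> carrier H1 \<Longrightarrow>
      comult H \<one>\<^bsub>G\<^esub> \<alpha> (\<eta> x) = tensor_map K H1 A id \<eta> (comult H \<one>\<^bsub>G\<^esub> \<one>\<^bsub>G\<^esub> x)"
    and g: "linear_map K C1 H1 g" and g': "linear_map K C1 H1 g'"
    and g_g': "\<And>c. c \<in> carrier C1 \<Longrightarrow> mult_map K H1 (tensor_map K H1 H1 g g' (comult C \<one>\<^bsub>G\<^esub> \<one>\<^bsub>G\<^esub> c))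
      = counit C c \<odot>\<^bsub>H1\<^esub> \<one>\<^bsub>H1\<^esub>"
    and g'_g: "\<And>c. c \<in> carrier C1 \<Longrightarrow> mult_map K H1 (tensor_map K H1 H1 g' g (comult C \<one>\<^bsub>G\<^esub> \<one>\<^bsub>G\<^esub> c))
      = counit C c \<odot>\<^bsub>H1\<^esub> \<one>\<^bsub>H1\<^esub>"
    and g_colinear: "\<And>c. c \<in> carrier C1 \<Longrightarrow> left_coaction K H C \<sigma> \<one>\<^bsub>G\<^esub> \<one>\<^bsub>G\<^esub> (g c)
      = tensor_map K C1 H1 id g (comult C \<one>\<^bsub>G\<^esub> \<one>\<^bsub>G\<^esub> c)"
  shows "cleft_comodule K C1 A (V \<one>\<^bsub>G\<^esub>) (comult C \<one>\<^bsub>G\<^esub> \<one>\<^bsub>G\<^esub>) (counit C) L (\<rho> \<one>\<^bsub>G\<^esub> \<one>\<^bsub>G\<^esub>)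
    (\<lambda>c. \<eta> (g c)) (\<lambda>c. \<eta> (g' c))"
proof -
  interpret V: right_pi_comodule G K C V \<rho> by (rule V)
  note \<eta>l = algebra_map_linear[OF \<eta>]
  note modV = V.comodule_module[OF G.one_closed]
  have \<rho>: "linear_map K (V \<one>\<^bsub>G\<^esub>) (tensor K (V \<one>\<^bsub>G\<^esub>) C1) (\<rho> \<one>\<^bsub>G\<^esub> \<one>\<^bsub>G\<^esub>)"
    using V.coaction_linear[OF G.one_closed G.one_closed] by simp
  \<comment> \<open>As \<eta> is multiplicative and unital, composing with it preserves convolution
    identities. The claim is stated for general f and h because it is used for both orders of
    \<open>g\<close> and \<open>g'\<close>.\<close>
  have inverse: "tensor_lift K A (\<lambda>x y. \<eta> (f x) \<otimes>\<^bsub>A\<^esub> \<eta> (h y)) (comult C \<one>\<^bsub>G\<^esub> \<one>\<^bsub>G\<^esub> c)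
      = counit C c \<odot>\<^bsub>A\<^esub> \<one>\<^bsub>A\<^esub>"
    if f: "linear_map K C1 H1 f" and h: "linear_map K C1 H1 h" and c: "c \<in> carrier C1"
      and eq: "mult_map K H1 (tensor_map K H1 H1 f h (comult C \<one>\<^bsub>G\<^esub> \<one>\<^bsub>G\<^esub> c)) = counit C c \<odot>\<^bsub>H1\<^esub> \<one>\<^bsub>H1\<^esub>"
    for f h c
  proof -
    note D = linear_map_closed[OF linear(3) c]
    note rules = linear_intros mods algebras f h linear_map_compose[OF f] linear_map_compose[OF h]
      linear_map_closed[OF f] linear_map_closed[OF h] linear_map_compose[OF \<eta>l] linear_map_closed[OF \<eta>l]
    have K: "counit C c \<in> carrier K"
      using linear_map_closed[OF C.counit_linear c] by (simp add: base_algebra_def)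
    have "tensor_lift K A (\<lambda>x y. \<eta> (f x) \<otimes>\<^bsub>A\<^esub> \<eta> (h y)) (comult C \<one>\<^bsub>G\<^esub> \<one>\<^bsub>G\<^esub> c)
      = tensor_lift K A (\<lambda>x y. \<eta> (f x \<otimes>\<^bsub>H1\<^esub> h y)) (comult C \<one>\<^bsub>G\<^esub> \<one>\<^bsub>G\<^esub> c)"
      by (rule tensor_lift_cong[OF mods(3,3,1) D], (assumption | rule rules)+)
        (simp add: algebra_map_mult[OF \<eta>] linear_map_closed[OF f] linear_map_closed[OF h])
    also have "\<dots> = \<eta> (tensor_lift K H1 (\<lambda>x y. f x \<otimes>\<^bsub>H1\<^esub> h y) (comult C \<one>\<^bsub>G\<^esub> \<one>\<^bsub>G\<^esub> c))"
      by (rule tensor_lift_commute[symmetric, OF mods(3,3,2,1) \<eta>l D]) (assumption | rule rules)+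
    also have "\<dots> = \<eta> (counit C c \<odot>\<^bsub>H1\<^esub> \<one>\<^bsub>H1\<^esub>)"
      using eq by (simp add: mult_map_tensor_map[OF mods(3,3) algebras(2) f h D])
    also have "\<dots> = counit C c \<odot>\<^bsub>A\<^esub> \<one>\<^bsub>A\<^esub>"
      by (simp add: linear_map_smult[OF \<eta>l] K assoc_algebra_one_closed[OF algebras(2)] algebra_map_one[OF \<eta>])
    finally show ?thesis .
  qed
  \<comment> \<open>Colinearity of the cosection moves \<eta> to the second component of
    \<Delta>_{1,1}(g(c)). Applying \<sigma> to the first component then gives the coaction on H_1 at
    g(c), to which colinearity of g applies.\<close>
  have colinear: "L (\<eta> (g c)) = tensor_lift K (tensor K C1 A)
      (\<lambda>x y. pure_tensor K C1 A x (\<eta> (g y))) (comult C \<one>\<^bsub>G\<^esub> \<one>\<^bsub>G\<^esub> c)" if c: "c \<in> carrier C1" for c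
  proof -
    note D = linear_map_closed[OF linear(3) c]
    note gc = linear_map_closed[OF g c]
    note DH = linear_map_closed[OF linear(2) gc]
    note rules = linear_intros mods g linear_map_compose[OF \<eta>l] linear_map_closed[OF \<eta>l]
      linear_map_compose[OF linear(4)] linear_map_closed[OF linear(4)]
    let ?CA = "tensor K C1 A"
    have bil: "bilinear_map K C1 H1 ?CA (\<lambda>x y. pure_tensor K C1 A x (\<eta> y))"
      by (assumption | rule rules)+
    have "L (\<eta> (g c)) = tensor_map K C1 A (\<sigma> \<one>\<^bsub>G\<^esub>) id (tensor_map K H1 A id \<eta> (comult H \<one>\<^bsub>G\<^esub> \<one>\<^bsub>G\<^esub> (g c)))"
      by (simp add: left_coaction_def \<eta>_comult gc)
    also have "\<dots> = tensor_lift K ?CA (\<lambda>x y. pure_tensor K C1 A (\<sigma> \<one>\<^bsub>G\<^esub> x) (\<eta> y)) (comult H \<one>\<^bsub>G\<^esub> \<one>\<^bsub>G\<^esub> (g c))"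
      unfolding tensor_map_def[of K C1 A] id_def
      by (rule tensor_lift_tensor_map[OF mods(2,2,2,1) _ linear_map_ident \<eta>l DH])
        (assumption | rule rules)+
    also have "\<dots> = tensor_lift K ?CA (\<lambda>x y. pure_tensor K C1 A x (\<eta> y)) (left_coaction K H C \<sigma> \<one>\<^bsub>G\<^esub> \<one>\<^bsub>G\<^esub> (g c))"
      unfolding left_coaction_def id_def
      by (rule tensor_lift_tensor_map[symmetric, OF mods(2,2,3,2) _ linear(4) linear_map_ident DH bil])
        (assumption | rule rules)+
    also have "\<dots> = tensor_lift K ?CA (\<lambda>x y. pure_tensor K C1 A x (\<eta> (g y))) (comult C \<one>\<^bsub>G\<^esub> \<one>\<^bsub>G\<^esub> c)"
      unfolding g_colinear[OF c] id_def
      by (rule tensor_lift_tensor_map[OF mods(3,3,3,2) _ linear_map_ident g D bil])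
        (assumption | rule rules)+
    finally show ?thesis .
  qed
  show ?thesis
  proof (rule cleft_comodule.intro)
    show "tensor_assoc K (V \<one>\<^bsub>G\<^esub>) C1 C1 (tensor_map K (tensor K (V \<one>\<^bsub>G\<^esub>) C1) C1 (\<rho> \<one>\<^bsub>G\<^esub> \<one>\<^bsub>G\<^esub>) id (\<rho> \<one>\<^bsub>G\<^esub> \<one>\<^bsub>G\<^esub> v))
      = tensor_map K (V \<one>\<^bsub>G\<^esub>) (tensor K C1 C1) id (comult C \<one>\<^bsub>G\<^esub> \<one>\<^bsub>G\<^esub>) (\<rho> \<one>\<^bsub>G\<^esub> \<one>\<^bsub>G\<^esub> v)"
      if "v \<in> carrier (V \<one>\<^bsub>G\<^esub>)" for v
      using V.coaction_coassoc[OF G.one_closed G.one_closed G.one_closed, of v] that by simp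
    show "tensor_lift K (V \<one>\<^bsub>G\<^esub>) (\<lambda>w c. counit C c \<odot>\<^bsub>V \<one>\<^bsub>G\<^esub>\<^esub> w) (\<rho> \<one>\<^bsub>G\<^esub> \<one>\<^bsub>G\<^esub> v) = v"
      if v: "v \<in> carrier (V \<one>\<^bsub>G\<^esub>)" for v
      using V.coaction_counit[OF G.one_closed v]
      by (simp add: tensor_unit_right_map[OF modV mods(3) C.counit_linear linear_map_closed[OF \<rho> v]])
  qed (rule algebras modV linear(3) C.counit_linear left_coaction_algebra_map left_coaction_coassoc
      left_coaction_counit \<rho> linear_map_compose[OF \<eta>l g] linear_map_compose[OF \<eta>l g'] colinear
      inverse[OF g g' _ g_g'] inverse[OF g' g _ g'_g]; assumption)+
qed

end

end

theorem theorem3p12: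
  fixes G :: "('g, 'n) monoid_scheme" and K :: "('k, 'm) ring_scheme"
    and H :: "('g, 'k, 'h) hopf_pi_coalg" and C :: "('g, 'k, 'c) hopf_pi_coalg"
    and \<sigma> :: "'g \<Rightarrow> 'h \<Rightarrow> 'c" and g :: "'g \<Rightarrow> 'c \<Rightarrow> 'h"
    and V :: "'g \<Rightarrow> ('k, 'v) module" and \<rho> :: "'g \<Rightarrow> 'g \<Rightarrow> 'v \<Rightarrow> ('k, 'v, 'c) tensor"
  assumes "group G" and "field K"
    and "hopf_pi_coalgebra G K H"
    and "hopf_pi_subcoalgebra G K H C \<sigma>"
    and "left_section G K H C \<sigma> g"
    and "right_pi_comodule G K C V \<rho>"
    and "has_left_cosection G K H"
  shows "\<forall>\<alpha>\<in>carrier G. \<exists>\<phi>.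
    right_module_iso K (coinv G K H C \<sigma> \<alpha>)
      (tensor K (V \<one>\<^bsub>G\<^esub>) (coinv G K H C \<sigma> \<alpha>))
      (tensor_right_action K (V \<one>\<^bsub>G\<^esub>) (coinv G K H C \<sigma> \<alpha>))
      (Ind G K H C \<sigma> V \<rho> \<alpha>)
      (tensor_right_action K (V \<one>\<^bsub>G\<^esub>) (component H \<alpha>))
      \<phi>"
proof
  fix \<alpha> assume \<alpha>: "\<alpha> \<in> carrier G"
  interpret group G by fact
  interpret hopf_pi_subcoalgebra G K H C \<sigma> by fact
  let ?H1 = "component H \<one>\<^bsub>G\<^esub>" and ?C1 = "component C \<one>\<^bsub>G\<^esub>" and ?\<Delta> = "comult C \<one>\<^bsub>G\<^esub> \<one>\<^bsub>G\<^esub>"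
  obtain \<eta> where \<eta>: "algebra_map K ?H1 (component H \<alpha>) (\<eta> \<alpha>)"
    and \<eta>_comult: "\<And>x. x \<in> carrier ?H1 \<Longrightarrow> comult H \<one>\<^bsub>G\<^esub> \<alpha> (\<eta> \<alpha> x)
      = tensor_map K ?H1 (component H \<alpha>) id (\<eta> \<alpha>) (comult H \<one>\<^bsub>G\<^esub> \<one>\<^bsub>G\<^esub> x)"
    using assms(7) \<alpha> unfolding has_left_cosection_def by blast
  have g: "linear_map K ?C1 ?H1 (g \<one>\<^bsub>G\<^esub>)"
    and g_colinear: "\<And>c. c \<in> carrier ?C1 \<Longrightarrow> left_coaction K H C \<sigma> \<one>\<^bsub>G\<^esub> \<one>\<^bsub>G\<^esub> (g \<one>\<^bsub>G\<^esub> c)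
      = tensor_map K ?C1 ?H1 id (g \<one>\<^bsub>G\<^esub>) (?\<Delta> c)"
    using assms(5) one_closed unfolding left_section_def by blast+
  have "convolution_invertible G K H C g"
    using assms(5) unfolding left_section_def by blast
  then obtain g' where "\<forall>\<alpha>\<in>carrier G.
        linear_map K (component C (inv\<^bsub>G\<^esub> \<alpha>)) (component H \<alpha>) (g' \<alpha>) \<and>
        (\<forall>c\<in>carrier (component C \<one>\<^bsub>G\<^esub>).
           mult_map K (component H \<alpha>)
             (tensor_map K (component H \<alpha>) (component H \<alpha>) (g \<alpha>) (g' \<alpha>)
               (comult C \<alpha> (inv\<^bsub>G\<^esub> \<alpha>) c))
             = counit C c \<odot>\<^bsub>component H \<alpha>\<^esub> \<one>\<^bsub>component H \<alpha>\<^esub> \<and>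
           mult_map K (component H \<alpha>)
             (tensor_map K (component H \<alpha>) (component H \<alpha>) (g' \<alpha>) (g \<alpha>)
               (comult C (inv\<^bsub>G\<^esub> \<alpha>) \<alpha> c))
             = counit C c \<odot>\<^bsub>component H \<alpha>\<^esub> \<one>\<^bsub>component H \<alpha>\<^esub>)"
    unfolding convolution_invertible_def by (rule exE)
  \<comment> \<open>At the neutral element the inverse of the index is again 1, so this component of
    g' is a map from C_1 to H_1 and both convolution identities use \<Delta>_{1,1}.\<close>
  from bspec[OF this one_closed]
  have g': "linear_map K ?C1 ?H1 (g' \<one>\<^bsub>G\<^esub>)"
    and g_g': "\<And>c. c \<in> carrier ?C1 \<Longrightarrow> mult_map K ?H1 (tensor_map K ?H1 ?H1 (g \<one>\<^bsub>G\<^esub>) (g' \<one>\<^bsub>G\<^esub>) (?\<Delta> c))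
      = counit C c \<odot>\<^bsub>?H1\<^esub> \<one>\<^bsub>?H1\<^esub>"
    and g'_g: "\<And>c. c \<in> carrier ?C1 \<Longrightarrow> mult_map K ?H1 (tensor_map K ?H1 ?H1 (g' \<one>\<^bsub>G\<^esub>) (g \<one>\<^bsub>G\<^esub>) (?\<Delta> c))
      = counit C c \<odot>\<^bsub>?H1\<^esub> \<one>\<^bsub>?H1\<^esub>"
    unfolding inv_one by blast+
  interpret cleft_comodule K ?C1 "component H \<alpha>" "V \<one>\<^bsub>G\<^esub>" ?\<Delta> "counit C"
    "left_coaction K H C \<sigma> \<one>\<^bsub>G\<^esub> \<alpha>" "\<rho> \<one>\<^bsub>G\<^esub> \<one>\<^bsub>G\<^esub>" "\<lambda>c. \<eta> \<alpha> (g \<one>\<^bsub>G\<^esub> c)" "\<lambda>c. \<eta> \<alpha> (g' \<one>\<^bsub>G\<^esub> c)"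
    by (rule cleft_comodule_cosection[OF \<alpha> assms(6) \<eta> \<eta>_comult g g' g_g' g'_g g_colinear])
  show "\<exists>\<phi>. right_module_iso K (coinv G K H C \<sigma> \<alpha>)
      (tensor K (V \<one>\<^bsub>G\<^esub>) (coinv G K H C \<sigma> \<alpha>))
      (tensor_right_action K (V \<one>\<^bsub>G\<^esub>) (coinv G K H C \<sigma> \<alpha>))
      (Ind G K H C \<sigma> V \<rho> \<alpha>)
      (tensor_right_action K (V \<one>\<^bsub>G\<^esub>) (component H \<alpha>))
      \<phi>"
    \<comment> \<open>After unfolding, the two modules are literally those of the interpreted
      locale, and its \<open>ind_map\<close> is the witness.\<close>
    unfolding coinv_def Ind_def by (rule exI) (rule induced_iso[unfolded coinvariants_def induced_def])
qed

end
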